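(* Let $(M,D,g)$ be a corank-one sub-Riemannian manifold of dimension $2n+1$. Assume that the image $\alpha(M)$ of the type map $\alpha:M\to\mathbb{RP}^{n-1}$ is a submanifold of a single stratum of $\Delta^{n-1}$ and that $\alpha$ is a submersion onto $\alpha(M)$. Then the Lie groupoid $$\mathcal{G}:=\left\{\gamma_{xy}\in \mathrm{GL}^{\mathrm{gr}}(D)\ \middle|\ \gamma_{xy}:\mathrm{gr}(T_xM)\to\mathrm{gr}(T_yM)\text{ is a Lie algebra isomorphism and }\gamma_{xy}^{-1}:(D_x,g_x)\to(D_y,g_y)\text{ is an isometry}\right\}\rightrightarrows M$$ is proper, i.e. $(s,t):\mathcal{G}\to M\times M$ is a proper map.
   Context: All manifolds and maps are smooth; Lie groupoids are Hausdorff and second countable, with source $s$ and target $t$. For a corank-one distribution $D\subseteq TM$, the Levi map is $\mathcal{L}_D:D\times D\to TM/D$, $(X,Y)\mapsto[X,Y]\bmod D$. $D$ is a corank-one structure if $\mathcal{L}_D$ is non-zero at every point. A corank-one sub-Riemannian manifold $(M,D,g)$ is a manifold with a corank-one structure $D$ and a Riemannian metric $g$ on the vector bundle $D$. $\mathrm{gr}(T_xM)=T_xM/D_x\oplus D_x$ is the graded nilpotent Lie algebra with $D_x$ in degree $-1$, $T_xM/D_x$ in degree $-2$ (central), and bracket on $D_x$ given by $\mathcal{L}_D$ at $x$. $\mathrm{GL}^{\mathrm{gr}}(D)\rightrightarrows M$ is the transitive Lie groupoid of all isomorphisms of graded vector spaces $\gamma_{xy}:\mathrm{gr}(T_xM)\to\mathrm{gr}(T_yM)$,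 i.e. pairs of linear isomorphisms $\gamma_{xy}^{-1}:D_x\to D_y$, $\gamma_{xy}^{-2}:T_xM/D_x\to T_yM/D_y$ (superscripts denote degree, not inverse), with source $x$, target $y$ and composition as multiplication. Under the stated hypotheses on $\alpha$, $\mathcal G$ is a Lie subgroupoid of $\mathrm{GL}^{\mathrm{gr}}(D)$. Type map: near $x$ write $D=\ker\theta$ and define $J:D\to D$ by $d\theta(X,Y)=g(JX,Y)$. $J_x$ is $g_x$-skew-symmetric with eigenvalues (with multiplicity) $\pm i\alpha_j^x$, $0\le\alpha_1^x\le\dots\le\alpha_n^x$, not all zero. The type is $\alpha(x)=[\alpha_1^x:\dots:\alpha_n^x]\in\mathbb{RP}^{n-1}$; it is independent of $\theta$. It takes values in $\Delta^{n-1}=\{0\le\lambda_1\le\dots\le\lambda_n,\ \sum\lambda_i=1\}$, identified with its image in $\mathbb{RP}^{n-1}$ under $\lambda\mapsto[\lambda_1:\dots:\lambda_n]$. The strata of $\Delta^{n-1}$ are its open faces: two points are in the same stratum iff the same equalities hold among $0\le\lambda_1\le\dots\le\lambda_n$. *)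

theory Defs
  imports
    "HOL-Analysis.Analysis"
    "HOL-Library.Function_Algebras"
    "Jordan_Normal_Form.Char_Poly"
begin

section \<open>Smooth maps between Euclidean spaces\<close>

text \<open>Only used for open sets \<open>S\<close>.\<close>

primrec Ck_on :: "nat \<Rightarrow> 'a::real_normed_vector set \<Rightarrow> ('a \<Rightarrow> 'b::real_normed_vector) \<Rightarrow> bool" where
  "Ck_on 0 S f \<longleftrightarrow> continuous_on S f"
| "Ck_on (Suc k) S f \<longleftrightarrow> (\<forall>x\<in>S. f differentiable (at x)) \<and>
     (\<forall>v. Ck_on k S (\<lambda>x. frechet_derivative f (at x) v))"

definition smooth_on :: "'a::real_normed_vector set \<Rightarrow> ('a \<Rightarrow> 'b::real_normed_vector) \<Rightarrow> bool" where
  "smooth_on S f \<longleftrightarrow> (\<forall>k. Ck_on k S f)"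

section \<open>Smooth manifolds\<close>

text \<open>A chart is a domain together with a coordinate map into the model space \<open>'e\<close>; the values of the
  coordinate map outside the domain are irrelevant.\<close>

type_synonym ('m, 'e) chart = "'m set \<times> ('m \<Rightarrow> 'e)"

abbreviation chart_inv :: "('m, 'e) chart \<Rightarrow> 'e \<Rightarrow> 'm" where
  "chart_inv c \<equiv> inv_into (fst c) (snd c)"

record ('m, 'e) manifold =
  mtop :: "'m topology"
  atlas :: "('m, 'e) chart set"

abbreviation points :: "('m, 'e) manifold \<Rightarrow> 'm set" where
  "points M \<equiv> topspace (mtop M)"

abbreviation charts_at :: "('m, 'e) manifold \<Rightarrow> 'm \<Rightarrow> ('m, 'e) chart set" where
  "charts_at M x \<equiv> {c \<in> atlas M. x \<in> fst c}"

text \<open>The atlas need not be maximal; all notions below depend only on the smooth structure it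
  generates.\<close>

definition smooth_manifold :: "('m, 'e::euclidean_space) manifold \<Rightarrow> bool" where
  "smooth_manifold M \<longleftrightarrow>
     Hausdorff_space (mtop M) \<and> second_countable (mtop M) \<and>
     (\<Union>c\<in>atlas M. fst c) = points M \<and>
     (\<forall>c\<in>atlas M. openin (mtop M) (fst c) \<and> open (snd c ` fst c) \<and>
        homeomorphic_map (subtopology (mtop M) (fst c)) (top_of_set (snd c ` fst c)) (snd c)) \<and>
     (\<forall>c\<in>atlas M. \<forall>c'\<in>atlas M. smooth_on (snd c ` (fst c \<inter> fst c')) (snd c' \<circ> chart_inv c))"

definition smooth_fun_on ::
  "('m, 'e::euclidean_space) manifold \<Rightarrow> 'm set \<Rightarrow> ('m \<Rightarrow> 'b::real_normed_vector) \<Rightarrow> bool" where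
  "smooth_fun_on M U f \<longleftrightarrow> (\<forall>c\<in>atlas M. smooth_on (snd c ` (U \<inter> fst c)) (f \<circ> chart_inv c))"

subsection \<open>Tangent vectors, vector fields, one-forms\<close>

text \<open>A tangent vector at \<open>x\<close> is the family of its coordinate vectors in all charts around \<open>x\<close>, related by
  the derivatives of the transition maps. The family is set to \<open>0\<close> at all other charts, so that the
  tangent space is a linear subspace of the function space below, isomorphic to \<open>'e\<close> via each
  chart around \<open>x\<close>.\<close>

instantiation "fun" :: (type, real_vector) real_vector
begin

definition scaleR_fun :: "real \<Rightarrow> ('a \<Rightarrow> 'b) \<Rightarrow> 'a \<Rightarrow> 'b" where
  "scaleR_fun a f = (\<lambda>x. a *\<^sub>R f x)"

instance
  by standard (auto simp: scaleR_fun_def fun_eq_iff algebra_simps)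

end

type_synonym ('m, 'e) tvec = "('m, 'e) chart \<Rightarrow> 'e"

definition tangent_space :: "('m, 'e::euclidean_space) manifold \<Rightarrow> 'm \<Rightarrow> ('m, 'e) tvec set" where
  "tangent_space M x =
     {v. (\<forall>c\<in>charts_at M x. \<forall>c'\<in>charts_at M x.
            v c' = frechet_derivative (snd c' \<circ> chart_inv c) (at (snd c x)) (v c)) \<and>
         (\<forall>c. c \<notin> charts_at M x \<longrightarrow> v c = 0)}"

text \<open>The tangent vector at \<open>x\<close> with coordinate vector \<open>e\<close> in the chart \<open>c\<close>.\<close>

definition tvec_of :: "('m, 'e::euclidean_space) manifold \<Rightarrow> ('m, 'e) chart \<Rightarrow> 'm \<Rightarrow> 'e \<Rightarrow> ('m, 'e) tvec" where
  "tvec_of M c x e =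
     (\<lambda>c'. if c' \<in> charts_at M x
           then frechet_derivative (snd c' \<circ> chart_inv c) (at (snd c x)) e else 0)"

definition smooth_vector_field ::
  "('m, 'e::euclidean_space) manifold \<Rightarrow> 'm set \<Rightarrow> ('m \<Rightarrow> ('m, 'e) tvec) \<Rightarrow> bool" where
  "smooth_vector_field M U V \<longleftrightarrow>
     (\<forall>x\<in>U. V x \<in> tangent_space M x) \<and>
     (\<forall>c\<in>atlas M. smooth_on (snd c ` (U \<inter> fst c)) (\<lambda>p. V (chart_inv c p) c))"

text \<open>In each chart: \<open>[V,W] = DW(V) - DV(W)\<close>.\<close>

definition lie_bracket ::
  "('m, 'e::euclidean_space) manifold \<Rightarrow> ('m \<Rightarrow> ('m, 'e) tvec) \<Rightarrow> ('m \<Rightarrow> ('m, 'e) tvec) \<Rightarrow> 'm \<Rightarrow> ('m, 'e) tvec" where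
  "lie_bracket M V W x =
     (\<lambda>c. if c \<in> charts_at M x
          then frechet_derivative (\<lambda>p. W (chart_inv c p) c) (at (snd c x)) (V x c)
             - frechet_derivative (\<lambda>p. V (chart_inv c p) c) (at (snd c x)) (W x c)
          else 0)"

definition linear_on_subspace :: "'a::real_vector set \<Rightarrow> ('a \<Rightarrow> 'b::real_vector) \<Rightarrow> bool" where
  "linear_on_subspace S f \<longleftrightarrow>
     (\<forall>v\<in>S. \<forall>w\<in>S. \<forall>a b. f (a *\<^sub>R v + b *\<^sub>R w) = a *\<^sub>R f v + b *\<^sub>R f w)"

definition smooth_one_form ::
  "('m, 'e::euclidean_space) manifold \<Rightarrow> 'm set \<Rightarrow> ('m \<Rightarrow> ('m, 'e) tvec \<Rightarrow> real) \<Rightarrow> bool" where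
  "smooth_one_form M U \<theta> \<longleftrightarrow>
     (\<forall>x\<in>U. linear_on_subspace (tangent_space M x) (\<theta> x)) \<and>
     (\<forall>c\<in>atlas M. \<forall>e. smooth_on (snd c ` (U \<inter> fst c))
        (\<lambda>p. \<theta> (chart_inv c p) (tvec_of M c (chart_inv c p) e)))"

text \<open>\<open>d\<theta>(v,w) = \<partial>\<^sub>v(\<theta>(w)) - \<partial>\<^sub>w(\<theta>(v))\<close> for vector fields with constant coordinates in a chart; the value
  does not depend on the chart.\<close>

definition ext_deriv ::
  "('m, 'e::euclidean_space) manifold \<Rightarrow> ('m \<Rightarrow> ('m, 'e) tvec \<Rightarrow> real) \<Rightarrow> 'm \<Rightarrow> ('m, 'e) tvec \<Rightarrow> ('m, 'e) tvec \<Rightarrow> real" where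
  "ext_deriv M \<theta> x v w =
     (let c = (SOME c. c \<in> charts_at M x);
          \<theta>c = (\<lambda>e p. \<theta> (chart_inv c p) (tvec_of M c (chart_inv c p) e))
      in frechet_derivative (\<theta>c (w c)) (at (snd c x)) (v c)
       - frechet_derivative (\<theta>c (v c)) (at (snd c x)) (w c))"

subsection \<open>Submanifolds of Euclidean space and submersions onto them\<close>

definition embedded_submanifold :: "nat \<Rightarrow> 'v::euclidean_space set \<Rightarrow> bool" where
  "embedded_submanifold k N \<longleftrightarrow>
     (\<forall>p\<in>N. \<exists>U \<phi> \<psi> L. open U \<and> p \<in> U \<and> open (\<phi> ` U) \<and>
        smooth_on U (\<phi> :: 'v \<Rightarrow> 'v) \<and> smooth_on (\<phi> ` U) \<psi> \<and> (\<forall>u\<in>U. \<psi> (\<phi> u) = u) \<and>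
        subspace L \<and> dim L = k \<and> \<phi> ` (U \<inter> N) = \<phi> ` U \<inter> L)"

definition velocity_space :: "'v::euclidean_space set \<Rightarrow> 'v \<Rightarrow> 'v set" where
  "velocity_space N p =
     {v. \<exists>\<gamma> \<epsilon>. 0 < \<epsilon> \<and> smooth_on {-\<epsilon><..<\<epsilon>} \<gamma> \<and> \<gamma> ` {-\<epsilon><..<\<epsilon>} \<subseteq> N \<and> \<gamma> 0 = p \<and>
        (\<gamma> has_vector_derivative v) (at (0::real))}"

definition submersion_onto ::
  "('m, 'e::euclidean_space) manifold \<Rightarrow> ('m \<Rightarrow> 'v::euclidean_space) \<Rightarrow> 'v set \<Rightarrow> bool" where
  "submersion_onto M f N \<longleftrightarrow>
     f ` points M = N \<and> smooth_fun_on M (points M) f \<and>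
     (\<forall>x\<in>points M. \<forall>c\<in>charts_at M x.
        (\<lambda>v. frechet_derivative (f \<circ> chart_inv c) (at (snd c x)) (v c)) ` tangent_space M x
          = velocity_space N (f x))"

section \<open>Corank-one sub-Riemannian manifolds\<close>

text \<open>A distribution assigns to each point a subspace of the tangent space.\<close>

type_synonym ('m, 'e) distr = "'m \<Rightarrow> ('m, 'e) tvec set"

definition smooth_section ::
  "('m, 'e::euclidean_space) manifold \<Rightarrow> ('m, 'e) distr \<Rightarrow> 'm set \<Rightarrow> ('m \<Rightarrow> ('m, 'e) tvec) \<Rightarrow> bool" where
  "smooth_section M D U V \<longleftrightarrow> smooth_vector_field M U V \<and> (\<forall>x\<in>U. V x \<in> D x)"

definition basis_of :: "'a::real_vector set \<Rightarrow> nat \<Rightarrow> (nat \<Rightarrow> 'a) \<Rightarrow> bool" where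
  "basis_of S r b \<longleftrightarrow> inj_on b {..<r} \<and> independent (b ` {..<r}) \<and> span (b ` {..<r}) = S"

definition local_frame ::
  "('m, 'e::euclidean_space) manifold \<Rightarrow> ('m, 'e) distr \<Rightarrow> nat \<Rightarrow> 'm set \<Rightarrow> (nat \<Rightarrow> 'm \<Rightarrow> ('m, 'e) tvec) \<Rightarrow> bool" where
  "local_frame M D r U E \<longleftrightarrow> openin (mtop M) U \<and>
     (\<forall>i<r. smooth_section M D U (E i)) \<and> (\<forall>x\<in>U. basis_of (D x) r (\<lambda>i. E i x))"

definition corank_one_distribution ::
  "('m, 'e::euclidean_space) manifold \<Rightarrow> ('m, 'e) distr \<Rightarrow> bool" where
  "corank_one_distribution M D \<longleftrightarrow>
     (\<forall>x\<in>points M. subspace (D x) \<and> D x \<subseteq> tangent_space M x) \<and>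
     (\<forall>x\<in>points M. \<exists>U E. x \<in> U \<and> local_frame M D (DIM('e) - 1) U E)"

text \<open>\<open>TM/D\<close> at \<open>x\<close> is the set of cosets of \<open>D x\<close> in the tangent space, with the quotient operations.\<close>

definition coset :: "'a::real_vector set \<Rightarrow> 'a \<Rightarrow> 'a set" where
  "coset K v = {v + d | d. d \<in> K}"

definition coset_add :: "'a::real_vector set \<Rightarrow> 'a set \<Rightarrow> 'a set" where
  "coset_add P Q = {p + q | p q. p \<in> P \<and> q \<in> Q}"

definition coset_scale :: "'a::real_vector set \<Rightarrow> real \<Rightarrow> 'a set \<Rightarrow> 'a set" where
  "coset_scale K a P = {a *\<^sub>R p + d | p d. p \<in> P \<and> d \<in> K}"

definition normal_space ::
  "('m, 'e::euclidean_space) manifold \<Rightarrow> ('m, 'e) distr \<Rightarrow> 'm \<Rightarrow> ('m, 'e) tvec set set" where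
  "normal_space M D x = coset (D x) ` tangent_space M x"

text \<open>The Levi map at \<open>x\<close>: extend both vectors to local sections of \<open>D\<close>; by tensoriality the bracket modulo
  \<open>D\<close> at \<open>x\<close> does not depend on the extensions.\<close>

definition levi ::
  "('m, 'e::euclidean_space) manifold \<Rightarrow> ('m, 'e) distr \<Rightarrow> 'm \<Rightarrow> ('m, 'e) tvec \<Rightarrow> ('m, 'e) tvec \<Rightarrow> ('m, 'e) tvec set" where
  "levi M D x v w =
     (THE q. \<exists>U V W. openin (mtop M) U \<and> x \<in> U \<and>
        smooth_section M D U V \<and> smooth_section M D U W \<and> V x = v \<and> W x = w \<and>
        q = coset (D x) (lie_bracket M V W x))"

definition corank_one_structure ::
  "('m, 'e::euclidean_space) manifold \<Rightarrow> ('m, 'e) distr \<Rightarrow> bool" where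
  "corank_one_structure M D \<longleftrightarrow> corank_one_distribution M D \<and>
     (\<forall>x\<in>points M. \<exists>v\<in>D x. \<exists>w\<in>D x. levi M D x v w \<noteq> coset (D x) 0)"

type_synonym ('m, 'e) metric = "'m \<Rightarrow> ('m, 'e) tvec \<Rightarrow> ('m, 'e) tvec \<Rightarrow> real"

definition riemannian_metric_on ::
  "('m, 'e::euclidean_space) manifold \<Rightarrow> ('m, 'e) distr \<Rightarrow> ('m, 'e) metric \<Rightarrow> bool" where
  "riemannian_metric_on M D g \<longleftrightarrow>
     (\<forall>x\<in>points M.
        (\<forall>v\<in>D x. linear_on_subspace (D x) (g x v)) \<and>
        (\<forall>v\<in>D x. \<forall>w\<in>D x. g x v w = g x w v) \<and>
        (\<forall>v\<in>D x. v \<noteq> 0 \<longrightarrow> 0 < g x v v)) \<and>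
     (\<forall>U V W. openin (mtop M) U \<and> smooth_section M D U V \<and> smooth_section M D U W \<longrightarrow>
        smooth_fun_on M U (\<lambda>x. g x (V x) (W x)))"

definition corank_one_sub_riemannian ::
  "('m, 'e::euclidean_space) manifold \<Rightarrow> ('m, 'e) distr \<Rightarrow> ('m, 'e) metric \<Rightarrow> bool" where
  "corank_one_sub_riemannian M D g \<longleftrightarrow>
     smooth_manifold M \<and> corank_one_structure M D \<and> riemannian_metric_on M D g"

section \<open>The type map\<close>

text \<open>\<open>m\<close> is the multiset of complex eigenvalues, with algebraic multiplicity, of the endomorphism \<open>J\<close> of the
  real vector space \<open>S\<close>; \<open>A\<close> is the matrix of \<open>J\<close> in a basis of \<open>S\<close>.\<close>

definition has_eigenvalues ::
  "'a::real_vector set \<Rightarrow> ('a \<Rightarrow> 'a) \<Rightarrow> complex multiset \<Rightarrow> bool" where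
  "has_eigenvalues S J m \<longleftrightarrow>
     (\<exists>r b A. basis_of S r b \<and> A \<in> carrier_mat r r \<and>
        (\<forall>j<r. J (b j) = (\<Sum>i<r. (A $$ (i, j)) *\<^sub>R b i)) \<and>
        m = proots (char_poly (map_mat complex_of_real A)))"

definition type_representative ::
  "('m, 'e::euclidean_space) manifold \<Rightarrow> ('m, 'e) distr \<Rightarrow> ('m, 'e) metric \<Rightarrow> 'm
     \<Rightarrow> real ^ 'n::{finite,linorder} \<Rightarrow> bool" where
  "type_representative M D g x a \<longleftrightarrow>
     (\<forall>i. 0 \<le> a $ i) \<and> (\<forall>i j. i \<le> j \<longrightarrow> a $ i \<le> a $ j) \<and>
     (\<exists>U \<theta> J. openin (mtop M) U \<and> x \<in> U \<and> smooth_one_form M U \<theta> \<and>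
        (\<forall>y\<in>U. D y = {v \<in> tangent_space M y. \<theta> y v = 0}) \<and>
        J ` D x \<subseteq> D x \<and> linear_on_subspace (D x) J \<and>
        (\<forall>v\<in>D x. \<forall>w\<in>D x. ext_deriv M \<theta> x v w = g x (J v) w) \<and>
        has_eigenvalues (D x) J
          (\<Sum>j\<in>UNIV. {# \<i> * complex_of_real (a $ j), - \<i> * complex_of_real (a $ j) #}))"

text \<open>Points of real projective space are lines through the origin of \<open>\<real>\<^sup>n\<close>; this is the point with
  homogeneous coordinates \<open>a \<noteq> 0\<close>.\<close>

definition proj_point :: "real ^ 'n \<Rightarrow> (real ^ 'n) set" where
  "proj_point a = span {a}"

text \<open>The value is independent of the choice of \<open>\<theta>\<close>, which only rescales the representative.\<close>

definition type_map ::
  "('m, 'e::euclidean_space) manifold \<Rightarrow> ('m, 'e) distr \<Rightarrow> ('m, 'e) metric \<Rightarrow> 'm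
     \<Rightarrow> (real ^ 'n::{finite,linorder}) set" where
  "type_map M D g x = (THE l. \<exists>a. type_representative M D g x a \<and> l = proj_point a)"

definition ordered_simplex :: "(real ^ 'n::{finite,linorder}) set" where
  "ordered_simplex = {l. (\<forall>i. 0 \<le> l $ i) \<and> (\<forall>i j. i \<le> j \<longrightarrow> l $ i \<le> l $ j) \<and> (\<Sum>i\<in>UNIV. l $ i) = 1}"

definition same_stratum :: "real ^ 'n \<Rightarrow> real ^ 'n \<Rightarrow> bool" where
  "same_stratum l m \<longleftrightarrow>
     (\<forall>i. l $ i = 0 \<longleftrightarrow> m $ i = 0) \<and> (\<forall>i j. l $ i = l $ j \<longleftrightarrow> m $ i = m $ j)"

definition simplex_strata :: "(real ^ 'n::{finite,linorder}) set set" where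
  "simplex_strata =
     ordered_simplex // {(l, m). l \<in> ordered_simplex \<and> m \<in> ordered_simplex \<and> same_stratum l m}"

text \<open>The type map read in the simplex through the identification \<open>l \<mapsto> [l]\<close> of the simplex with its
  image in projective space.\<close>

definition simplex_type_map ::
  "('m, 'e::euclidean_space) manifold \<Rightarrow> ('m, 'e) distr \<Rightarrow> ('m, 'e) metric \<Rightarrow> 'm
     \<Rightarrow> real ^ 'n::{finite,linorder}" where
  "simplex_type_map M D g x = the_inv_into ordered_simplex proj_point (type_map M D g x)"

section \<open>The groupoids\<close>

text \<open>The Lie algebra \<open>gr(T\<^sub>xM)\<close>; the first component has degree \<open>-2\<close>, the second degree \<open>-1\<close>.\<close>

definition gr_space ::
  "('m, 'e::euclidean_space) manifold \<Rightarrow> ('m, 'e) distr \<Rightarrow> 'm \<Rightarrow> (('m, 'e) tvec set \<times> ('m, 'e) tvec) set" where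
  "gr_space M D x = normal_space M D x \<times> D x"

definition gr_bracket ::
  "('m, 'e::euclidean_space) manifold \<Rightarrow> ('m, 'e) distr \<Rightarrow> 'm
     \<Rightarrow> ('m, 'e) tvec set \<times> ('m, 'e) tvec \<Rightarrow> ('m, 'e) tvec set \<times> ('m, 'e) tvec
     \<Rightarrow> ('m, 'e) tvec set \<times> ('m, 'e) tvec" where
  "gr_bracket M D x p q = (levi M D x (snd p) (snd q), 0)"

text \<open>An arrow; \<open>deg1\<close> and \<open>deg2\<close> are the components of degree \<open>-1\<close> and \<open>-2\<close>.\<close>

record ('m, 'e) gr_arrow =
  src :: 'm
  tgt :: 'm
  deg1 :: "('m, 'e) tvec \<Rightarrow> ('m, 'e) tvec"
  deg2 :: "('m, 'e) tvec set \<Rightarrow> ('m, 'e) tvec set"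

text \<open>The components are normalised outside their domains by extensionality.\<close>

definition GL_gr ::
  "('m, 'e::euclidean_space) manifold \<Rightarrow> ('m, 'e) distr \<Rightarrow> ('m, 'e) gr_arrow set" where
  "GL_gr M D =
     {\<gamma>. src \<gamma> \<in> points M \<and> tgt \<gamma> \<in> points M \<and>
        deg1 \<gamma> \<in> extensional (D (src \<gamma>)) \<and>
        bij_betw (deg1 \<gamma>) (D (src \<gamma>)) (D (tgt \<gamma>)) \<and>
        linear_on_subspace (D (src \<gamma>)) (deg1 \<gamma>) \<and>
        deg2 \<gamma> \<in> extensional (normal_space M D (src \<gamma>)) \<and>
        bij_betw (deg2 \<gamma>) (normal_space M D (src \<gamma>)) (normal_space M D (tgt \<gamma>)) \<and>
        (\<forall>P\<in>normal_space M D (src \<gamma>). \<forall>Q\<in>normal_space M D (src \<gamma>).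
           deg2 \<gamma> (coset_add P Q) = coset_add (deg2 \<gamma> P) (deg2 \<gamma> Q)) \<and>
        (\<forall>P\<in>normal_space M D (src \<gamma>). \<forall>a.
           deg2 \<gamma> (coset_scale (D (src \<gamma>)) a P) = coset_scale (D (tgt \<gamma>)) a (deg2 \<gamma> P))}"

text \<open>A local frame \<open>E\<close> of \<open>D\<close> together with a transverse vector field \<open>Z\<close>, whose class is a local frame of
  \<open>TM/D\<close>.\<close>

definition adapted_frame ::
  "('m, 'e::euclidean_space) manifold \<Rightarrow> ('m, 'e) distr \<Rightarrow> 'm set
     \<Rightarrow> (nat \<Rightarrow> 'm \<Rightarrow> ('m, 'e) tvec) \<Rightarrow> ('m \<Rightarrow> ('m, 'e) tvec) \<Rightarrow> bool" where
  "adapted_frame M D U E Z \<longleftrightarrow> local_frame M D (DIM('e) - 1) U E \<and>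
     smooth_vector_field M U Z \<and> (\<forall>x\<in>U. Z x \<notin> D x)"

text \<open>Given adapted frames \<open>(E,Z)\<close> over \<open>U\<close> and \<open>(E',Z')\<close> over \<open>U'\<close>, an arrow from \<open>x \<in> U\<close> to \<open>y \<in> U'\<close> is
  described by its matrix \<open>a\<close> in degree \<open>-1\<close> and its scalar \<open>b\<close> in degree \<open>-2\<close>. These local
  trivialisations \<open>\<gamma> \<mapsto> (x, y, a, b)\<close>, with values in \<open>U \<times> U' \<times> GL\<^sub>2\<^sub>n \<times> GL\<^sub>1\<close>, are the ones that define the
  manifold structure of \<open>GL_gr\<close>; its topology is generated by their inverse images of open sets.\<close>

abbreviation (input) trivialisation_space ::
  "('m, 'e::euclidean_space) manifold \<Rightarrow> ('m \<times> 'm \<times> (nat \<times> nat \<Rightarrow> real) \<times> real) topology" where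
  "trivialisation_space M \<equiv>
     prod_topology (mtop M) (prod_topology (mtop M)
       (prod_topology (product_topology (\<lambda>_. euclideanreal) ({..<DIM('e) - 1} \<times> {..<DIM('e) - 1}))
         euclideanreal))"

definition trivialisation_preimage ::
  "('m, 'e::euclidean_space) manifold \<Rightarrow> ('m, 'e) distr
     \<Rightarrow> 'm set \<Rightarrow> (nat \<Rightarrow> 'm \<Rightarrow> ('m, 'e) tvec) \<Rightarrow> ('m \<Rightarrow> ('m, 'e) tvec)
     \<Rightarrow> 'm set \<Rightarrow> (nat \<Rightarrow> 'm \<Rightarrow> ('m, 'e) tvec) \<Rightarrow> ('m \<Rightarrow> ('m, 'e) tvec)
     \<Rightarrow> ('m \<times> 'm \<times> (nat \<times> nat \<Rightarrow> real) \<times> real) set \<Rightarrow> ('m, 'e) gr_arrow set" where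
  "trivialisation_preimage M D U E Z U' E' Z' W =
     {\<gamma> \<in> GL_gr M D. src \<gamma> \<in> U \<and> tgt \<gamma> \<in> U' \<and>
        (\<exists>a b. (src \<gamma>, tgt \<gamma>, a, b) \<in> W \<and>
           (\<forall>j<DIM('e) - 1. deg1 \<gamma> (E j (src \<gamma>)) = (\<Sum>i<DIM('e) - 1. a (i, j) *\<^sub>R E' i (tgt \<gamma>))) \<and>
           deg2 \<gamma> (coset (D (src \<gamma>)) (Z (src \<gamma>))) = coset (D (tgt \<gamma>)) (b *\<^sub>R Z' (tgt \<gamma>)))}"

definition GL_gr_topology ::
  "('m, 'e::euclidean_space) manifold \<Rightarrow> ('m, 'e) distr \<Rightarrow> ('m, 'e) gr_arrow topology" where
  "GL_gr_topology M D = topology_generated_by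
     {trivialisation_preimage M D U E Z U' E' Z' W | U E Z U' E' Z' W.
        adapted_frame M D U E Z \<and> adapted_frame M D U' E' Z' \<and> openin (trivialisation_space M) W}"

definition isometry_groupoid ::
  "('m, 'e::euclidean_space) manifold \<Rightarrow> ('m, 'e) distr \<Rightarrow> ('m, 'e) metric \<Rightarrow> ('m, 'e) gr_arrow set" where
  "isometry_groupoid M D g =
     {\<gamma> \<in> GL_gr M D.
        (\<forall>p\<in>gr_space M D (src \<gamma>). \<forall>q\<in>gr_space M D (src \<gamma>).
           map_prod (deg2 \<gamma>) (deg1 \<gamma>) (gr_bracket M D (src \<gamma>) p q)
             = gr_bracket M D (tgt \<gamma>) (map_prod (deg2 \<gamma>) (deg1 \<gamma>) p) (map_prod (deg2 \<gamma>) (deg1 \<gamma>) q)) \<and>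
        (\<forall>v\<in>D (src \<gamma>). \<forall>w\<in>D (src \<gamma>). g (tgt \<gamma>) (deg1 \<gamma> v) (deg1 \<gamma> w) = g (src \<gamma>) v w)}"

text \<open>As a Lie subgroupoid of \<open>GL_gr\<close> it carries the subspace topology.\<close>

definition isometry_groupoid_topology ::
  "('m, 'e::euclidean_space) manifold \<Rightarrow> ('m, 'e) distr \<Rightarrow> ('m, 'e) metric \<Rightarrow> ('m, 'e) gr_arrow topology" where
  "isometry_groupoid_topology M D g = subtopology (GL_gr_topology M D) (isometry_groupoid M D g)"

end

theory Submission
  imports Defs
begin

text \<open>Choose local frames of \<open>D\<close> and of \<open>TM/D\<close> near \<open>x\<close> and near \<open>y\<close>. An arrow from \<open>x\<close> to \<open>y\<close> becomes a pair
  \<open>(a, b)\<close> of a matrix and a scalar. It is an isometry iff \<open>a\<close> carries the Gram matrix at \<open>x\<close> to the one at \<open>y\<close>,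
  which is a closed condition and bounds \<open>a\<close>; it is a Lie algebra morphism iff \<open>b \<L>\<^sub>x = a\<^sup>* \<L>\<^sub>y\<close>. Since the Levi
  map does not vanish at \<open>x\<close>, this bounds \<open>b\<close>, and since it does not vanish at \<open>y\<close>, it forces \<open>b \<noteq> 0\<close>.
  Hence the arrows over a product of two small compact sets form a compact set, and finitely many
  such products cover a given compact subset of \<open>M \<times> M\<close>.\<close>

section \<open>Calculus of smooth maps\<close>

text \<open>The bound on \<open>a\<close> has to be uniform over a pair of compact sets; it comes
  from the positive minimum of the Gram form at the target over a compact set times a unit sphere.
  The bound on \<open>b\<close> divides by one Levi coefficient, so the compact set around
  \<open>x\<close> is shrunk until that coefficient has no zero on it. Two obstacles lie before
  this. First, \<open>levi\<close> is a definite description over all extensions, and nothing can be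
  computed from it until the bracket modulo \<open>D\<close> is known to depend on the values at the
  point alone; for the bracket to be a tangent vector at all, the second derivatives of the
  transition maps must cancel, whence the symmetry of second derivatives. Second, the topology of
  \<open>GL_gr\<close> is generated by the trivialisations in all adapted frames, so compactness in
  the coordinates of one pair of frames passes to arrows only through continuity of the changes of
  frames. Continuity of frame coefficients throughout rests on a perturbation bound for coordinates
  in a moving basis.\<close>

lemma Ck_on_subset: "Ck_on k S f \<Longrightarrow> T \<subseteq> S \<Longrightarrow> Ck_on k T f"
  by (induction k arbitrary: f) (auto intro: continuous_on_subset)

lemma frechet_derivative_cong_open:
  assumes "open S" "x \<in> S" "\<And>y. y \<in> S \<Longrightarrow> f y = g y"
  shows "frechet_derivative f (at x) = frechet_derivative g (at x)"
proof -
  have "(f has_derivative d) (at x) \<longleftrightarrow> (g has_derivative d) (at x)" for d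
    using has_derivative_transform_within_open[of f d x UNIV S g]
      has_derivative_transform_within_open[of g d x UNIV S f] assms by auto
  then show ?thesis by (simp add: frechet_derivative_def)
qed

lemma differentiable_cong_open:
  assumes "open S" "x \<in> S" "\<And>y. y \<in> S \<Longrightarrow> f y = g y" "f differentiable (at x)"
  shows "g differentiable (at x)"
  using assms has_derivative_transform_within_open[of f _ x UNIV S g]
  unfolding differentiable_def by blast

lemma Ck_on_cong:
  assumes "open S"
  shows "(\<And>x. x \<in> S \<Longrightarrow> f x = g x) \<Longrightarrow> Ck_on k S f \<Longrightarrow> Ck_on k S g"
proof (induction k arbitrary: f g)
  case 0
  then show ?case using continuous_on_cong[of S S f g] by simp
next
  case (Suc k)
  have "frechet_derivative f (at x) = frechet_derivative g (at x)" if "x \<in> S" for x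
    using frechet_derivative_cong_open[OF assms that, of f g] Suc.prems by blast
  then have "Ck_on k S (\<lambda>x. frechet_derivative g (at x) v)" for v
    using Suc.IH[of "\<lambda>x. frechet_derivative f (at x) v" "\<lambda>x. frechet_derivative g (at x) v"]
      Suc.prems by simp
  moreover have "g differentiable at x" if "x \<in> S" for x
    using differentiable_cong_open[OF assms that, of f g] Suc.prems that by auto
  ultimately show ?case by simp
qed

lemma Ck_on_SucD: "Ck_on (Suc k) S f \<Longrightarrow> Ck_on k S f"
proof (induction k arbitrary: f)
  case 0
  then show ?case
    by (auto intro!: continuous_at_imp_continuous_on differentiable_imp_continuous_within)
next
  case (Suc k)
  then show ?case by (metis Ck_on.simps(2))
qed

lemma has_frechet_derivative:
  "f differentiable (at x) \<Longrightarrow> (f has_derivative frechet_derivative f (at x)) (at x)"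
  by (simp add: frechet_derivative_works)

lemma Ck_onD:
  assumes "Ck_on (Suc k) S f" "x \<in> S"
  shows "(f has_derivative frechet_derivative f (at x)) (at x)"
  using assms has_frechet_derivative by auto

text \<open>\<open>Ck_on\<close> refers to the chosen \<open>frechet_derivative\<close>; since
  derivatives are unique, any formula produced by a calculus rule can stand in its place.\<close>

lemma Ck_on_SucI:
  assumes "open S" "\<And>x. x \<in> S \<Longrightarrow> (f has_derivative f' x) (at x)"
    and "\<And>v. Ck_on k S (\<lambda>x. f' x v)"
  shows "Ck_on (Suc k) S f"
proof -
  have "f' x = frechet_derivative f (at x)" if "x \<in> S" for x
    using frechet_derivative_at[OF assms(2)[OF that]] .
  then have "Ck_on k S (\<lambda>x. frechet_derivative f (at x) v)" for v
    using Ck_on_cong[OF assms(1), of "\<lambda>x. f' x v" "\<lambda>x. frechet_derivative f (at x) v" k] assms(3) by simp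
  then show ?thesis using assms(2) by (auto simp: differentiable_def)
qed

lemma Ck_on_const: "open S \<Longrightarrow> Ck_on k S (\<lambda>x. c)"
  by (induction k arbitrary: c) (auto simp: frechet_derivative_const)

lemma Ck_on_bounded_linear:
  assumes "open S" "bounded_linear h"
  shows "Ck_on k S f \<Longrightarrow> Ck_on k S (\<lambda>x. h (f x))"
proof (induction k arbitrary: f)
  case 0
  then show ?case by (simp add: bounded_linear.continuous_on[OF assms(2)])
next
  case (Suc k)
  show ?case
    by (rule Ck_on_SucI[OF assms(1), of _ "\<lambda>x v. h (frechet_derivative f (at x) v)"])
      (use Suc in \<open>auto intro!: bounded_linear.has_derivative[OF assms(2)] has_frechet_derivative\<close>)
qed

lemma Ck_on_add:
  assumes "open S"
  shows "Ck_on k S f \<Longrightarrow> Ck_on k S g \<Longrightarrow> Ck_on k S (\<lambda>x. f x + g x)"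
proof (induction k arbitrary: f g)
  case 0
  then show ?case by (simp add: continuous_on_add)
next
  case (Suc k)
  show ?case
    by (rule Ck_on_SucI[OF assms(1), of _ "\<lambda>x v. frechet_derivative f (at x) v + frechet_derivative g (at x) v"])
      (use Suc in \<open>auto intro!: has_derivative_add has_frechet_derivative\<close>)
qed

lemma Ck_on_sum:
  assumes "open S" "\<And>i. i \<in> I \<Longrightarrow> Ck_on k S (f i)"
  shows "Ck_on k S (\<lambda>x. \<Sum>i\<in>I. f i x)"
  using assms(2)
  by (induction I rule: infinite_finite_induct) (auto intro: Ck_on_add Ck_on_const assms(1))

lemma Ck_on_bilinear:
  assumes "open S" "bounded_bilinear B"
  shows "Ck_on k S f \<Longrightarrow> Ck_on k S g \<Longrightarrow> Ck_on k S (\<lambda>x. B (f x) (g x))"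
proof (induction k arbitrary: f g)
  case 0
  then show ?case by (simp add: bounded_bilinear.continuous_on[OF assms(2)])
next
  case (Suc k)
  \<comment> \<open>The product rule contains \<open>f\<close> and \<open>g\<close>
    undifferentiated, so their regularity is lowered to \<open>k\<close> before the induction
    hypothesis is applied to the mixed products.\<close>
  have "Ck_on k S f" "Ck_on k S g"
    using Suc.prems Ck_on_SucD by blast+
  then have "Ck_on k S (\<lambda>x. B (f x) (frechet_derivative g (at x) v) + B (frechet_derivative f (at x) v) (g x))" for v
    using Suc by (auto intro!: Ck_on_add assms)
  then show ?case
    by (intro Ck_on_SucI[OF assms(1), of _ "\<lambda>x v. B (f x) (frechet_derivative g (at x) v) + B (frechet_derivative f (at x) v) (g x)"])
      (use Suc.prems in \<open>auto intro!: bounded_bilinear.FDERIV[OF assms(2)] has_frechet_derivative\<close>)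
qed

lemma Ck_on_scaleR:
  "open S \<Longrightarrow> Ck_on k S f \<Longrightarrow> Ck_on k S g \<Longrightarrow> Ck_on k S (\<lambda>x. f x *\<^sub>R g x)"
  by (rule Ck_on_bilinear[OF _ bounded_bilinear_scaleR])

lemma Ck_on_inner: "open S \<Longrightarrow> Ck_on k S f \<Longrightarrow> Ck_on k S (\<lambda>x. f x \<bullet> b)"
  by (rule Ck_on_bounded_linear[OF _ bounded_linear_inner_left])

text \<open>Separates the direction from the base point: a derivative applied to a varying vector
  becomes a finite sum of scalar coordinates times derivatives in fixed directions, the form that
  the recursion of \<open>Ck_on\<close> handles.\<close>

lemma linear_euclidean_expand:
  fixes L :: "'a::euclidean_space \<Rightarrow> 'b::real_vector"
  assumes "linear L"
  shows "L u = (\<Sum>b\<in>Basis. (u \<bullet> b) *\<^sub>R L b)"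
proof -
  have "L u = L (\<Sum>b\<in>Basis. (u \<bullet> b) *\<^sub>R b)" by (simp add: euclidean_representation)
  also have "\<dots> = (\<Sum>b\<in>Basis. (u \<bullet> b) *\<^sub>R L b)"
    by (simp add: linear_sum[OF assms] linear_cmul[OF assms])
  finally show ?thesis .
qed

text \<open>By the chain rule the derivative is a sum of products of directional derivatives of
  \<open>g\<close> and of directional derivatives of \<open>f\<close> composed with the same
  \<open>g\<close>; hence the induction varies \<open>f\<close> and keeps \<open>g\<close>
  fixed.\<close>

lemma Ck_on_compose:
  fixes g :: "'a::real_normed_vector \<Rightarrow> 'c::euclidean_space" and f :: "'c \<Rightarrow> 'b::real_normed_vector"
  assumes "open S" "open T" "g ` S \<subseteq> T"
  shows "Ck_on k T f \<Longrightarrow> Ck_on k S g \<Longrightarrow> Ck_on k S (\<lambda>x. f (g x))"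
proof (induction k arbitrary: f)
  case 0
  then show ?case using assms(3) by (auto intro: continuous_on_compose2)
next
  case (Suc k)
  let ?f' = "\<lambda>x v. \<Sum>b\<in>Basis. (frechet_derivative g (at x) v \<bullet> b) *\<^sub>R frechet_derivative f (at (g x)) b"
  have "Ck_on k S (\<lambda>x. ?f' x v)" for v
    by (intro Ck_on_sum Ck_on_scaleR Ck_on_inner assms Suc.IH) (use Suc.prems in \<open>auto intro: Ck_on_SucD\<close>)
  moreover have "((\<lambda>x. f (g x)) has_derivative ?f' x) (at x)" if "x \<in> S" for x
  proof -
    have f: "(f has_derivative frechet_derivative f (at (g x))) (at (g x))"
      using Ck_onD[OF Suc.prems(1)] assms(3) that by auto
    have "(\<lambda>v. frechet_derivative f (at (g x)) (frechet_derivative g (at x) v)) = ?f' x"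
      by (rule ext) (rule linear_euclidean_expand[OF has_derivative_linear[OF f]])
    then show ?thesis
      using has_derivative_compose[OF Ck_onD[OF Suc.prems(2) that] f] by (simp only:)
  qed
  ultimately show ?case by (rule Ck_on_SucI[OF assms(1), rotated -1])
qed

lemma Ck_on_directional:
  fixes f :: "'a::euclidean_space \<Rightarrow> 'b::real_normed_vector"
  assumes "open S" "Ck_on (Suc k) S f" "Ck_on k S u"
  shows "Ck_on k S (\<lambda>x. frechet_derivative f (at x) (u x))"
proof -
  have "Ck_on k S (\<lambda>x. \<Sum>b\<in>Basis. (u x \<bullet> b) *\<^sub>R frechet_derivative f (at x) b)"
    by (intro Ck_on_sum Ck_on_scaleR Ck_on_inner assms) (use assms in auto)
  then show ?thesis
    by (rule Ck_on_cong[OF assms(1), rotated])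
      (rule linear_euclidean_expand[OF has_derivative_linear[OF Ck_onD[OF assms(2)]], symmetric])
qed

section \<open>Symmetry of second derivatives\<close>

lemma second_difference_mvt:
  fixes h :: "'a::real_normed_vector \<Rightarrow> real"
  assumes h: "Ck_on 2 S h" and t: "0 < t"
    and S: "\<And>s r. 0 \<le> s \<Longrightarrow> s \<le> t \<Longrightarrow> 0 \<le> r \<Longrightarrow> r \<le> t \<Longrightarrow> x + s *\<^sub>R v + r *\<^sub>R w \<in> S"
  obtains s r where "0 < s" "s < t" "0 < r" "r < t"
    "h (x + t *\<^sub>R v + t *\<^sub>R w) - h (x + t *\<^sub>R v) - h (x + t *\<^sub>R w) + h x =
      t * (t * frechet_derivative (\<lambda>q. frechet_derivative h (at q) v) (at (x + s *\<^sub>R v + r *\<^sub>R w)) w)"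
proof -
  have h1: "Ck_on (Suc 0) S (\<lambda>q. frechet_derivative h (at q) v)" and h0: "Ck_on (Suc (Suc 0)) S h"
    using h by (simp_all add: numeral_2_eq_2)
  have dh: "((\<lambda>s. h (x + s *\<^sub>R v + r *\<^sub>R w)) has_derivative
      (\<lambda>d. d * frechet_derivative h (at (x + s *\<^sub>R v + r *\<^sub>R w)) v)) (at s)"
    if "0 \<le> s" "s \<le> t" "0 \<le> r" "r \<le> t" for s r
  proof -
    have 1: "(h has_derivative frechet_derivative h (at (x + s *\<^sub>R v + r *\<^sub>R w))) (at (x + s *\<^sub>R v + r *\<^sub>R w))"
      using Ck_onD[OF h0 S[OF that]] .
    have 2: "((\<lambda>s. x + s *\<^sub>R v + r *\<^sub>R w) has_derivative (\<lambda>d. d *\<^sub>R v)) (at s)"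
      by (auto intro!: derivative_eq_intros)
    show ?thesis
      using has_derivative_compose[OF 2 1] linear_cmul[OF has_derivative_linear[OF 1]] by simp
  qed
  \<comment> \<open>The second difference over the parallelogram is a first difference of
    \<open>?\<phi>\<close>. The mean value theorem in direction \<open>v\<close>, then in direction
    \<open>w\<close>, produces the mixed derivative. The vanishing summand
    \<open>0 *\<^sub>R w\<close> is kept so that \<open>dh\<close> applies with
    \<open>r = 0\<close>.\<close>
  let ?\<phi> = "\<lambda>s. h (x + s *\<^sub>R v + t *\<^sub>R w) - h (x + s *\<^sub>R v + 0 *\<^sub>R w)"
  let ?D = "\<lambda>s r. frechet_derivative h (at (x + s *\<^sub>R v + r *\<^sub>R w)) v"
  have "\<exists>s\<in>{0<..<t}. ?\<phi> t - ?\<phi> 0 = (\<lambda>d. d * ?D s t - d * ?D s 0) (t - 0)"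
  proof (rule mvt_simple[OF t, of ?\<phi> "\<lambda>s d. d * ?D s t - d * ?D s 0"])
    fix s assume "0 \<le> s" "s \<le> t"
    then show "(?\<phi> has_derivative (\<lambda>d. d * ?D s t - d * ?D s 0)) (at s within {0..t})"
      using t by (intro has_derivative_at_withinI[OF has_derivative_diff[OF dh dh]]) auto
  qed
  then obtain s where s: "0 < s" "s < t" "?\<phi> t - ?\<phi> 0 = t * (?D s t - ?D s 0)"
    by (auto simp: algebra_simps)
  let ?DD = "\<lambda>r. frechet_derivative (\<lambda>q. frechet_derivative h (at q) v) (at (x + s *\<^sub>R v + r *\<^sub>R w)) w"
  have "\<exists>r\<in>{0<..<t}. ?D s t - ?D s 0 = (\<lambda>d. d * ?DD r) (t - 0)"
  proof (rule mvt_simple[OF t, of "?D s" "\<lambda>r d. d * ?DD r"])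
    fix r assume "0 \<le> r" "r \<le> t"
    then have 1: "((\<lambda>q. frechet_derivative h (at q) v) has_derivative
        frechet_derivative (\<lambda>q. frechet_derivative h (at q) v) (at (x + s *\<^sub>R v + r *\<^sub>R w))) (at (x + s *\<^sub>R v + r *\<^sub>R w))"
      using Ck_onD[OF h1 S] s by auto
    have 2: "((\<lambda>r. x + s *\<^sub>R v + r *\<^sub>R w) has_derivative (\<lambda>d. d *\<^sub>R w)) (at r)"
      by (auto intro!: derivative_eq_intros)
    show "(?D s has_derivative (\<lambda>d. d * ?DD r)) (at r within {0..t})"
      using has_derivative_compose[OF 2 1] linear_cmul[OF has_derivative_linear[OF 1]]
      by (simp add: has_derivative_at_withinI)
  qed
  then obtain r where r: "0 < r" "r < t" "?D s t - ?D s 0 = t * ?DD r" by auto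
  show thesis
    by (rule that[OF s(1,2) r(1,2)]) (use s(3) r(3) in simp)
qed

text \<open>The second difference is symmetric in \<open>v\<close> and \<open>w\<close>, so on a
  small parallelogram some value of one mixed derivative equals some value of the other; continuity
  at \<open>x\<close> then identifies the two (Schwarz).\<close>

lemma second_derivative_symmetric_real:
  fixes h :: "'a::real_normed_vector \<Rightarrow> real"
  assumes S: "open S" "x \<in> S" and h: "Ck_on 2 S h"
  shows "frechet_derivative (\<lambda>q. frechet_derivative h (at q) v) (at x) w =
    frechet_derivative (\<lambda>q. frechet_derivative h (at q) w) (at x) v" (is "?A x = ?B x")
proof -
  have cont: "continuous (at x) ?A" "continuous (at x) ?B"
    using h S by (auto simp: numeral_2_eq_2 continuous_on_eq_continuous_at)
  have "dist (?A x) (?B x) < e" if e: "e > 0" for e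
  proof -
    obtain d where d: "d > 0" "\<And>y. dist y x < d \<Longrightarrow> dist (?A y) (?A x) < e / 2"
      "\<And>y. dist y x < d \<Longrightarrow> dist (?B y) (?B x) < e / 2"
    proof -
      obtain d1 where "d1 > 0" "\<And>y. dist y x < d1 \<Longrightarrow> dist (?A y) (?A x) < e / 2"
        using cont(1) e unfolding continuous_at_eps_delta by (metis half_gt_zero)
      moreover obtain d2 where "d2 > 0" "\<And>y. dist y x < d2 \<Longrightarrow> dist (?B y) (?B x) < e / 2"
        using cont(2) e unfolding continuous_at_eps_delta by (metis half_gt_zero)
      ultimately show thesis using that[of "min d1 d2"] by auto
    qed
    obtain d' where d': "d' > 0" "ball x d' \<subseteq> S" using S openE by blast
    \<comment> \<open>The summand 1 keeps \<open>P\<close> positive when both vectors vanish. The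
      factor 1/2 in \<open>t\<close> puts the parallelogram strictly inside the ball of radius
      \<open>min d d'\<close>, which lies in \<open>S\<close> and where both continuity estimates
      hold.\<close>
    define P where "P = norm v + norm w + 1"
    define t where "t = min d d' / P / 2"
    have pos: "0 < P" by (simp add: P_def add_nonneg_pos)
    then have t: "t > 0" using d d' by (simp add: t_def)
    have lt: "t * (norm v + norm w) < min d d'"
    proof -
      have "t * (norm v + norm w) \<le> t * P" using t by (simp add: P_def)
      also have "\<dots> = min d d' / 2"
        using pos by (simp add: t_def)
      also have "\<dots> < min d d'" using d(1) d'(1) by linarith
      finally show ?thesis .
    qed
    have near: "dist (x + s *\<^sub>R v + r *\<^sub>R w) x < min d d'"
      if "0 \<le> s" "s \<le> t" "0 \<le> r" "r \<le> t" for s r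
    proof -
      have "dist (x + s *\<^sub>R v + r *\<^sub>R w) x = norm (s *\<^sub>R v + r *\<^sub>R w)"
        by (simp add: dist_norm algebra_simps)
      also have "\<dots> \<le> norm (s *\<^sub>R v) + norm (r *\<^sub>R w)" by (rule norm_triangle_ineq)
      also have "\<dots> = s * norm v + r * norm w" using that by simp
      also have "\<dots> \<le> t * norm v + t * norm w" using that by (intro add_mono mult_right_mono) auto
      finally show ?thesis using lt by (simp add: algebra_simps)
    qed
    have inS: "x + s *\<^sub>R v + r *\<^sub>R w \<in> S" "x + r *\<^sub>R w + s *\<^sub>R v \<in> S"
      if "0 \<le> s" "s \<le> t" "0 \<le> r" "r \<le> t" for s r
      using near[OF that] d'(2) by (auto simp: subset_iff dist_commute add.commute add.left_commute)
    obtain s r where sr: "0 < s" "s < t" "0 < r" "r < t"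
      "h (x + t *\<^sub>R v + t *\<^sub>R w) - h (x + t *\<^sub>R v) - h (x + t *\<^sub>R w) + h x =
        t * (t * ?A (x + s *\<^sub>R v + r *\<^sub>R w))"
      using second_difference_mvt[OF h t inS(1)] by blast
    obtain s' r' where sr': "0 < s'" "s' < t" "0 < r'" "r' < t"
      "h (x + t *\<^sub>R w + t *\<^sub>R v) - h (x + t *\<^sub>R w) - h (x + t *\<^sub>R v) + h x =
        t * (t * ?B (x + s' *\<^sub>R w + r' *\<^sub>R v))"
      using second_difference_mvt[OF h t inS(2)] by blast
    have "x + t *\<^sub>R w + t *\<^sub>R v = x + t *\<^sub>R v + t *\<^sub>R w" by (simp add: algebra_simps)
    with sr(5) sr'(5) have "t * (t * ?A (x + s *\<^sub>R v + r *\<^sub>R w)) = t * (t * ?B (x + s' *\<^sub>R w + r' *\<^sub>R v))"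
      by (smt (verit))
    then have eq: "?A (x + s *\<^sub>R v + r *\<^sub>R w) = ?B (x + s' *\<^sub>R w + r' *\<^sub>R v)" using t by simp
    have n1: "dist (x + s *\<^sub>R v + r *\<^sub>R w) x < d" using near[of s r] sr by auto
    have n2: "dist (x + s' *\<^sub>R w + r' *\<^sub>R v) x < d"
      using near[of r' s'] sr' by (auto simp: add.commute add.left_commute)
    show ?thesis
      using d(2)[OF n1] d(3)[OF n2] eq by (metis dist_commute dist_triangle_half_l)
  qed
  then show ?thesis by (metis dist_self less_irrefl zero_less_dist_iff)
qed

lemma frechet_derivative_bounded_linear:
  assumes "bounded_linear L" "f differentiable (at x)"
  shows "frechet_derivative (\<lambda>x. L (f x)) (at x) v = L (frechet_derivative f (at x) v)"
  using frechet_derivative_at[OF bounded_linear.has_derivative[OF assms(1) has_frechet_derivative[OF assms(2)]]]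
  by metis

lemma second_derivative_symmetric:
  fixes f :: "'a::real_normed_vector \<Rightarrow> 'b::euclidean_space"
  assumes S: "open S" "x \<in> S" and f: "Ck_on 2 S f"
  shows "frechet_derivative (\<lambda>q. frechet_derivative f (at q) v) (at x) w =
    frechet_derivative (\<lambda>q. frechet_derivative f (at q) w) (at x) v"
proof (rule euclidean_eqI)
  fix b :: 'b
  let ?L = "\<lambda>y. y \<bullet> b"
  have L: "bounded_linear ?L" by (rule bounded_linear_inner_left)
  have f2: "Ck_on (Suc (Suc 0)) S f" using f by (simp add: numeral_2_eq_2)
  have 1: "frechet_derivative (\<lambda>q. ?L (f q)) (at q) u = ?L (frechet_derivative f (at q) u)" if "q \<in> S" for q u
    using frechet_derivative_bounded_linear[OF L, of f q u] f2 that by auto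
  have 2: "frechet_derivative (\<lambda>q. frechet_derivative (\<lambda>q. ?L (f q)) (at q) u) (at x) z =
      ?L (frechet_derivative (\<lambda>q. frechet_derivative f (at q) u) (at x) z)" for u z
  proof -
    have "frechet_derivative (\<lambda>q. frechet_derivative (\<lambda>q. ?L (f q)) (at q) u) (at x) =
      frechet_derivative (\<lambda>q. ?L (frechet_derivative f (at q) u)) (at x)"
      by (rule frechet_derivative_cong_open[OF S]) (rule 1)
    then show ?thesis
      using frechet_derivative_bounded_linear[OF L, of "\<lambda>q. frechet_derivative f (at q) u" x z] f2 S by auto
  qed
  show "?L (frechet_derivative (\<lambda>q. frechet_derivative f (at q) v) (at x) w) =
    ?L (frechet_derivative (\<lambda>q. frechet_derivative f (at q) w) (at x) v)"
    using second_derivative_symmetric_real[OF S Ck_on_bounded_linear[OF S(1) L f], of v w]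
    by (simp only: 2)
qed

lemma smooth_on_subset: "smooth_on S f \<Longrightarrow> T \<subseteq> S \<Longrightarrow> smooth_on T f"
  by (auto simp: smooth_on_def intro: Ck_on_subset)

lemma smooth_on_lincomb:
  assumes "open S" "\<And>i. i \<in> I \<Longrightarrow> smooth_on S (f i)"
  shows "smooth_on S (\<lambda>x. \<Sum>i\<in>I. c i *\<^sub>R f i x)"
  using assms unfolding smooth_on_def
  by (auto intro!: Ck_on_sum Ck_on_bounded_linear[OF _ bounded_linear_scaleR_right])

lemma smooth_onD:
  assumes "smooth_on S f" "x \<in> S"
  shows "(f has_derivative frechet_derivative f (at x)) (at x)"
  using Ck_onD[of 0 S f x] assms unfolding smooth_on_def by blast

lemma smooth_on_continuous: "smooth_on S f \<Longrightarrow> continuous_on S f"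
  unfolding smooth_on_def using Ck_on.simps(1) by blast

text \<open>Serves to express the derivative of a section that vanishes at a point as a limit of
  rescaled values of the section, because those values lie in the distribution.\<close>

lemma has_vector_derivative_quotient_tendsto:
  fixes f :: "real \<Rightarrow> 'b::real_normed_vector"
  assumes "(f has_vector_derivative d) (at 0)" "f 0 = 0"
  shows "((\<lambda>t. f t /\<^sub>R t) \<longlongrightarrow> d) (at 0)"
proof -
  have "((\<lambda>t. norm (f t - t *\<^sub>R d) / norm t) \<longlongrightarrow> 0) (at 0)"
    using assms by (simp add: has_vector_derivative_def has_derivative_iff_norm)
  moreover have "norm (f t /\<^sub>R t - d) = norm (f t - t *\<^sub>R d) / norm t" if "t \<noteq> 0" for t
  proof -
    have "f t /\<^sub>R t - d = (f t - t *\<^sub>R d) /\<^sub>R t" using that by (simp add: scaleR_diff_right)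
    then show ?thesis by (simp add: divide_inverse mult.commute)
  qed
  ultimately have "((\<lambda>t. norm (f t /\<^sub>R t - d)) \<longlongrightarrow> 0) (at 0)"
    by (subst filterlim_cong[OF refl refl, of _ "\<lambda>t. norm (f t - t *\<^sub>R d) / norm t"])
      (auto simp: eventually_at_filter)
  then show ?thesis by (simp add: tendsto_norm_zero_iff Lim_null[symmetric])
qed

text \<open>One term comes from moving the base point, one from moving the vector. It is applied to
  the Jacobian of a transition map acting on a vector field.\<close>

lemma directional_derivative_product_rule:
  fixes f :: "'a::euclidean_space \<Rightarrow> 'b::real_normed_vector"
  assumes S: "open S" "x \<in> S" and f: "Ck_on 2 S f" and u: "u differentiable (at x)"
  shows "((\<lambda>q. frechet_derivative f (at q) (u q)) has_derivative
    (\<lambda>h. frechet_derivative (\<lambda>q. frechet_derivative f (at q) (u x)) (at x) h +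
      frechet_derivative f (at x) (frechet_derivative u (at x) h))) (at x)"
proof -
  have f2: "Ck_on (Suc (Suc 0)) S f" using f by (simp add: numeral_2_eq_2)
  have lin: "linear (frechet_derivative f (at q))" if "q \<in> S" for q
    using has_derivative_linear[OF Ck_onD[OF f2 that]] .
  let ?g = "\<lambda>b q. frechet_derivative f (at q) b"
  have g: "(?g b has_derivative frechet_derivative (?g b) (at x)) (at x)" for b
    using f2 S by (intro Ck_onD[of 0 S]) auto
  have u': "((\<lambda>q. u q \<bullet> b) has_derivative (\<lambda>h. frechet_derivative u (at x) h \<bullet> b)) (at x)" for b
    using has_derivative_inner_left[OF has_frechet_derivative[OF u]] .
  have 1: "((\<lambda>q. \<Sum>b\<in>Basis. (u q \<bullet> b) *\<^sub>R ?g b q) has_derivative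
      (\<lambda>h. \<Sum>b\<in>Basis. (u x \<bullet> b) *\<^sub>R frechet_derivative (?g b) (at x) h
        + (frechet_derivative u (at x) h \<bullet> b) *\<^sub>R ?g b x)) (at x)"
    by (rule has_derivative_sum) (rule has_derivative_scaleR[OF u' g])
  have 2: "((\<lambda>q. \<Sum>b\<in>Basis. (u x \<bullet> b) *\<^sub>R ?g b q) has_derivative
      (\<lambda>h. \<Sum>b\<in>Basis. (u x \<bullet> b) *\<^sub>R frechet_derivative (?g b) (at x) h)) (at x)"
    by (rule has_derivative_sum) (rule has_derivative_scaleR_right[OF g])
  have "frechet_derivative (\<lambda>q. frechet_derivative f (at q) (u x)) (at x) =
      frechet_derivative (\<lambda>q. \<Sum>b\<in>Basis. (u x \<bullet> b) *\<^sub>R ?g b q) (at x)"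
    by (rule frechet_derivative_cong_open[OF S]) (rule linear_euclidean_expand[OF lin])
  also have "\<dots> = (\<lambda>h. \<Sum>b\<in>Basis. (u x \<bullet> b) *\<^sub>R frechet_derivative (?g b) (at x) h)"
    using frechet_derivative_at[OF 2] by simp
  finally have A: "frechet_derivative (\<lambda>q. frechet_derivative f (at q) (u x)) (at x) h =
      (\<Sum>b\<in>Basis. (u x \<bullet> b) *\<^sub>R frechet_derivative (?g b) (at x) h)" for h by metis
  have B: "frechet_derivative f (at x) (frechet_derivative u (at x) h) =
      (\<Sum>b\<in>Basis. (frechet_derivative u (at x) h \<bullet> b) *\<^sub>R ?g b x)" for h
    by (rule linear_euclidean_expand[OF lin[OF S(2)]])
  show ?thesis
    unfolding A B sum.distrib[symmetric]
  proof (rule has_derivative_transform_within_open[OF 1 S])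
    fix q assume "q \<in> S"
    then show "(\<Sum>b\<in>Basis. (u q \<bullet> b) *\<^sub>R ?g b q) = frechet_derivative f (at q) (u q)"
      by (rule linear_euclidean_expand[OF lin, symmetric])
  qed
qed

section \<open>Bases, coordinates and cosets\<close>

text \<open>Independence of the indexed family rather than of its image set: a repeated vector
  counts as a relation, and coefficients can be estimated index by index.\<close>

definition lin_indep :: "nat \<Rightarrow> (nat \<Rightarrow> 'a::real_vector) \<Rightarrow> bool" where
  "lin_indep r b \<longleftrightarrow> (\<forall>c. (\<Sum>i<r. c i *\<^sub>R b i) = 0 \<longrightarrow> (\<forall>i<r. c i = 0))"

lemma lin_indep_iff: "lin_indep r b \<longleftrightarrow> inj_on b {..<r} \<and> independent (b ` {..<r})"
proof
  assume b: "lin_indep r b"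
  have inj: "inj_on b {..<r}"
  proof (rule inj_onI, rule ccontr)
    fix i j assume ij: "i \<in> {..<r}" "j \<in> {..<r}" "b i = b j" "i \<noteq> j"
    let ?c = "\<lambda>k. (if k = i then 1 else 0) - (if k = j then 1 else 0 :: real)"
    have "(\<Sum>k<r. ?c k *\<^sub>R b k) = b i - b j"
      using ij by (simp add: scaleR_left_diff_distrib sum_subtractf if_distrib[of "\<lambda>t. t *\<^sub>R _"] cong: if_cong)
    then have "(\<Sum>k<r. ?c k *\<^sub>R b k) = 0" using ij by simp
    then have "?c i = 0" using b[unfolded lin_indep_def, rule_format, of ?c i] ij by blast
    then show False using ij by simp
  qed
  have "u v = 0" if "(\<Sum>v\<in>b ` {..<r}. u v *\<^sub>R v) = 0" "v \<in> b ` {..<r}" for u v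
    using that b by (auto simp: sum.reindex[OF inj] lin_indep_def)
  then have "independent (b ` {..<r})"
    by (auto simp: dependent_finite)
  with inj show "inj_on b {..<r} \<and> independent (b ` {..<r})" by blast
next
  assume b: "inj_on b {..<r} \<and> independent (b ` {..<r})"
  show "lin_indep r b"
    unfolding lin_indep_def
  proof (intro allI impI)
    fix c i assume c: "(\<Sum>i<r. c i *\<^sub>R b i) = 0" and i: "i < r"
    have "(\<Sum>v\<in>b ` {..<r}. c (inv_into {..<r} b v) *\<^sub>R v) = 0"
      using b c by (simp add: sum.reindex inv_into_f_f)
    then have "c (inv_into {..<r} b (b i)) = 0"
      by (intro independentD[of "b ` {..<r}" "b ` {..<r}"]) (use b i in auto)
    then show "c i = 0" using b i by (simp add: inv_into_f_f)
  qed
qed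

lemma span_lessThan: "span (b ` {..<r::nat}) = range (\<lambda>c. \<Sum>i<r. c i *\<^sub>R b i)"
proof
  show "range (\<lambda>c. \<Sum>i<r. c i *\<^sub>R b i) \<subseteq> span (b ` {..<r})"
  proof
    fix v assume "v \<in> range (\<lambda>c. \<Sum>i<r. c i *\<^sub>R b i)"
    then obtain c where v: "v = (\<Sum>i<r. c i *\<^sub>R b i)" by blast
    show "v \<in> span (b ` {..<r})"
      unfolding v by (intro span_sum span_scale span_base) auto
  qed
  show "span (b ` {..<r}) \<subseteq> range (\<lambda>c. \<Sum>i<r. c i *\<^sub>R b i)"
  proof (rule span_minimal)
    show "b ` {..<r} \<subseteq> range (\<lambda>c. \<Sum>i<r. c i *\<^sub>R b i)"
    proof clarsimp
      fix i assume "i < r"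
      have "(\<Sum>k<r. (if k = i then 1 else 0) *\<^sub>R b k) = (\<Sum>k<r. if k = i then b k else 0)"
        by (rule sum.cong) auto
      with \<open>i < r\<close> have "b i = (\<Sum>k<r. (if k = i then 1 else 0) *\<^sub>R b k)"
        by simp
      then show "b i \<in> range (\<lambda>c. \<Sum>i<r. c i *\<^sub>R b i)"
        by (rule range_eqI[of _ _ "\<lambda>k. if k = i then 1 else 0"])
    qed
    show "subspace (range (\<lambda>c. \<Sum>i<r. c i *\<^sub>R b i))"
      unfolding subspace_def
    proof (intro conjI ballI allI)
      show "0 \<in> range (\<lambda>c. \<Sum>i<r. c i *\<^sub>R b i)"
        by (rule range_eqI[of _ _ "\<lambda>_. 0"]) simp
      fix v assume "v \<in> range (\<lambda>c. \<Sum>i<r. c i *\<^sub>R b i)"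
      then obtain c where c: "v = (\<Sum>i<r. c i *\<^sub>R b i)" by blast
      show "a *\<^sub>R v \<in> range (\<lambda>c. \<Sum>i<r. c i *\<^sub>R b i)" for a
        by (rule range_eqI[of _ _ "\<lambda>i. a * c i"]) (simp add: c scaleR_sum_right)
      fix w assume "w \<in> range (\<lambda>c. \<Sum>i<r. c i *\<^sub>R b i)"
      then obtain d where d: "w = (\<Sum>i<r. d i *\<^sub>R b i)" by blast
      show "v + w \<in> range (\<lambda>c. \<Sum>i<r. c i *\<^sub>R b i)"
        by (rule range_eqI[of _ _ "\<lambda>i. c i + d i"]) (simp add: c d scaleR_left_distrib sum.distrib)
    qed
  qed
qed

lemma basis_of_iff: "basis_of S r b \<longleftrightarrow> lin_indep r b \<and> range (\<lambda>c. \<Sum>i<r. c i *\<^sub>R b i) = S"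
  by (auto simp: basis_of_def lin_indep_iff span_lessThan)

lemma basis_of_subspace: "basis_of S r b \<Longrightarrow> subspace S"
  unfolding basis_of_def by auto

lemma basis_of_mem: "basis_of S r b \<Longrightarrow> i < r \<Longrightarrow> b i \<in> S"
  unfolding basis_of_def by (auto intro: span_base)

lemma basis_of_comb: "basis_of S r b \<Longrightarrow> (\<Sum>i<r. c i *\<^sub>R b i) \<in> S"
  unfolding basis_of_iff by auto

text \<open>For a basis and a vector of its span the values are determined below \<open>r\<close>
  only; at other indices, and for vectors outside the span, they are arbitrary.\<close>

definition coords :: "nat \<Rightarrow> (nat \<Rightarrow> 'a::real_vector) \<Rightarrow> 'a \<Rightarrow> nat \<Rightarrow> real" where
  "coords r b v = (SOME c. v = (\<Sum>i<r. c i *\<^sub>R b i))"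

lemma coords_sum:
  assumes "basis_of S r b" "v \<in> S"
  shows "(\<Sum>i<r. coords r b v i *\<^sub>R b i) = v"
proof -
  have "\<exists>c. v = (\<Sum>i<r. c i *\<^sub>R b i)" using assms by (auto simp: basis_of_iff)
  from someI_ex[OF this] show ?thesis by (simp add: coords_def)
qed

lemma lin_indepD:
  assumes "lin_indep r b" "(\<Sum>i<r. c i *\<^sub>R b i) = (\<Sum>i<r. d i *\<^sub>R b i)" "i < r"
  shows "c i = d i"
proof -
  have "(\<Sum>i<r. (c i - d i) *\<^sub>R b i) = 0"
    using assms(2) by (simp add: scaleR_left_diff_distrib sum_subtractf)
  then show ?thesis using assms(1,3) unfolding lin_indep_def by fastforce
qed

lemma coords_eq:
  assumes "basis_of S r b" "v = (\<Sum>i<r. c i *\<^sub>R b i)" "i < r"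
  shows "coords r b v i = c i"
  using coords_sum[OF assms(1), of v] lin_indepD[of r b "coords r b v" c i] assms
  by (auto simp: basis_of_iff)

lemma coords_combine:
  assumes "basis_of S r b" "v \<in> S" "w \<in> S" "i < r"
  shows "coords r b (s *\<^sub>R v + t *\<^sub>R w) i = s * coords r b v i + t * coords r b w i"
proof (rule coords_eq[OF assms(1) _ assms(4)])
  have "s *\<^sub>R v + t *\<^sub>R w =
      s *\<^sub>R (\<Sum>i<r. coords r b v i *\<^sub>R b i) + t *\<^sub>R (\<Sum>i<r. coords r b w i *\<^sub>R b i)"
    by (simp add: coords_sum[OF assms(1)] assms)
  then show "s *\<^sub>R v + t *\<^sub>R w = (\<Sum>i<r. (s * coords r b v i + t * coords r b w i) *\<^sub>R b i)"
    by (simp add: scaleR_left_distrib sum.distrib scaleR_sum_right)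
qed

text \<open>A vector of \<open>S\<close> outside the span of \<open>b'\<close> would give
  \<open>r + 1\<close> independent vectors inside the span of \<open>r\<close> vectors.\<close>

lemma basis_of_if_lin_indep:
  assumes "basis_of S r b" "lin_indep r b'" "\<And>i. i < r \<Longrightarrow> b' i \<in> S"
  shows "basis_of S r b'"
proof -
  let ?A = "b ` {..<r}" and ?B = "b' ` {..<r}"
  have A: "span ?A = S" "card ?A = r" using assms(1) by (auto simp: basis_of_def card_image)
  have B: "independent ?B" "card ?B = r" "inj_on b' {..<r}"
    using assms(2) by (auto simp: lin_indep_iff card_image)
  have "?B \<subseteq> S" using assms(3) by auto
  then have "span ?B \<subseteq> S" using basis_of_subspace[OF assms(1)] by (rule span_minimal)
  moreover have "v \<in> span ?B" if v: "v \<in> S" for v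
  proof (rule ccontr)
    assume *: "v \<notin> span ?B"
    then have "independent (insert v ?B)" using B by (simp add: independent_insertI)
    moreover have "insert v ?B \<subseteq> span ?A" using A v assms(3) by auto
    ultimately have "card (insert v ?B) \<le> card ?A"
      using independent_span_bound[of ?A "insert v ?B"] by simp
    moreover have "v \<notin> ?B" using * span_base[of v ?B] by (rule contrapos_nn)
    ultimately show False using A B by simp
  qed
  ultimately show ?thesis using B by (auto simp: basis_of_def)
qed

lemma linear_on_subspaceD:
  "linear_on_subspace S f \<Longrightarrow> v \<in> S \<Longrightarrow> w \<in> S \<Longrightarrow> f (a *\<^sub>R v + b *\<^sub>R w) = a *\<^sub>R f v + b *\<^sub>R f w"
  by (simp add: linear_on_subspace_def)

lemma linear_on_subspace_sum:
  assumes "linear_on_subspace S f" "subspace S" "\<And>i. i \<in> I \<Longrightarrow> b i \<in> S"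
  shows "f (\<Sum>i\<in>I. c i *\<^sub>R b i) = (\<Sum>i\<in>I. c i *\<^sub>R f (b i))"
proof -
  have 0: "f 0 = 0"
  proof -
    have "f (0 *\<^sub>R 0 + 0 *\<^sub>R 0) = 0 *\<^sub>R f 0 + 0 *\<^sub>R f 0"
      using subspace_0[OF assms(2)] by (rule linear_on_subspaceD[OF assms(1) subspace_0[OF assms(2)]])
    then show ?thesis by simp
  qed
  show ?thesis
    using assms(3)
  proof (induction I rule: infinite_finite_induct)
    case (insert j I)
    have s: "(\<Sum>i\<in>I. c i *\<^sub>R b i) \<in> S"
      by (intro subspace_sum[OF assms(2)] subspace_scale[OF assms(2)] insert.prems) auto
    have "f (c j *\<^sub>R b j + 1 *\<^sub>R (\<Sum>i\<in>I. c i *\<^sub>R b i)) = c j *\<^sub>R f (b j) + 1 *\<^sub>R f (\<Sum>i\<in>I. c i *\<^sub>R b i)"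
      by (rule linear_on_subspaceD[OF assms(1) _ s]) (use insert.prems in auto)
    then show ?case using insert by simp
  qed (use 0 in auto)
qed

text \<open>Dimension count: an injective linear map carries a basis of \<open>S\<close> to
  \<open>r\<close> independent vectors of \<open>S'\<close>, and these already form a basis
  there.\<close>

lemma linear_on_subspace_bij:
  assumes b: "basis_of S r b" "basis_of S' r b'"
    and f: "linear_on_subspace S f" "f ` S \<subseteq> S'" and inj: "\<And>v. v \<in> S \<Longrightarrow> f v = 0 \<Longrightarrow> v = 0"
  shows "bij_betw f S S'"
proof -
  note sub = basis_of_subspace[OF b(1)] and mem = basis_of_mem[OF b(1)]
  have sum: "f (\<Sum>i<r. c i *\<^sub>R b i) = (\<Sum>i<r. c i *\<^sub>R f (b i))" for c
    using linear_on_subspace_sum[OF f(1) sub, of "{..<r}"] mem by simp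
  have "lin_indep r (\<lambda>i. f (b i))"
    unfolding lin_indep_def
  proof (intro allI impI)
    fix c i assume "(\<Sum>i<r. c i *\<^sub>R f (b i)) = 0" "i < r"
    then have "(\<Sum>i<r. c i *\<^sub>R b i) = 0" using inj[OF basis_of_comb[OF b(1)], of c] by (simp add: sum)
    then show "c i = 0" using b(1) \<open>i < r\<close> by (auto simp: basis_of_iff lin_indep_def)
  qed
  then have "basis_of S' r (\<lambda>i. f (b i))"
    using basis_of_if_lin_indep[OF b(2)] f(2) mem by blast
  then have "S' = range (\<lambda>c. f (\<Sum>i<r. c i *\<^sub>R b i))" by (auto simp: basis_of_iff sum)
  then have "S' = f ` S" using b(1) by (auto simp: basis_of_iff)
  moreover have "inj_on f S"
  proof (rule inj_onI)
    fix v w assume vw: "v \<in> S" "w \<in> S" "f v = f w"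
    have "f (1 *\<^sub>R v + (-1) *\<^sub>R w) = 1 *\<^sub>R f v + (-1) *\<^sub>R f w"
      using vw by (intro linear_on_subspaceD[OF f(1)])
    then show "v = w" using inj[of "v - w"] vw subspace_diff[OF sub] by simp
  qed
  ultimately show ?thesis by (simp add: bij_betw_def)
qed

section \<open>Coefficients with respect to a moving basis\<close>

lemma lin_indep_coeff_bound:
  fixes b :: "nat \<Rightarrow> 'e::euclidean_space"
  assumes "lin_indep r b"
  obtains K where "K > 0" "\<And>c i. i < r \<Longrightarrow> \<bar>c i\<bar> \<le> K * norm (\<Sum>j<r. c j *\<^sub>R b j)"
proof -
  have b: "inj_on b {..<r}" "independent (b ` {..<r})" using assms by (auto simp: lin_indep_iff)
  have "\<exists>K>0. \<forall>c. \<bar>c i\<bar> \<le> K * norm (\<Sum>j<r. c j *\<^sub>R b j)" if i: "i < r" for i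
  proof -
    \<comment> \<open>The dual functional of \<open>b i\<close>, extended to the whole space: it
      reads off the coefficient \<open>c i\<close>, and its operator bound is the desired
      estimate.\<close>
    obtain \<phi> :: "'e \<Rightarrow> real" where \<phi>: "linear \<phi>" "\<And>v. v \<in> b ` {..<r} \<Longrightarrow> \<phi> v = (if v = b i then 1 else 0)"
      using linear_independent_extend[OF b(2), of "\<lambda>v. if v = b i then 1 else 0"] by blast
    then have \<phi>b: "\<phi> (b j) = (if j = i then 1 else 0)" if "j < r" for j
      using that i b(1) by (auto dest: inj_onD)
    obtain K where K: "K > 0" "\<And>x. norm (\<phi> x) \<le> K * norm x"
      using linear_bounded_pos[OF \<phi>(1)] by blast
    have "\<phi> (\<Sum>j<r. c j *\<^sub>R b j) = c i" for c
      using i by (simp add: linear_sum[OF \<phi>(1)] linear_cmul[OF \<phi>(1)] \<phi>b if_distrib[of "\<lambda>t. _ * t"] cong: if_cong)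
    then show ?thesis using K by (metis real_norm_def)
  qed
  then obtain K where K: "\<And>i. i < r \<Longrightarrow> K i > 0" 
    "\<And>i c. i < r \<Longrightarrow> \<bar>c i\<bar> \<le> K i * norm (\<Sum>j<r. c j *\<^sub>R b j)" by metis
  \<comment> \<open>The leading 1 keeps the common constant positive when
    \<open>r = 0\<close>.\<close>
  show thesis
  proof (rule that[of "1 + (\<Sum>i<r. K i)"])
    show "1 + (\<Sum>i<r. K i) > 0" using K(1) by (intro add_pos_nonneg sum_nonneg) (auto intro: less_imp_le)
    fix c and i assume i: "i < r"
    have "K i \<le> (\<Sum>i<r. K i)" by (rule member_le_sum) (use i K(1) in \<open>auto intro: less_imp_le\<close>)
    then have "K i * norm (\<Sum>j<r. c j *\<^sub>R b j) \<le> (1 + (\<Sum>i<r. K i)) * norm (\<Sum>j<r. c j *\<^sub>R b j)"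
      by (intro mult_right_mono) auto
    then show "\<bar>c i\<bar> \<le> (1 + (\<Sum>i<r. K i)) * norm (\<Sum>j<r. c j *\<^sub>R b j)" using K(2)[OF i, of c] by linarith
  qed
qed

text \<open>Replacing \<open>b\<close> by a nearby family changes a combination by at most a small
  multiple of the sum of the \<open>\<bar>c j\<bar>\<close>, which can be absorbed; so one constant
  serves all nearby families.\<close>

lemma eventually_coeff_bound:
  fixes B :: "nat \<Rightarrow> 'w \<Rightarrow> 'e::euclidean_space"
  assumes b: "lin_indep r b" and B: "\<And>i. i < r \<Longrightarrow> (B i \<longlongrightarrow> b i) F"
  obtains K where "K > 0"
    "\<forall>\<^sub>F \<omega> in F. \<forall>c. \<forall>i<r. \<bar>c i\<bar> \<le> K * norm (\<Sum>j<r. c j *\<^sub>R B j \<omega>)"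
proof -
  obtain K where K: "K > 0" "\<And>c i. i < r \<Longrightarrow> \<bar>c i\<bar> \<le> K * norm (\<Sum>j<r. c j *\<^sub>R b j)"
    using lin_indep_coeff_bound[OF b] by blast
  define L where "L = real r * K"
  have L: "L \<ge> 0" using K by (simp add: L_def)
  \<comment> \<open>Chosen so that \<open>L * \<epsilon> \<le> 1 / 2\<close>: half of the
    coefficient sum then moves to the left, which doubles \<open>L\<close>. The added 1 in the final
    constant \<open>2 * L + 1\<close> keeps it positive.\<close>
  define \<epsilon> where "\<epsilon> = 1 / (2 * (L + 1))"
  have \<epsilon>: "\<epsilon> > 0" "L * \<epsilon> \<le> 1 / 2" using L by (auto simp: \<epsilon>_def field_simps)
  have "\<forall>\<^sub>F \<omega> in F. \<forall>j\<in>{..<r}. dist (B j \<omega>) (b j) < \<epsilon>"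
    using B \<epsilon> by (intro eventually_ball_finite) (auto intro: tendstoD)
  then have "\<forall>\<^sub>F \<omega> in F. \<forall>c. \<forall>i<r. \<bar>c i\<bar> \<le> (2 * L + 1) * norm (\<Sum>j<r. c j *\<^sub>R B j \<omega>)"
  proof (eventually_elim, intro allI impI)
    fix \<omega> and c :: "nat \<Rightarrow> real" and i
    assume near: "\<forall>j\<in>{..<r}. dist (B j \<omega>) (b j) < \<epsilon>" and i: "i < r"
    define s where "s = (\<Sum>j<r. \<bar>c j\<bar>)"
    let ?N = "norm (\<Sum>j<r. c j *\<^sub>R B j \<omega>)"
    have s0: "s \<ge> 0" by (simp add: s_def sum_nonneg)
    have "(\<Sum>j<r. c j *\<^sub>R b j) = (\<Sum>j<r. c j *\<^sub>R B j \<omega>) - (\<Sum>j<r. c j *\<^sub>R (B j \<omega> - b j))"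
      by (simp add: scaleR_diff_right sum_subtractf)
    then have "norm (\<Sum>j<r. c j *\<^sub>R b j) \<le> ?N + norm (\<Sum>j<r. c j *\<^sub>R (B j \<omega> - b j))"
      by (metis norm_triangle_ineq4)
    also have "norm (\<Sum>j<r. c j *\<^sub>R (B j \<omega> - b j)) \<le> (\<Sum>j<r. \<bar>c j\<bar> * \<epsilon>)"
    proof (rule sum_norm_le)
      fix j assume "j \<in> {..<r}"
      then have "norm (B j \<omega> - b j) \<le> \<epsilon>" using near by (simp add: dist_norm less_imp_le)
      then show "norm (c j *\<^sub>R (B j \<omega> - b j)) \<le> \<bar>c j\<bar> * \<epsilon>" by (simp add: mult_left_mono)
    qed
    also have "\<dots> = \<epsilon> * s" by (simp add: s_def sum_distrib_left mult.commute)
    finally have N: "norm (\<Sum>j<r. c j *\<^sub>R b j) \<le> ?N + \<epsilon> * s" by simp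
    have "s \<le> (\<Sum>j<r. K * norm (\<Sum>j<r. c j *\<^sub>R b j))"
      unfolding s_def by (rule sum_mono) (use K in auto)
    then have "s \<le> L * norm (\<Sum>j<r. c j *\<^sub>R b j)" by (simp add: L_def)
    also have "\<dots> \<le> L * (?N + \<epsilon> * s)" using N L by (rule mult_left_mono)
    also have "\<dots> = L * ?N + (L * \<epsilon>) * s" by (simp add: algebra_simps)
    also have "\<dots> \<le> L * ?N + (1 / 2) * s" using \<epsilon> s0 by (intro add_left_mono mult_right_mono) auto
    finally have "s \<le> (2 * L) * ?N" by (simp add: algebra_simps)
    also have "\<dots> \<le> (2 * L + 1) * ?N" by (intro mult_right_mono) auto
    finally have "s \<le> (2 * L + 1) * ?N" .
    moreover have "\<bar>c i\<bar> \<le> s" unfolding s_def by (rule member_le_sum) (use i in auto)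
    ultimately show "\<bar>c i\<bar> \<le> (2 * L + 1) * ?N" by linarith
  qed
  then show thesis using L that[of "2 * L + 1"] by auto
qed

text \<open>No continuity of the coefficients is presupposed: the uniform bound, applied to the
  family \<open>c j \<omega> - d j\<close>, estimates them by the distance of two combinations that
  have the same limit.\<close>

lemma coeff_tendsto:
  fixes B :: "nat \<Rightarrow> 'w \<Rightarrow> 'e::euclidean_space"
  assumes b: "lin_indep r b" and B: "\<And>i. i < r \<Longrightarrow> (B i \<longlongrightarrow> b i) F"
    and v: "((\<lambda>\<omega>. \<Sum>i<r. c i \<omega> *\<^sub>R B i \<omega>) \<longlongrightarrow> (\<Sum>i<r. d i *\<^sub>R b i)) F" and i: "i < r"
  shows "(c i \<longlongrightarrow> d i) F"
proof -
  obtain K where K: "K > 0"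
    "\<forall>\<^sub>F \<omega> in F. \<forall>c. \<forall>i<r. \<bar>c i\<bar> \<le> K * norm (\<Sum>j<r. c j *\<^sub>R B j \<omega>)"
    using eventually_coeff_bound[of r b B F] b B by blast
  let ?g = "\<lambda>\<omega>. K * norm ((\<Sum>j<r. c j \<omega> *\<^sub>R B j \<omega>) - (\<Sum>j<r. d j *\<^sub>R B j \<omega>))"
  have "((\<lambda>\<omega>. \<Sum>j<r. d j *\<^sub>R B j \<omega>) \<longlongrightarrow> (\<Sum>i<r. d i *\<^sub>R b i)) F"
    by (intro tendsto_sum tendsto_scaleR tendsto_const B) auto
  then have "(?g \<longlongrightarrow> K * norm ((\<Sum>i<r. d i *\<^sub>R b i) - (\<Sum>i<r. d i *\<^sub>R b i))) F"
    by (intro tendsto_mult tendsto_norm tendsto_diff tendsto_const v)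
  then have "(?g \<longlongrightarrow> 0) F" by simp
  moreover have "\<forall>\<^sub>F \<omega> in F. norm (c i \<omega> - d i) \<le> ?g \<omega>"
    using K(2)
  proof eventually_elim
    case (elim \<omega>)
    then have "\<bar>c i \<omega> - d i\<bar> \<le> K * norm (\<Sum>j<r. (c j \<omega> - d j) *\<^sub>R B j \<omega>)"
      using i by (elim allE[of _ "\<lambda>j. c j \<omega> - d j"]) auto
    then show ?case by (simp add: scaleR_left_diff_distrib sum_subtractf)
  qed
  ultimately have "((\<lambda>\<omega>. c i \<omega> - d i) \<longlongrightarrow> 0) F" by (rule Lim_null_comparison[rotated])
  then show ?thesis by (simp add: Lim_null[symmetric])
qed

lemma continuous_map_euclidean_iff_tendsto:
  "continuous_map X euclidean f \<longleftrightarrow> (\<forall>x\<in>topspace X. (f \<longlongrightarrow> f x) (atin X x))"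
  by (simp add: continuous_map_atin)

lemma continuous_map_coeff:
  fixes B :: "nat \<Rightarrow> 'w \<Rightarrow> 'e::euclidean_space"
  assumes "\<And>x. x \<in> topspace X \<Longrightarrow> lin_indep r (\<lambda>i. B i x)"
    and "\<And>i. i < r \<Longrightarrow> continuous_map X euclidean (B i)"
    and "continuous_map X euclidean (\<lambda>x. \<Sum>i<r. c i x *\<^sub>R B i x)" and "i < r"
  shows "continuous_map X euclideanreal (c i)"
  unfolding continuous_map_euclidean_iff_tendsto
proof
  fix x assume x: "x \<in> topspace X"
  show "(c i \<longlongrightarrow> c i x) (atin X x)"
    by (rule coeff_tendsto[OF assms(1)[OF x], of B _ c "\<lambda>i. c i x"])
      (use assms x in \<open>auto simp: continuous_map_euclidean_iff_tendsto\<close>)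
qed

text \<open>Where the coefficient bound holds, a vanishing combination has vanishing coefficients;
  the bound holds near \<open>x\<close>.\<close>

lemma openin_lin_indep:
  fixes B :: "nat \<Rightarrow> 'w \<Rightarrow> 'e::euclidean_space"
  assumes "\<And>i. i < r \<Longrightarrow> continuous_map X euclidean (B i)" "x \<in> topspace X" "lin_indep r (\<lambda>i. B i x)"
  obtains U where "openin X U" "x \<in> U" "\<And>y. y \<in> U \<Longrightarrow> lin_indep r (\<lambda>i. B i y)"
proof -
  obtain K where K: "K > 0"
    "\<forall>\<^sub>F y in atin X x. \<forall>c. \<forall>i<r. \<bar>c i\<bar> \<le> K * norm (\<Sum>j<r. c j *\<^sub>R B j y)"
    using eventually_coeff_bound[OF assms(3), of B "atin X x"] assms
    by (auto simp: continuous_map_euclidean_iff_tendsto)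
  then have "\<forall>\<^sub>F y in atin X x. lin_indep r (\<lambda>i. B i y)"
    by (auto elim!: eventually_mono simp: lin_indep_def) (metis abs_le_zero_iff mult_zero_right norm_zero)
  then obtain U where U: "openin X U" "x \<in> U" "\<And>y. y \<in> U - {x} \<Longrightarrow> lin_indep r (\<lambda>i. B i y)"
    using assms(2) by (auto simp: eventually_atin)
  \<comment> \<open>The filter \<open>atin\<close> leaves out the point \<open>x\<close> itself,
    where independence is the hypothesis.\<close>
  then have "\<And>y. y \<in> U \<Longrightarrow> lin_indep r (\<lambda>i. B i y)" using assms(3) by (metis DiffI singletonD)
  then show thesis using that U by blast
qed

lemma lin_indep_snoc:
  assumes "lin_indep r b" "e \<notin> span (b ` {..<r})"
  shows "lin_indep (Suc r) (\<lambda>i. if i < r then b i else e)" (is "lin_indep _ ?b")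
proof -
  have b: "inj_on b {..<r}" "independent (b ` {..<r})" using assms by (auto simp: lin_indep_iff)
  have im: "?b ` {..<Suc r} = insert e (b ` {..<r})" by (auto simp: lessThan_Suc)
  have "e \<notin> b ` {..<r}" using assms(2) span_base[of e "b ` {..<r}"] by (rule contrapos_nn)
  moreover have "inj_on ?b {..<r}"
    by (rule inj_on_cong[THEN iffD1, OF _ b(1)]) simp
  moreover have "?b ` ({..<r} - {r}) = b ` {..<r}" by auto
  ultimately have "inj_on ?b {..<Suc r}" unfolding lessThan_Suc inj_on_insert by simp
  moreover have "independent (?b ` {..<Suc r})"
    unfolding im using assms(2) b(2) by (simp add: independent_insertI)
  ultimately show ?thesis by (simp add: lin_indep_iff)
qed

lemma extend_lin_indep:
  fixes b :: "nat \<Rightarrow> 'e::euclidean_space"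
  assumes "lin_indep r b" "r < DIM('e)"
  obtains e where "lin_indep (Suc r) (\<lambda>i. if i < r then b i else e)"
proof -
  have "dim (b ` {..<r}) < DIM('e)"
    using dim_le_card'[of "b ` {..<r}"] card_image_le[of "{..<r}" b] assms(2) by auto
  then have "span (b ` {..<r}) \<noteq> UNIV" by (metis dim_UNIV dim_span less_irrefl)
  then obtain e where "e \<notin> span (b ` {..<r})" by blast
  then show thesis using that lin_indep_snoc[OF assms(1)] by blast
qed

section \<open>Pointwise operations and quotients by a subspace\<close>

lemma sum_fun_apply: "(\<Sum>i\<in>A. f i) x = (\<Sum>i\<in>A. f i x)"
  for f :: "'i \<Rightarrow> 'a \<Rightarrow> 'b::comm_monoid_add"
  by (induction A rule: infinite_finite_induct) auto

lemma scaleR_fun_apply: "(a *\<^sub>R f) x = a *\<^sub>R f x"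
  by (simp add: scaleR_fun_def)

lemma coset_eq_iff:
  assumes "subspace K"
  shows "coset K v = coset K w \<longleftrightarrow> v - w \<in> K"
proof
  assume "coset K v = coset K w"
  moreover have "v \<in> coset K v" using subspace_0[OF assms] by (force simp: coset_def)
  ultimately obtain d where "d \<in> K" "v = w + d" by (auto simp: coset_def)
  then show "v - w \<in> K" by simp
next
  assume *: "v - w \<in> K"
  have "\<exists>d'. v + d = w + d' \<and> d' \<in> K" if "d \<in> K" for d
    using subspace_add[OF assms * that] by (intro exI[of _ "(v - w) + d"]) simp
  moreover have "\<exists>d'. w + d = v + d' \<and> d' \<in> K" if "d \<in> K" for d
    using subspace_diff[OF assms that *] by (intro exI[of _ "d - (v - w)"]) simp
  ultimately show "coset K v = coset K w" by (auto simp: coset_def)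
qed

lemma coset_add_coset:
  assumes "subspace K"
  shows "coset_add (coset K v) (coset K w) = coset K (v + w)"
proof -
  have "\<exists>d. (v + d1) + (w + d2) = (v + w) + d \<and> d \<in> K" if "d1 \<in> K" "d2 \<in> K" for d1 d2
    using subspace_add[OF assms that] by (intro exI[of _ "d1 + d2"]) simp
  moreover have "(v + w) + d = (v + d) + (w + 0)" for d by simp
  ultimately show ?thesis
    using subspace_0[OF assms] unfolding coset_add_def coset_def by blast
qed

lemma coset_scale_coset:
  assumes "subspace K"
  shows "coset_scale K a (coset K v) = coset K (a *\<^sub>R v)"
proof -
  have "\<exists>d. a *\<^sub>R (v + d1) + d2 = a *\<^sub>R v + d \<and> d \<in> K" if "d1 \<in> K" "d2 \<in> K" for d1 d2
    using subspace_add[OF assms subspace_scale[OF assms that(1), of a] that(2)]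
    by (intro exI[of _ "a *\<^sub>R d1 + d2"]) (simp add: scaleR_add_right)
  moreover have "a *\<^sub>R v + d = a *\<^sub>R (v + 0) + d" for d by simp
  ultimately show ?thesis
    using subspace_0[OF assms] unfolding coset_scale_def coset_def by blast
qed

lemma sum_indicator_mult:
  fixes f :: "nat \<Rightarrow> real"
  assumes "l < r"
  shows "(\<Sum>j<r. (if j = l then 1 else 0) * f j) = f l"
proof -
  have "(\<Sum>j<r. (if j = l then 1 else 0) * f j) = (\<Sum>j<r. if j = l then f j else 0)"
    by (rule sum.cong) auto
  then show ?thesis using assms by simp
qed

text \<open>The metric and the Levi form transform in the same way under an arrow; this interchange
  of sums serves both, with \<open>q\<close> the matrix of the form at the target and
  \<open>a\<close> the matrix of the arrow.\<close>

lemma bilinear_sum_pullback: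
  fixes c d :: "nat \<Rightarrow> real" and a :: "nat \<times> nat \<Rightarrow> real"
  shows "(\<Sum>i<r. \<Sum>j<r. (\<Sum>k<r. c k * a (i, k)) * (\<Sum>l<r. d l * a (j, l)) * q i j) =
    (\<Sum>k<r. \<Sum>l<r. c k * d l * (\<Sum>i<r. \<Sum>j<r. a (i, k) * a (j, l) * q i j))"
proof -
  have "(\<Sum>i<r. \<Sum>j<r. (\<Sum>k<r. c k * a (i, k)) * (\<Sum>l<r. d l * a (j, l)) * q i j) =
      (\<Sum>i<r. \<Sum>j<r. \<Sum>k<r. \<Sum>l<r. c k * d l * (a (i, k) * a (j, l) * q i j))"
    unfolding sum_product by (simp add: sum_distrib_left sum_distrib_right mult_ac)
  also have "\<dots> = (\<Sum>i<r. \<Sum>k<r. \<Sum>j<r. \<Sum>l<r. c k * d l * (a (i, k) * a (j, l) * q i j))"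
    by (rule sum.cong[OF refl], rule sum.swap)
  also have "\<dots> = (\<Sum>k<r. \<Sum>i<r. \<Sum>j<r. \<Sum>l<r. c k * d l * (a (i, k) * a (j, l) * q i j))"
    by (rule sum.swap)
  also have "\<dots> = (\<Sum>k<r. \<Sum>i<r. \<Sum>l<r. \<Sum>j<r. c k * d l * (a (i, k) * a (j, l) * q i j))"
    by (rule sum.cong[OF refl], rule sum.cong[OF refl], rule sum.swap)
  also have "\<dots> = (\<Sum>k<r. \<Sum>l<r. \<Sum>i<r. \<Sum>j<r. c k * d l * (a (i, k) * a (j, l) * q i j))"
    by (rule sum.cong[OF refl], rule sum.swap)
  finally show ?thesis by (simp add: sum_distrib_left)
qed

section \<open>Uniform bounds over compact sets\<close>

lemma compactin_real_bounded:
  assumes "compactin X K" "continuous_map (subtopology X K) euclideanreal f"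
  obtains B where "\<And>x. x \<in> K \<Longrightarrow> \<bar>f x\<bar> \<le> B"
proof -
  have "compactin euclideanreal (f ` K)"
    using image_compactin[OF _ assms(2), of K] assms(1) by (simp add: compactin_subtopology)
  then have "bounded (f ` K)" by (simp add: compact_imp_bounded)
  then show thesis using that by (auto simp: bounded_iff)
qed

lemma compactin_real_pos_lower_bound:
  assumes "compactin X K" "continuous_map (subtopology X K) euclideanreal f" "\<And>x. x \<in> K \<Longrightarrow> 0 < f x"
  obtains \<delta> :: real where "\<delta> > 0" "\<And>x. x \<in> K \<Longrightarrow> \<delta> \<le> f x"
proof (cases "K = {}")
  case False
  have "compactin euclideanreal (f ` K)"
    using image_compactin[OF _ assms(2), of K] assms(1) by (simp add: compactin_subtopology)
  then have "compact (f ` K)" by simp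
  from compact_attains_inf[OF this] False obtain x where "x \<in> K" "\<forall>y\<in>K. f x \<le> f y" by auto
  then show thesis using that[of "f x"] assms(3) by auto
qed (use that[of 1] in simp)

lemma closedin_Collect_ball_finite:
  assumes "finite I" "\<And>i. i \<in> I \<Longrightarrow> closedin X {x \<in> topspace X. P i x}"
  shows "closedin X {x \<in> topspace X. \<forall>i\<in>I. P i x}"
  using assms
proof (induction I rule: finite_induct)
  case (insert i I)
  have "{x \<in> topspace X. \<forall>j\<in>insert i I. P j x} =
      {x \<in> topspace X. P i x} \<inter> {x \<in> topspace X. \<forall>j\<in>I. P j x}" by auto
  then show ?case using insert by (simp add: closedin_Int)
qed simp

text \<open>The form has a positive minimum over \<open>K\<close> times the boundary of the unit
  cube, and homogeneity of degree two extends the estimate to all vectors. The cube replaces the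
  round sphere because its boundary is a finite union of products of compact sets.\<close>

lemma quadratic_form_lower_bound:
  fixes q :: "nat \<Rightarrow> nat \<Rightarrow> 'w \<Rightarrow> real"
  assumes K: "compactin X K"
    and q: "\<And>i j. i < r \<Longrightarrow> j < r \<Longrightarrow> continuous_map (subtopology X K) euclideanreal (q i j)"
    and pos: "\<And>y c. y \<in> K \<Longrightarrow> \<exists>i<r. c i \<noteq> 0 \<Longrightarrow> 0 < (\<Sum>i<r. \<Sum>j<r. c i * c j * q i j y)"
  obtains \<delta> where "\<delta> > 0"
    "\<And>y c i. y \<in> K \<Longrightarrow> i < r \<Longrightarrow> \<delta> * (c i)\<^sup>2 \<le> (\<Sum>i<r. \<Sum>j<r. c i * c j * q i j y)"
proof -
  let ?Q = "\<lambda>y c. \<Sum>i<r. \<Sum>j<r. c i * c j * q i j y"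
  let ?C = "product_topology (\<lambda>_. euclideanreal) {..<r}"
  \<comment> \<open>\<open>S m\<close> is the pair of opposite faces on which coordinate
    \<open>m\<close> is -1 or 1.\<close>
  define S where "S m = (PiE {..<r} (\<lambda>i. if i = m then {-1, 1} else {-1..1}) :: (nat \<Rightarrow> real) set)" for m
  have "compactin ?C (S m)" for m
    unfolding S_def
  proof (rule compactin_PiE[THEN iffD2, OF disjI2], rule ballI)
    fix i show "compactin euclideanreal (if i = m then {-1, 1} else {-1..1})"
      by (cases "i = m") (simp_all add: finite_imp_compact)
  qed
  then have "compactin ?C (\<Union>m<r. S m)" by (intro compactin_Union) auto
  with K have KS: "compactin (prod_topology X ?C) (K \<times> (\<Union>m<r. S m))" by (simp add: compactin_Times)
  let ?Y = "subtopology (prod_topology X ?C) (K \<times> (\<Union>m<r. S m))"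
  have cK: "continuous_map ?Y (subtopology X K) fst"
  proof (rule continuous_map_into_subtopology)
    show "continuous_map ?Y X fst" by (rule continuous_map_from_subtopology[OF continuous_map_fst])
    show "fst \<in> topspace ?Y \<rightarrow> K" by (rule Pi_I) (simp add: mem_Times_iff)
  qed
  have cq: "continuous_map ?Y euclideanreal (\<lambda>p. q i j (fst p))" if "i < r" "j < r" for i j
    using continuous_map_compose[OF cK q[OF that]] by (simp add: o_def)
  have cc: "continuous_map ?Y euclideanreal (\<lambda>p. snd p i)" if "i < r" for i
  proof -
    have "continuous_map ?Y ?C snd" by (rule continuous_map_from_subtopology[OF continuous_map_snd])
    moreover have "continuous_map ?C euclideanreal (\<lambda>c. c i)"
      using that by (intro continuous_map_product_projection) simp
    ultimately have "continuous_map ?Y euclideanreal ((\<lambda>c. c i) \<circ> snd)" by (rule continuous_map_compose)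
    then show ?thesis by (simp add: o_def)
  qed
  have "continuous_map ?Y euclideanreal (\<lambda>p. ?Q (fst p) (snd p))"
    by (intro continuous_map_sum continuous_map_real_mult cq cc) auto
  moreover have "0 < ?Q (fst p) (snd p)" if p: "p \<in> K \<times> (\<Union>m<r. S m)" for p
  proof (rule pos)
    obtain m where m: "m < r" "snd p \<in> S m" using p by auto
    then have "snd p m \<in> {-1, 1}" by (auto simp: S_def dest!: PiE_mem[of _ _ _ m])
    then show "\<exists>i<r. snd p i \<noteq> 0" using m(1) by auto
  qed (use p in auto)
  ultimately obtain \<delta> where \<delta>: "\<delta> > 0" "\<And>p. p \<in> K \<times> (\<Union>m<r. S m) \<Longrightarrow> \<delta> \<le> ?Q (fst p) (snd p)"
    using compactin_real_pos_lower_bound[OF KS] by blast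
  show thesis
  proof (rule that[OF \<delta>(1)])
    fix y i and c :: "nat \<Rightarrow> real" assume y: "y \<in> K" and i: "i < r"
    have "Max ((\<lambda>i. \<bar>c i\<bar>) ` {..<r}) \<in> (\<lambda>i. \<bar>c i\<bar>) ` {..<r}" using i by (intro Max_in) auto
    then obtain m where m: "m < r" "Max ((\<lambda>i. \<bar>c i\<bar>) ` {..<r}) = \<bar>c m\<bar>" by auto
    have le: "\<bar>c j\<bar> \<le> \<bar>c m\<bar>" if "j < r" for j
      unfolding m(2)[symmetric] by (rule Max_ge) (use that in auto)
    show "\<delta> * (c i)\<^sup>2 \<le> ?Q y c"
    proof (cases "c m = 0")
      case True
      then have "c j = 0" if "j < r" for j using le[OF that] by simp
      then show ?thesis using i by simp
    next
      case False
      \<comment> \<open>Dividing by the entry of largest modulus moves \<open>c\<close> into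
        \<open>S m\<close>; the restriction to indices below \<open>r\<close> makes \<open>e\<close>
        a point of the product space.\<close>
      define e where "e = (\<lambda>j\<in>{..<r}. c j / \<bar>c m\<bar>)"
      have "e \<in> S m"
        unfolding S_def
      proof (rule PiE_I)
        fix j assume "j \<in> {..<r}"
        then have j: "j < r" by simp
        have "\<bar>e j\<bar> \<le> 1" using le[OF j] False j by (simp add: e_def)
        moreover have "e m \<in> {-1, 1}" using False m(1) by (auto simp: e_def abs_if)
        ultimately show "e j \<in> (if j = m then {-1, 1} else {-1..1})" by auto
      qed (simp add: e_def)
      then have "\<delta> \<le> ?Q y e" using \<delta>(2)[of "(y, e)"] y m(1) by auto
      moreover have "?Q y c = (c m)\<^sup>2 * ?Q y e"
      proof -
        have eq: "c i * c j * q i j y = (c m)\<^sup>2 * (e i * e j * q i j y)" if "i < r" "j < r" for i j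
        proof -
          have "(c m)\<^sup>2 = \<bar>c m\<bar> * \<bar>c m\<bar>" by (simp add: power2_eq_square)
          moreover have "c i = \<bar>c m\<bar> * e i" "c j = \<bar>c m\<bar> * e j" using that False by (simp_all add: e_def)
          ultimately show ?thesis by (metis (no_types, opaque_lifting) mult.assoc mult.left_commute)
        qed
        show ?thesis
          unfolding sum_distrib_left by (intro sum.cong refl eq) simp_all
      qed
      moreover have "(c i)\<^sup>2 \<le> (c m)\<^sup>2" using le[OF i] by (simp add: abs_le_square_iff)
      moreover have "\<delta> * (c i)\<^sup>2 \<le> \<delta> * (c m)\<^sup>2" "(c m)\<^sup>2 * \<delta> \<le> (c m)\<^sup>2 * ?Q y e"
        using calculation \<delta>(1) by (auto intro: mult_left_mono)
      ultimately show ?thesis by (simp add: mult.commute)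
    qed
  qed
qed

section \<open>Tangent vectors and Lie brackets in charts\<close>

locale smooth_mfd =
  fixes M :: "('m, 'e::euclidean_space) manifold"
  assumes smooth_manifold: "smooth_manifold M"
begin

lemma chart_openin: "c \<in> atlas M \<Longrightarrow> openin (mtop M) (fst c)"
  using smooth_manifold by (simp add: smooth_manifold_def)

lemma chart_homeomorphic:
  "c \<in> atlas M \<Longrightarrow> homeomorphic_map (subtopology (mtop M) (fst c)) (top_of_set (snd c ` fst c)) (snd c)"
  using smooth_manifold by (simp add: smooth_manifold_def)

lemma transition_smooth:
  "c \<in> atlas M \<Longrightarrow> c' \<in> atlas M \<Longrightarrow> smooth_on (snd c ` (fst c \<inter> fst c')) (snd c' \<circ> chart_inv c)"
  using smooth_manifold by (simp add: smooth_manifold_def)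

lemma chart_subset: "c \<in> atlas M \<Longrightarrow> fst c \<subseteq> points M"
  using chart_openin openin_subset by blast

lemma ex_chart: "x \<in> points M \<Longrightarrow> \<exists>c. c \<in> charts_at M x"
  using smooth_manifold unfolding smooth_manifold_def by blast

lemma chart_inj: "c \<in> atlas M \<Longrightarrow> inj_on (snd c) (fst c)"
  using homeomorphic_imp_injective_map[OF chart_homeomorphic] chart_subset
  by (metis topspace_subtopology_subset)

lemma chart_inv_left: "c \<in> atlas M \<Longrightarrow> x \<in> fst c \<Longrightarrow> chart_inv c (snd c x) = x"
  by (simp add: chart_inj inv_into_f_f)

lemma chart_image_open:
  assumes "openin (mtop M) U" "c \<in> atlas M"
  shows "open (snd c ` (U \<inter> fst c))"
proof -
  have "openin (subtopology (mtop M) (fst c)) (U \<inter> fst c)"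
    using assms(1) by (auto simp: openin_subtopology)
  then have "openin (top_of_set (snd c ` fst c)) (snd c ` (U \<inter> fst c))"
    using homeomorphic_imp_open_map[OF chart_homeomorphic[OF assms(2)]] by (simp add: open_map_def)
  moreover have "open (snd c ` fst c)"
    using smooth_manifold assms(2) by (simp add: smooth_manifold_def)
  ultimately show ?thesis by (rule openin_open_trans)
qed

lemma chart_continuous:
  "c \<in> atlas M \<Longrightarrow> continuous_map (subtopology (mtop M) (fst c)) euclidean (snd c)"
  using homeomorphic_imp_continuous_map[OF chart_homeomorphic] continuous_map_into_fulltopology by blast

lemma continuous_map_via_chart:
  assumes c: "c \<in> atlas M" and U: "U \<subseteq> fst c"
    and h: "continuous_on (snd c ` U) (\<lambda>p. h (chart_inv c p))"
  shows "continuous_map (subtopology (mtop M) U) euclidean h"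
proof -
  have "continuous_map (subtopology (mtop M) U) (top_of_set (snd c ` U)) (snd c)"
    using continuous_map_from_subtopology_mono[OF chart_continuous[OF c] U]
    by (auto simp: continuous_map_in_subtopology)
  moreover have "continuous_map (top_of_set (snd c ` U)) euclidean (\<lambda>p. h (chart_inv c p))"
    using h by simp
  ultimately have "continuous_map (subtopology (mtop M) U) euclidean ((\<lambda>p. h (chart_inv c p)) \<circ> snd c)"
    by (rule continuous_map_compose)
  then show ?thesis
    by (rule continuous_map_eq) (use U chart_inv_left[OF c] in auto)
qed

lemma transition_has_derivative:
  assumes "c \<in> charts_at M x" "c' \<in> charts_at M x"
  shows "((snd c' \<circ> chart_inv c) has_derivative frechet_derivative (snd c' \<circ> chart_inv c) (at (snd c x)))
    (at (snd c x))"
  using assms by (intro smooth_onD[OF transition_smooth]) auto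

lemma transition_refl:
  assumes "c \<in> charts_at M x"
  shows "frechet_derivative (snd c \<circ> chart_inv c) (at (snd c x)) e = e"
proof -
  have c: "c \<in> atlas M" using assms by simp
  have "frechet_derivative (snd c \<circ> chart_inv c) (at (snd c x)) = frechet_derivative (\<lambda>p. p) (at (snd c x))"
    by (rule frechet_derivative_cong_open[OF chart_image_open[OF chart_openin[OF c] c]])
      (use assms in \<open>auto simp: chart_inv_left\<close>)
  then show ?thesis by (simp add: frechet_derivative_ident)
qed

text \<open>Cocycle identity of the transition Jacobians, from the chain rule near
  \<open>snd c x\<close>; it makes \<open>tvec_of\<close> a consistent family of coordinate
  vectors.\<close>

lemma transition_chain:
  assumes x: "c \<in> charts_at M x" "c' \<in> charts_at M x" "c'' \<in> charts_at M x"
  shows "frechet_derivative (snd c'' \<circ> chart_inv c') (at (snd c' x))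
      (frechet_derivative (snd c' \<circ> chart_inv c) (at (snd c x)) e) =
    frechet_derivative (snd c'' \<circ> chart_inv c) (at (snd c x)) e"
proof -
  have c: "c \<in> atlas M" "c' \<in> atlas M" "c'' \<in> atlas M" using x by auto
  have eq: "(snd c' \<circ> chart_inv c) (snd c x) = snd c' x" using x by (simp add: chart_inv_left)
  have d: "((\<lambda>p. (snd c'' \<circ> chart_inv c') ((snd c' \<circ> chart_inv c) p)) has_derivative
      (\<lambda>e. frechet_derivative (snd c'' \<circ> chart_inv c') (at (snd c' x))
        (frechet_derivative (snd c' \<circ> chart_inv c) (at (snd c x)) e))) (at (snd c x))"
    by (rule has_derivative_compose[OF transition_has_derivative[OF x(1,2)]], subst (1) eq)
      (rule transition_has_derivative[OF x(2,3)])
  have "openin (mtop M) (fst c' \<inter> fst c'')" using c by (simp add: chart_openin openin_Int)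
  from chart_image_open[OF this c(1)]
  have "((snd c'' \<circ> chart_inv c) has_derivative
      (\<lambda>e. frechet_derivative (snd c'' \<circ> chart_inv c') (at (snd c' x))
        (frechet_derivative (snd c' \<circ> chart_inv c) (at (snd c x)) e))) (at (snd c x))"
    by (rule has_derivative_transform_within_open[OF d]) (use x c in \<open>auto simp: chart_inv_left\<close>)
  from frechet_derivative_at[OF this] show ?thesis by metis
qed

section \<open>Tangent spaces\<close>

lemma tangentI:
  assumes "\<And>c c'. c \<in> charts_at M x \<Longrightarrow> c' \<in> charts_at M x \<Longrightarrow>
      v c' = frechet_derivative (snd c' \<circ> chart_inv c) (at (snd c x)) (v c)"
    and "\<And>c. c \<notin> charts_at M x \<Longrightarrow> v c = 0"
  shows "v \<in> tangent_space M x"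
  using assms unfolding tangent_space_def by blast

lemma tangent_outside: "v \<in> tangent_space M x \<Longrightarrow> c \<notin> charts_at M x \<Longrightarrow> v c = 0"
  unfolding tangent_space_def by blast

lemma tvec_of_in_tangent: "c \<in> charts_at M x \<Longrightarrow> tvec_of M c x e \<in> tangent_space M x"
  by (rule tangentI) (auto simp: tvec_of_def transition_chain simp del: o_apply)

lemma tvec_of_eval: "c \<in> charts_at M x \<Longrightarrow> tvec_of M c x e c = e"
  by (auto simp: tvec_of_def transition_refl)

lemma tangentD:
  "v \<in> tangent_space M x \<Longrightarrow> c \<in> charts_at M x \<Longrightarrow> c' \<in> charts_at M x \<Longrightarrow>
    v c' = frechet_derivative (snd c' \<circ> chart_inv c) (at (snd c x)) (v c)"
  unfolding tangent_space_def by blast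

lemma tangent_eqI:
  assumes "v \<in> tangent_space M x" "w \<in> tangent_space M x" "c \<in> charts_at M x" "v c = w c"
  shows "v = w"
proof
  fix c'
  show "v c' = w c'"
  proof (cases "c' \<in> charts_at M x")
    case True
    then show ?thesis
      using tangentD[OF assms(1,3) True] tangentD[OF assms(2,3) True] assms(4) by simp
  next
    case False
    then show ?thesis using tangent_outside[OF assms(1) False] tangent_outside[OF assms(2) False] by simp
  qed
qed

lemma tangent_subspace: "subspace (tangent_space M x)"
proof (rule subspaceI)
  note lin = has_derivative_linear[OF transition_has_derivative]
  show "0 \<in> tangent_space M x"
    by (rule tangentI) (simp_all add: linear_0[OF lin])
  fix v assume v: "v \<in> tangent_space M x"
  show "a *\<^sub>R v \<in> tangent_space M x" for a
  proof (rule tangentI)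
    fix c c' assume c: "c \<in> charts_at M x" "c' \<in> charts_at M x"
    show "(a *\<^sub>R v) c' = frechet_derivative (snd c' \<circ> chart_inv c) (at (snd c x)) ((a *\<^sub>R v) c)"
      unfolding scaleR_fun_apply linear_cmul[OF lin[OF c]] tangentD[OF v c] ..
  qed (simp add: scaleR_fun_apply tangent_outside[OF v])
  fix w assume w: "w \<in> tangent_space M x"
  show "v + w \<in> tangent_space M x"
  proof (rule tangentI)
    fix c c' assume c: "c \<in> charts_at M x" "c' \<in> charts_at M x"
    show "(v + w) c' = frechet_derivative (snd c' \<circ> chart_inv c) (at (snd c x)) ((v + w) c)"
      unfolding plus_fun_apply linear_add[OF lin[OF c]] tangentD[OF v c] tangentD[OF w c] ..
  qed (simp add: tangent_outside[OF v] tangent_outside[OF w])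
qed

text \<open>A tangent vector is determined by its value in one chart, so evaluation at
  \<open>c\<close> neither creates nor destroys relations. This moves questions from the function
  space of tangent vectors to the normed space \<open>'e\<close>, where the coefficient estimates
  hold.\<close>

lemma lin_indep_chart:
  assumes c: "c \<in> charts_at M x" and b: "\<And>i. i < r \<Longrightarrow> b i \<in> tangent_space M x"
  shows "lin_indep r (\<lambda>i. b i c) \<longleftrightarrow> lin_indep r b"
proof -
  have "(\<Sum>i<r. a i *\<^sub>R b i c) = 0 \<longleftrightarrow> (\<Sum>i<r. a i *\<^sub>R b i) = 0" for a
  proof
    assume "(\<Sum>i<r. a i *\<^sub>R b i c) = 0"
    then have "(\<Sum>i<r. a i *\<^sub>R b i) c = 0 c" by (simp add: sum_fun_apply scaleR_fun_apply)
    moreover have "(\<Sum>i<r. a i *\<^sub>R b i) \<in> tangent_space M x"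
      using b by (intro subspace_sum subspace_scale tangent_subspace) auto
    ultimately show "(\<Sum>i<r. a i *\<^sub>R b i) = 0"
      using tangent_eqI[OF _ subspace_0[OF tangent_subspace] c] by blast
  next
    assume "(\<Sum>i<r. a i *\<^sub>R b i) = 0"
    then have "(\<Sum>i<r. a i *\<^sub>R b i) c = 0" by simp
    then show "(\<Sum>i<r. a i *\<^sub>R b i c) = 0" by (simp add: sum_fun_apply scaleR_fun_apply)
  qed
  then show ?thesis by (simp add: lin_indep_def)
qed

lemma lin_indep_spans_UNIV:
  fixes b :: "nat \<Rightarrow> 'e"
  assumes "lin_indep DIM('e) b"
  shows "basis_of UNIV DIM('e) b"
proof -
  have b: "inj_on b {..<DIM('e)}" "independent (b ` {..<DIM('e)})"
    using assms by (auto simp: lin_indep_iff)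
  then have "UNIV \<subseteq> span (b ` {..<DIM('e)})"
    by (intro card_ge_dim_independent) (auto simp: card_image)
  then show ?thesis using b by (auto simp: basis_of_def)
qed

lemma tangent_basis:
  assumes x: "x \<in> points M" and b: "\<And>i. i < DIM('e) \<Longrightarrow> b i \<in> tangent_space M x" "lin_indep DIM('e) b"
  shows "basis_of (tangent_space M x) DIM('e) b"
  unfolding basis_of_iff
proof (intro conjI b equalityI subsetI)
  obtain c where c: "c \<in> charts_at M x" using ex_chart[OF x] by blast
  have span: "basis_of UNIV DIM('e) (\<lambda>i. b i c)"
    using lin_indep_spans_UNIV lin_indep_chart[of c x "DIM('e)" b, OF c b(1)] b(2) by blast
  fix v
  { assume v: "v \<in> tangent_space M x"
    define a where "a = coords DIM('e) (\<lambda>i. b i c) (v c)"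
    have "(\<Sum>i<DIM('e). a i *\<^sub>R b i) \<in> tangent_space M x"
      using b by (intro subspace_sum subspace_scale tangent_subspace) auto
    moreover have "v c = (\<Sum>i<DIM('e). a i *\<^sub>R b i) c"
      using coords_sum[OF span, of "v c"] by (simp add: a_def sum_fun_apply scaleR_fun_apply)
    ultimately have "v = (\<Sum>i<DIM('e). a i *\<^sub>R b i)" using tangent_eqI[OF v _ c] by blast
    then show "v \<in> range (\<lambda>a. \<Sum>i<DIM('e). a i *\<^sub>R b i)" by blast }
  { assume "v \<in> range (\<lambda>a. \<Sum>i<DIM('e). a i *\<^sub>R b i)"
    then show "v \<in> tangent_space M x"
      using b by (auto intro!: subspace_sum subspace_scale tangent_subspace) }
qed

section \<open>Vector fields and their brackets\<close>

lemma smooth_vector_field_subset: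
  "smooth_vector_field M U V \<Longrightarrow> U' \<subseteq> U \<Longrightarrow> smooth_vector_field M U' V"
  unfolding smooth_vector_field_def
  by (meson smooth_on_subset image_mono Int_mono subset_refl subsetD)

lemma smooth_vector_field_lincomb:
  assumes U: "openin (mtop M) U" and V: "\<And>i. i \<in> I \<Longrightarrow> smooth_vector_field M U (V i)"
  shows "smooth_vector_field M U (\<lambda>x. \<Sum>i\<in>I. a i *\<^sub>R V i x)"
proof -
  have "(\<Sum>i\<in>I. a i *\<^sub>R V i x) \<in> tangent_space M x" if "x \<in> U" for x
    using V that by (intro subspace_sum subspace_scale tangent_subspace) (auto simp: smooth_vector_field_def)
  moreover have "smooth_on (snd c ` (U \<inter> fst c)) (\<lambda>p. \<Sum>i\<in>I. a i *\<^sub>R V i (chart_inv c p) c)"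
    if "c \<in> atlas M" for c
    using V that by (intro smooth_on_lincomb chart_image_open U) (auto simp: smooth_vector_field_def)
  ultimately show ?thesis
    by (simp add: smooth_vector_field_def sum_fun_apply scaleR_fun_apply)
qed

text \<open>In another chart the constant field becomes the directional derivative of the transition
  map, read at the transported point; smoothness therefore goes through
  \<open>Ck_on_compose\<close>.\<close>

lemma smooth_vector_field_tvec_of:
  assumes c: "c \<in> atlas M" and U: "openin (mtop M) U" "U \<subseteq> fst c"
  shows "smooth_vector_field M U (\<lambda>x. tvec_of M c x e)"
  unfolding smooth_vector_field_def
proof (intro conjI ballI)
  show "tvec_of M c x e \<in> tangent_space M x" if "x \<in> U" for x
    using that c U by (intro tvec_of_in_tangent) auto
  fix c' assume c': "c' \<in> atlas M"
  let ?S = "snd c' ` (U \<inter> fst c')" and ?T = "snd c ` (fst c \<inter> fst c')"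
  let ?f = "\<lambda>p. frechet_derivative (snd c' \<circ> chart_inv c) (at p) e"
  have S: "open ?S" using chart_image_open[OF U(1) c'] .
  have T: "open ?T" using chart_image_open[OF chart_openin[OF c'] c] by (simp add: Int_commute)
  show "smooth_on ?S (\<lambda>p. tvec_of M c (chart_inv c' p) e c')"
    unfolding smooth_on_def
  proof
    fix k
    have f: "Ck_on k ?T ?f"
      using transition_smooth[OF c c'] Ck_on.simps(2) unfolding smooth_on_def by metis
    have "smooth_on ?S (snd c \<circ> chart_inv c')"
      using transition_smooth[OF c' c] by (rule smooth_on_subset) (use U(2) in auto)
    then have g: "Ck_on k ?S (\<lambda>p. (snd c \<circ> chart_inv c') p)" by (simp add: smooth_on_def o_def)
    have im: "(\<lambda>p. (snd c \<circ> chart_inv c') p) ` ?S \<subseteq> ?T"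
      using U(2) c' by (auto simp: chart_inv_left)
    have "Ck_on k ?S (\<lambda>p. ?f ((snd c \<circ> chart_inv c') p))"
      by (rule Ck_on_compose[OF S T im f g])
    then show "Ck_on k ?S (\<lambda>p. tvec_of M c (chart_inv c' p) e c')"
      by (rule Ck_on_cong[OF S, rotated]) (use c' in \<open>auto simp: chart_inv_left tvec_of_def\<close>)
  qed
qed

lemma vector_field_has_derivative:
  assumes "smooth_vector_field M U V" "x \<in> U" "c \<in> charts_at M x"
  shows "((\<lambda>p. V (chart_inv c p) c) has_derivative
    frechet_derivative (\<lambda>p. V (chart_inv c p) c) (at (snd c x))) (at (snd c x))"
  using assms by (intro smooth_onD[of "snd c ` (U \<inter> fst c)"]) (auto simp: smooth_vector_field_def)

text \<open>Obtained by differentiating the transformation law of \<open>V\<close> from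
  \<open>c\<close> to \<open>c'\<close>. The term with the second derivative of
  \<open>\<phi>\<close> is what prevents the derivative of a single field from being a tangent
  vector.\<close>

lemma vector_field_derivative_transition:
  assumes U: "openin (mtop M) U" "x \<in> U" and V: "smooth_vector_field M U V"
    and c: "c \<in> charts_at M x" "c' \<in> charts_at M x"
  defines "\<phi> \<equiv> snd c' \<circ> chart_inv c"
  shows "frechet_derivative (\<lambda>p. V (chart_inv c' p) c') (at (snd c' x)) (frechet_derivative \<phi> (at (snd c x)) u) =
    frechet_derivative (\<lambda>q. frechet_derivative \<phi> (at q) (V x c)) (at (snd c x)) u +
    frechet_derivative \<phi> (at (snd c x)) (frechet_derivative (\<lambda>p. V (chart_inv c p) c) (at (snd c x)) u)"
    (is "?L u = ?R u")
proof -
  have ca: "c \<in> atlas M" "c' \<in> atlas M" using c by auto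
  let ?S = "snd c ` ((U \<inter> fst c') \<inter> fst c)"
  have S: "open ?S" "snd c x \<in> ?S"
    using chart_image_open[OF openin_Int[OF U(1) chart_openin[OF ca(2)]] ca(1)] U c by auto
  have \<phi>x: "\<phi> (snd c x) = snd c' x" using c by (simp add: \<phi>_def chart_inv_left)
  have "((\<lambda>q. V (chart_inv c' (\<phi> q)) c') has_derivative ?L) (at (snd c x))"
  proof -
    have 1: "(\<phi> has_derivative frechet_derivative \<phi> (at (snd c x))) (at (snd c x))"
      unfolding \<phi>_def by (rule transition_has_derivative[OF c])
    have 2: "((\<lambda>p. V (chart_inv c' p) c') has_derivative
      frechet_derivative (\<lambda>p. V (chart_inv c' p) c') (at (snd c' x))) (at (\<phi> (snd c x)))"
      unfolding \<phi>x by (rule vector_field_has_derivative[OF V U(2) c(2)])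
    show ?thesis using has_derivative_compose[OF 1 2] .
  qed
  then have L: "((\<lambda>q. frechet_derivative \<phi> (at q) (V (chart_inv c q) c)) has_derivative ?L) (at (snd c x))"
  proof (rule has_derivative_transform_within_open[OF _ S])
    fix q assume "q \<in> ?S"
    then obtain y where y: "q = snd c y" "y \<in> U" "y \<in> fst c" "y \<in> fst c'" by blast
    then have "V y \<in> tangent_space M y" using V by (simp add: smooth_vector_field_def)
    then show "V (chart_inv c' (\<phi> q)) c' = frechet_derivative \<phi> (at q) (V (chart_inv c q) c)"
      using y ca tangentD[of "V y" y c c'] by (simp add: \<phi>_def chart_inv_left)
  qed
  have "smooth_on ?S \<phi>"
    unfolding \<phi>_def by (rule smooth_on_subset[OF transition_smooth[OF ca]]) auto
  then have \<phi>2: "Ck_on 2 ?S \<phi>" by (simp add: smooth_on_def)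
  have "(\<lambda>p. V (chart_inv c p) c) differentiable (at (snd c x))"
    using vector_field_has_derivative[OF V U(2) c(1)] by (auto simp: differentiable_def)
  from directional_derivative_product_rule[OF S \<phi>2 this]
  have "((\<lambda>q. frechet_derivative \<phi> (at q) (V (chart_inv c q) c)) has_derivative ?R) (at (snd c x))"
    using c by (simp add: chart_inv_left)
  from has_derivative_unique[OF L this] show ?thesis by metis
qed

text \<open>The terms with second derivatives of the transition map are symmetric in the values of
  the two fields and cancel in the difference.\<close>

lemma lie_bracket_in_tangent:
  assumes U: "openin (mtop M) U" "x \<in> U" and VW: "smooth_vector_field M U V" "smooth_vector_field M U W"
  shows "lie_bracket M V W x \<in> tangent_space M x"
  unfolding tangent_space_def
proof (intro CollectI conjI ballI allI impI)
  fix c c' assume c: "c \<in> charts_at M x" "c' \<in> charts_at M x"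
  let ?\<phi> = "snd c' \<circ> chart_inv c"
  have ca: "c \<in> atlas M" "c' \<in> atlas M" using c by auto
  let ?S = "snd c ` (fst c' \<inter> fst c)"
  have S: "open ?S" "snd c x \<in> ?S"
    using chart_image_open[OF chart_openin[OF ca(2)] ca(1)] c by auto
  have "Ck_on 2 ?S ?\<phi>"
    using transition_smooth[OF ca] by (simp add: smooth_on_def Int_commute)
  note sym = second_derivative_symmetric[OF S this]
  have t: "V x c' = frechet_derivative ?\<phi> (at (snd c x)) (V x c)"
    "W x c' = frechet_derivative ?\<phi> (at (snd c x)) (W x c)"
    using VW U c by (auto intro!: tangentD simp: smooth_vector_field_def)
  show "lie_bracket M V W x c' = frechet_derivative ?\<phi> (at (snd c x)) (lie_bracket M V W x c)"
    using c unfolding lie_bracket_def t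
    by (simp add: vector_field_derivative_transition[OF U _ c] VW sym[of "W x c" "V x c"]
        linear_diff[OF has_derivative_linear[OF transition_has_derivative[OF c]]])
qed (auto simp: lie_bracket_def)

lemma vector_field_derivative_lincomb:
  assumes x: "x \<in> U" "c \<in> charts_at M x" and X: "\<And>k. k \<in> K \<Longrightarrow> smooth_vector_field M U (X k)"
  shows "frechet_derivative (\<lambda>p. (\<Sum>k\<in>K. a k *\<^sub>R X k (chart_inv c p)) c) (at (snd c x)) u =
    (\<Sum>k\<in>K. a k *\<^sub>R frechet_derivative (\<lambda>p. X k (chart_inv c p) c) (at (snd c x)) u)"
proof -
  have "((\<lambda>p. \<Sum>k\<in>K. a k *\<^sub>R X k (chart_inv c p) c) has_derivative
    (\<lambda>u. \<Sum>k\<in>K. a k *\<^sub>R frechet_derivative (\<lambda>p. X k (chart_inv c p) c) (at (snd c x)) u)) (at (snd c x))"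
    by (intro has_derivative_sum has_derivative_scaleR_right vector_field_has_derivative[OF X x])
  from frechet_derivative_at[OF this, THEN fun_cong, of u, symmetric] show ?thesis
    unfolding sum_fun_apply scaleR_fun_apply .
qed

text \<open>Constant coefficients contribute no derivatives, so the bracket is bilinear here. This
  case is enough because a vector at a point can be extended with constant frame
  coefficients.\<close>

lemma lie_bracket_lincomb:
  assumes x: "x \<in> U" and V: "\<And>i. i \<in> I \<Longrightarrow> smooth_vector_field M U (V i)"
    and W: "\<And>j. j \<in> J \<Longrightarrow> smooth_vector_field M U (W j)"
  shows "lie_bracket M (\<lambda>y. \<Sum>i\<in>I. a i *\<^sub>R V i y) (\<lambda>y. \<Sum>j\<in>J. b j *\<^sub>R W j y) x =
    (\<Sum>i\<in>I. \<Sum>j\<in>J. (a i * b j) *\<^sub>R lie_bracket M (V i) (W j) x)"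
proof
  fix c
  show "lie_bracket M (\<lambda>y. \<Sum>i\<in>I. a i *\<^sub>R V i y) (\<lambda>y. \<Sum>j\<in>J. b j *\<^sub>R W j y) x c =
    (\<Sum>i\<in>I. \<Sum>j\<in>J. (a i * b j) *\<^sub>R lie_bracket M (V i) (W j) x) c"
  proof (cases "c \<in> charts_at M x")
    case c: True
    note deriv = vector_field_derivative_lincomb[OF x c]
    have lin: "linear (frechet_derivative (\<lambda>p. X (chart_inv c p) c) (at (snd c x)))"
      if "smooth_vector_field M U X" for X
      using has_derivative_linear[OF vector_field_has_derivative[OF that x c]] .
    have "lie_bracket M (\<lambda>y. \<Sum>i\<in>I. a i *\<^sub>R V i y) (\<lambda>y. \<Sum>j\<in>J. b j *\<^sub>R W j y) x c =
      (\<Sum>j\<in>J. b j *\<^sub>R frechet_derivative (\<lambda>p. W j (chart_inv c p) c) (at (snd c x)) (\<Sum>i\<in>I. a i *\<^sub>R V i x c)) -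
      (\<Sum>i\<in>I. a i *\<^sub>R frechet_derivative (\<lambda>p. V i (chart_inv c p) c) (at (snd c x)) (\<Sum>j\<in>J. b j *\<^sub>R W j x c))"
      using c by (simp add: lie_bracket_def deriv V W) (simp add: sum_fun_apply scaleR_fun_apply)
    also have "\<dots> = (\<Sum>j\<in>J. \<Sum>i\<in>I. (a i * b j) *\<^sub>R frechet_derivative (\<lambda>p. W j (chart_inv c p) c) (at (snd c x)) (V i x c)) -
      (\<Sum>i\<in>I. \<Sum>j\<in>J. (a i * b j) *\<^sub>R frechet_derivative (\<lambda>p. V i (chart_inv c p) c) (at (snd c x)) (W j x c))"
      by (simp add: linear_sum[OF lin] linear_cmul[OF lin] V W scaleR_sum_right mult.commute)
    also have "\<dots> = (\<Sum>i\<in>I. \<Sum>j\<in>J. (a i * b j) *\<^sub>R lie_bracket M (V i) (W j) x c)"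
      using c by (subst sum.swap) (simp add: lie_bracket_def scaleR_diff_right sum_subtractf)
    finally show ?thesis by (simp add: sum_fun_apply scaleR_fun_apply)
  next
    case False
    then have "lie_bracket M X Y x c = 0" for X Y by (auto simp: lie_bracket_def)
    then show ?thesis by (simp add: sum_fun_apply scaleR_fun_apply)
  qed
qed

lemma lie_bracket_continuous:
  assumes U: "openin (mtop M) U" and c: "c \<in> atlas M"
    and VW: "smooth_vector_field M U V" "smooth_vector_field M U W"
  shows "continuous_on (snd c ` (U \<inter> fst c)) (\<lambda>p. lie_bracket M V W (chart_inv c p) c)"
proof -
  let ?S = "snd c ` (U \<inter> fst c)"
  have S: "open ?S" by (rule chart_image_open[OF U c])
  have D: "Ck_on 0 ?S (\<lambda>p. frechet_derivative (\<lambda>p. X (chart_inv c p) c) (at p) (Y (chart_inv c p) c))"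
    if "smooth_vector_field M U X" "smooth_vector_field M U Y" for X Y
  proof (rule Ck_on_directional[OF S])
    show "Ck_on (Suc 0) ?S (\<lambda>p. X (chart_inv c p) c)" "Ck_on 0 ?S (\<lambda>p. Y (chart_inv c p) c)"
      using that c unfolding smooth_vector_field_def smooth_on_def by blast+
  qed
  have "continuous_on ?S (\<lambda>p. frechet_derivative (\<lambda>p. W (chart_inv c p) c) (at p) (V (chart_inv c p) c)
      - frechet_derivative (\<lambda>p. V (chart_inv c p) c) (at p) (W (chart_inv c p) c))"
    using D[OF VW(2,1)] D[OF VW] by (auto intro: continuous_on_diff)
  then show ?thesis
    by (rule continuous_on_eq) (use c in \<open>auto simp: lie_bracket_def chart_inv_left\<close>)
qed

lemma vector_field_continuous:
  assumes "c \<in> atlas M" "U \<subseteq> fst c" "smooth_vector_field M U V"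
  shows "continuous_map (subtopology (mtop M) U) euclidean (\<lambda>x. V x c)"
proof (rule continuous_map_via_chart[OF assms(1,2)])
  have "smooth_on (snd c ` (U \<inter> fst c)) (\<lambda>p. V (chart_inv c p) c)"
    using assms by (simp add: smooth_vector_field_def)
  then show "continuous_on (snd c ` U) (\<lambda>p. V (chart_inv c p) c)"
    using assms(2) by (auto dest!: smooth_on_continuous simp: Int_absorb2)
qed

section \<open>Local compactness of the manifold\<close>

lemma Hausdorff: "Hausdorff_space (mtop M)"
  using smooth_manifold by (simp add: smooth_manifold_def)

lemma locally_compact: "locally_compact_space (mtop M)"
  unfolding locally_compact_space_def
proof
  fix x assume "x \<in> points M"
  then obtain c where c: "c \<in> atlas M" "x \<in> fst c" using ex_chart by blast
  have "open (snd c ` (fst c \<inter> fst c))" by (rule chart_image_open[OF chart_openin[OF c(1)] c(1)])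
  then obtain e where e: "e > 0" "cball (snd c x) e \<subseteq> snd c ` fst c"
    using c(2) by (auto simp: open_contains_cball)
  let ?X = "subtopology (mtop M) (fst c)"
  have top: "topspace ?X = fst c" using chart_subset[OF c(1)] by (simp add: Int_absorb1)
  let ?K = "{y \<in> fst c. snd c y \<in> cball (snd c x) e}" and ?U = "{y \<in> fst c. snd c y \<in> ball (snd c x) e}"
  have im: "snd c ` ?K = cball (snd c x) e" using e(2) by blast
  have "compactin (top_of_set (snd c ` fst c)) (cball (snd c x) e)"
    using e(2) by (simp add: compactin_subtopology)
  then have "compactin ?X ?K"
    using homeomorphic_map_compactness[OF chart_homeomorphic[OF c(1)], of ?K] unfolding im top by blast
  then have "compactin (mtop M) ?K" by (simp add: compactin_subtopology)
  moreover have "openin ?X {y \<in> topspace ?X. snd c y \<in> ball (snd c x) e}"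
    by (rule openin_continuous_map_preimage[OF chart_continuous[OF c(1)]]) simp
  then have "openin (mtop M) ?U"
    unfolding top using chart_openin[OF c(1)] by (rule openin_trans_full)
  moreover have "x \<in> ?U" "?U \<subseteq> ?K" using c(2) e(1) by auto
  ultimately show "\<exists>U K. openin (mtop M) U \<and> compactin (mtop M) K \<and> x \<in> U \<and> U \<subseteq> K" by blast
qed

lemma compact_neighbourhood:
  assumes "openin (mtop M) W" "x \<in> W"
  obtains G K where "openin (mtop M) G" "compactin (mtop M) K" "x \<in> G" "G \<subseteq> K" "K \<subseteq> W"
proof -
  have "neighbourhood_base_of (compactin (mtop M)) (mtop M)"
    using locally_compact Hausdorff locally_compact_space_neighbourhood_base by blast
  from this[unfolded neighbourhood_base_of, rule_format, OF conjI[OF assms]] obtain G K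
    where GK: "openin (mtop M) G \<and> compactin (mtop M) K \<and> x \<in> G \<and> G \<subseteq> K \<and> K \<subseteq> W"
    by (elim exE)
  show thesis by (rule that[of G K]) (simp_all add: GK)
qed

end

section \<open>The Levi map in frames\<close>

text \<open>The rank of \<open>D\<close> is a parameter: an abbreviation for \<open>DIM('e) - 1\<close> would carry a hidden type argument.\<close>

locale sub_riemannian =
  fixes M :: "('m, 'e::euclidean_space) manifold" and D :: "('m, 'e) distr" and g :: "('m, 'e) metric"
    and rk :: nat
  assumes sub_riemannian: "corank_one_sub_riemannian M D g" and rk: "rk = DIM('e) - 1"
begin

sublocale smooth_mfd M
  using sub_riemannian by unfold_locales (simp add: corank_one_sub_riemannian_def)

lemma Suc_rk: "Suc rk = DIM('e)"
  using DIM_positive[where 'a='e] by (simp add: rk)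

lemma rk_less: "rk < DIM('e)"
  using Suc_rk by simp

lemma distr_subspace: "x \<in> points M \<Longrightarrow> subspace (D x)"
  and distr_tangent: "x \<in> points M \<Longrightarrow> D x \<subseteq> tangent_space M x"
  using sub_riemannian
  by (auto simp: corank_one_sub_riemannian_def corank_one_structure_def corank_one_distribution_def)

lemma ex_local_frame: "x \<in> points M \<Longrightarrow> \<exists>U E. x \<in> U \<and> local_frame M D rk U E"
  using sub_riemannian
  unfolding corank_one_sub_riemannian_def corank_one_structure_def corank_one_distribution_def rk by blast

lemma levi_nonzero: "x \<in> points M \<Longrightarrow> \<exists>v\<in>D x. \<exists>w\<in>D x. levi M D x v w \<noteq> coset (D x) 0"
  using sub_riemannian
  unfolding corank_one_sub_riemannian_def corank_one_structure_def by blast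

lemma metric: "riemannian_metric_on M D g"
  using sub_riemannian by (simp add: corank_one_sub_riemannian_def)

lemma metric_linear: "x \<in> points M \<Longrightarrow> v \<in> D x \<Longrightarrow> linear_on_subspace (D x) (g x v)"
  and metric_sym: "x \<in> points M \<Longrightarrow> v \<in> D x \<Longrightarrow> w \<in> D x \<Longrightarrow> g x v w = g x w v"
  and metric_pos: "x \<in> points M \<Longrightarrow> v \<in> D x \<Longrightarrow> v \<noteq> 0 \<Longrightarrow> 0 < g x v v"
  using metric unfolding riemannian_metric_on_def by simp_all

lemma metric_smooth:
  "openin (mtop M) U \<Longrightarrow> smooth_section M D U V \<Longrightarrow> smooth_section M D U W \<Longrightarrow>
    smooth_fun_on M U (\<lambda>x. g x (V x) (W x))"
  using metric[unfolded riemannian_metric_on_def, THEN conjunct2, rule_format, of U V W] by simp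

lemma local_frameD:
  assumes "local_frame M D rk U E"
  shows "openin (mtop M) U" "i < rk \<Longrightarrow> smooth_section M D U (E i)"
    "i < rk \<Longrightarrow> smooth_vector_field M U (E i)"
    "x \<in> U \<Longrightarrow> basis_of (D x) rk (\<lambda>i. E i x)" "x \<in> U \<Longrightarrow> x \<in> points M"
    "x \<in> U \<Longrightarrow> i < rk \<Longrightarrow> E i x \<in> tangent_space M x"
    "x \<in> U \<Longrightarrow> i < rk \<Longrightarrow> E i x \<in> D x"
  using assms openin_subset[of "mtop M" U]
  by (auto simp: local_frame_def smooth_section_def smooth_vector_field_def)

text \<open>This makes the Levi map independent of the extensions. The coefficients of \<open>V\<close> in a frame need not be
  known to be differentiable: their difference quotients along a curve converge because \<open>V\<close> is
  differentiable and the frame is continuous.\<close>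

lemma vanishing_section_derivative:
  assumes U: "openin (mtop M) U" "x \<in> U" and V: "smooth_section M D U V" "V x = 0"
    and u: "u \<in> tangent_space M x"
  shows "(\<lambda>c. if c \<in> charts_at M x
    then frechet_derivative (\<lambda>p. V (chart_inv c p) c) (at (snd c x)) (u c) else 0) \<in> D x"
    (is "?v \<in> _")
proof -
  have x: "x \<in> points M" using U openin_subset by blast
  have Vf: "smooth_vector_field M U V" using V by (simp add: smooth_section_def)
  obtain U0 E where E: "x \<in> U0" "local_frame M D rk U0 E" using ex_local_frame[OF x] by blast
  note E' = local_frameD[OF E(2)]
  obtain c where c: "c \<in> charts_at M x" using ex_chart[OF x] by blast
  then have ca: "c \<in> atlas M" by simp
  \<comment> \<open>A straight line in the chart \<open>c\<close> through \<open>x\<close> with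
    velocity \<open>u c\<close>; \<open>f t\<close> holds the frame coefficients of \<open>V\<close>
    along it.\<close>
  define y where "y t = chart_inv c (snd c x + t *\<^sub>R u c)" for t :: real
  define f where "f t = coords rk (\<lambda>i. E i (y t)) (V (y t))" for t
  have y0: "y 0 = x" using c by (simp add: y_def chart_inv_left)
  have near: "\<forall>\<^sub>F t in at 0. y t \<in> A" if A: "openin (mtop M) A" "x \<in> A" for A
  proof -
    have "((\<lambda>t. snd c x + t *\<^sub>R u c) \<longlongrightarrow> snd c x + 0 *\<^sub>R u c) (at 0)"
      by (intro tendsto_intros)
    moreover have "open (snd c ` (A \<inter> fst c))" "snd c x + 0 *\<^sub>R u c \<in> snd c ` (A \<inter> fst c)"
      using chart_image_open[OF A(1) ca] A c by auto
    ultimately have "\<forall>\<^sub>F t in at 0. snd c x + t *\<^sub>R u c \<in> snd c ` (A \<inter> fst c)"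
      by (rule topological_tendstoD)
    then show ?thesis by eventually_elim (use ca in \<open>auto simp: y_def chart_inv_left\<close>)
  qed
  \<comment> \<open>The line is straight only in \<open>c\<close>, but in every other chart
    \<open>c'\<close> around \<open>x\<close> its velocity at 0 is \<open>u c'\<close>, by the
    transformation law of tangent vectors.\<close>
  have curve: "((\<lambda>t. X (y t) c') has_derivative
      (\<lambda>h. frechet_derivative (\<lambda>p. X (chart_inv c' p) c') (at (snd c' x)) (h *\<^sub>R u c'))) (at 0)"
    if X: "smooth_vector_field M A X" "openin (mtop M) A" "x \<in> A" and c': "c' \<in> charts_at M x" for X A c'
  proof -
    let ?\<phi> = "snd c' \<circ> chart_inv c"
    have c'a: "c' \<in> atlas M" using c' by simp
    have eq: "?\<phi> (snd c x) = snd c' x" using c by (simp add: chart_inv_left)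
    have 0: "((\<lambda>t. snd c x + t *\<^sub>R u c) has_derivative (\<lambda>h. h *\<^sub>R u c)) (at 0)"
      by (auto intro!: derivative_eq_intros)
    have 1: "(?\<phi> has_derivative frechet_derivative ?\<phi> (at (snd c x))) (at (snd c x + 0 *\<^sub>R u c))"
      using transition_has_derivative[OF c c'] by simp
    have 2: "((\<lambda>t. ?\<phi> (snd c x + t *\<^sub>R u c)) has_derivative (\<lambda>h. h *\<^sub>R u c')) (at 0)"
      using has_derivative_compose[OF 0 1]
      by (simp add: linear_cmul[OF has_derivative_linear[OF 1]] tangentD[OF u c c', symmetric] del: o_apply)
    have 3: "((\<lambda>p. X (chart_inv c' p) c') has_derivative
        frechet_derivative (\<lambda>p. X (chart_inv c' p) c') (at (snd c' x))) (at (?\<phi> (snd c x + 0 *\<^sub>R u c)))"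
      using vector_field_has_derivative[OF X(1,3) c'] eq by simp
    have 4: "((\<lambda>t. X (chart_inv c' (?\<phi> (snd c x + t *\<^sub>R u c))) c') has_derivative
      (\<lambda>h. frechet_derivative (\<lambda>p. X (chart_inv c' p) c') (at (snd c' x)) (h *\<^sub>R u c'))) (at 0)"
      using has_derivative_compose[OF 2 3] .
    have ev: "\<forall>\<^sub>F t in at 0. X (chart_inv c' (?\<phi> (snd c x + t *\<^sub>R u c))) c' = X (y t) c'"
      using near[OF chart_openin[OF c'a]] c' by (auto elim!: eventually_mono simp: y_def chart_inv_left)
    show ?thesis
      by (rule has_derivative_transform_eventually[OF 4 ev])
        (use c c' in \<open>simp_all add: y_def chart_inv_left\<close>)
  qed
  have E_lim: "((\<lambda>t. E i (y t) c') \<longlongrightarrow> E i x c') (at 0)" if "i < rk" "c' \<in> charts_at M x" for i c'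
    using has_derivative_continuous[OF curve[OF E'(3)[OF that(1)] E'(1) E(1) that(2)]] y0
    by (simp add: isCont_def)
  have V_lim: "((\<lambda>t. V (y t) c' /\<^sub>R t) \<longlongrightarrow> ?v c') (at 0)" if c': "c' \<in> charts_at M x" for c'
  proof (rule has_vector_derivative_quotient_tendsto)
    show "((\<lambda>t. V (y t) c') has_vector_derivative ?v c') (at 0)"
      using curve[OF Vf U c'] c' unfolding has_vector_derivative_def
      by (simp add: linear_cmul[OF has_derivative_linear[OF vector_field_has_derivative[OF Vf U(2) c']]])
  qed (simp add: y0 V)
  have "\<forall>\<^sub>F t in at 0. y t \<in> U \<inter> U0"
    using near[OF openin_Int[OF U(1) E'(1)]] U E(1) by blast
  then have V_sum: "\<forall>\<^sub>F t in at 0. V (y t) c' /\<^sub>R t = (\<Sum>i<rk. (f t i / t) *\<^sub>R E i (y t) c')" for c'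
  proof (rule eventually_mono)
    fix t assume t: "y t \<in> U \<inter> U0"
    then have "V (y t) = (\<Sum>i<rk. f t i *\<^sub>R E i (y t))"
      unfolding f_def using V(1) coords_sum[OF E'(4), of "y t" "V (y t)"] by (simp add: smooth_section_def)
    from fun_cong[OF this, of c'] show "V (y t) c' /\<^sub>R t = (\<Sum>i<rk. (f t i / t) *\<^sub>R E i (y t) c')"
      by (simp add: sum_fun_apply scaleR_fun_apply scaleR_sum_right divide_inverse mult.commute)
  qed
  have "lin_indep rk (\<lambda>i. E i x c)"
    using lin_indep_chart[of c x rk "\<lambda>i. E i x", OF c E'(6)[OF E(1)]] E'(4)[OF E(1)] by (simp add: basis_of_iff)
  \<comment> \<open>\<open>?v c\<close> is not yet known to lie in the span of the frame, so the
    frame is completed to a basis of \<open>'e\<close> in order to have coefficients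
    \<open>d\<close> at all; the difference quotients have coefficient 0 at
    \<open>e\<close>.\<close>
  then obtain e where e: "lin_indep (Suc rk) (\<lambda>i. if i < rk then E i x c else e)"
    using extend_lin_indep rk_less by blast
  let ?b = "\<lambda>i. if i < rk then E i x c else e"
  define d where "d = coords (Suc rk) ?b (?v c)"
  have d: "?v c = (\<Sum>i<Suc rk. d i *\<^sub>R ?b i)"
    unfolding d_def
    using coords_sum[OF lin_indep_spans_UNIV[of ?b], of "?v c"] e unfolding Suc_rk by simp
  have lim: "((\<lambda>t. if i < rk then f t i / t else 0) \<longlongrightarrow> d i) (at 0)" if "i < Suc rk" for i
  proof (rule coeff_tendsto[OF e, of "\<lambda>i t. if i < rk then E i (y t) c else e"])
    show "((\<lambda>t. if i < rk then E i (y t) c else e) \<longlongrightarrow> ?b i) (at 0)" if "i < Suc rk" for i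
      using E_lim[OF _ c] by auto
    have "\<forall>\<^sub>F t in at 0. V (y t) c /\<^sub>R t =
        (\<Sum>i<Suc rk. (if i < rk then f t i / t else 0) *\<^sub>R (if i < rk then E i (y t) c else e))"
      using V_sum[of c] by eventually_elim simp
    from tendsto_cong[OF this] V_lim[OF c]
    show "((\<lambda>t. \<Sum>i<Suc rk. (if i < rk then f t i / t else 0) *\<^sub>R (if i < rk then E i (y t) c else e))
        \<longlongrightarrow> (\<Sum>i<Suc rk. d i *\<^sub>R ?b i)) (at 0)"
      unfolding d by simp
  qed (rule that)
  \<comment> \<open>The coefficients converge by an argument in the single chart \<open>c\<close>;
    the same limits \<open>d i\<close> then serve in every chart, which yields an equality of
    tangent vectors.\<close>
  have "?v = (\<Sum>i<rk. d i *\<^sub>R E i x)"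
  proof
    fix c'
    show "?v c' = (\<Sum>i<rk. d i *\<^sub>R E i x) c'"
    proof (cases "c' \<in> charts_at M x")
      case True
      have "((\<lambda>t. \<Sum>i<rk. (f t i / t) *\<^sub>R E i (y t) c') \<longlongrightarrow> (\<Sum>i<rk. d i *\<^sub>R E i x c')) (at 0)"
      proof (intro tendsto_sum tendsto_scaleR)
        fix i assume "i \<in> {..<rk}"
        then show "((\<lambda>t. f t i / t) \<longlongrightarrow> d i) (at 0)" "((\<lambda>t. E i (y t) c') \<longlongrightarrow> E i x c') (at 0)"
          using lim[of i] E_lim[OF _ True] by simp_all
      qed
      moreover have "((\<lambda>t. \<Sum>i<rk. (f t i / t) *\<^sub>R E i (y t) c') \<longlongrightarrow> ?v c') (at 0)"
        using tendsto_cong[OF V_sum[of c']] V_lim[OF True] by simp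
      ultimately have "?v c' = (\<Sum>i<rk. d i *\<^sub>R E i x c')"
        by (intro tendsto_unique[of "at (0::real)"]) auto
      then show ?thesis by (simp add: sum_fun_apply scaleR_fun_apply)
    next
      case False
      then show ?thesis
        using tangent_outside[OF E'(6)[OF E(1)]] by (auto simp: sum_fun_apply scaleR_fun_apply)
    qed
  qed
  then show ?thesis using basis_of_comb[OF E'(4)[OF E(1)], of d] by simp
qed

lemma smooth_section_lincomb:
  assumes U: "openin (mtop M) U" and V: "\<And>i. i \<in> I \<Longrightarrow> smooth_section M D U (V i)"
  shows "smooth_section M D U (\<lambda>x. \<Sum>i\<in>I. a i *\<^sub>R V i x)"
  unfolding smooth_section_def
proof (intro conjI ballI)
  show "smooth_vector_field M U (\<lambda>x. \<Sum>i\<in>I. a i *\<^sub>R V i x)"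
    using V by (intro smooth_vector_field_lincomb U) (simp add: smooth_section_def)
  fix x assume "x \<in> U"
  moreover from this have "x \<in> points M" using U openin_subset by blast
  ultimately show "(\<Sum>i\<in>I. a i *\<^sub>R V i x) \<in> D x"
    using V by (intro subspace_sum subspace_scale distr_subspace) (auto simp: smooth_section_def)
qed

lemma smooth_section_subset:
  "smooth_section M D U V \<Longrightarrow> U' \<subseteq> U \<Longrightarrow> smooth_section M D U' V"
  unfolding smooth_section_def using smooth_vector_field_subset by blast

lemma smooth_section_diff:
  assumes "openin (mtop M) U" "smooth_section M D U V" "smooth_section M D U W"
  shows "smooth_section M D U (\<lambda>x. V x - W x)"
proof -
  \<comment> \<open>The difference as a linear combination indexed by the two booleans, with
    coefficients 1 and -1.\<close>
  have "smooth_section M D U (\<lambda>x. \<Sum>i\<in>UNIV. (if i then 1 else -1) *\<^sub>R (if i then V else W) x)"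
    using assms by (intro smooth_section_lincomb) auto
  then show ?thesis by (simp add: UNIV_bool)
qed

text \<open>As the values at \<open>x\<close> agree, the difference of the brackets is the
  derivative of \<open>W - W'\<close> along \<open>V\<close> minus the derivative of
  \<open>V - V'\<close> along \<open>W\<close>; both differentiate sections that vanish at
  \<open>x\<close>.\<close>

lemma lie_bracket_mod_distr:
  assumes U: "openin (mtop M) U" "x \<in> U"
    and V: "smooth_section M D U V" "smooth_section M D U V'" "V x = V' x"
    and W: "smooth_section M D U W" "smooth_section M D U W'" "W x = W' x"
  shows "lie_bracket M V W x - lie_bracket M V' W' x \<in> D x"
proof -
  have x: "x \<in> points M" using U openin_subset by blast
  let ?A = "\<lambda>V u c. if c \<in> charts_at M x
    then frechet_derivative (\<lambda>p. V (chart_inv c p) c) (at (snd c x)) (u c) else 0"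
  have t: "V x \<in> tangent_space M x" "W x \<in> tangent_space M x"
    using V W U by (auto simp: smooth_section_def smooth_vector_field_def)
  have "?A (\<lambda>x. W x - W' x) (V x) \<in> D x" "?A (\<lambda>x. V x - V' x) (W x) \<in> D x"
    using V W by (intro vanishing_section_derivative[OF U smooth_section_diff] U t; simp)+
  then have "?A (\<lambda>x. W x - W' x) (V x) - ?A (\<lambda>x. V x - V' x) (W x) \<in> D x"
    using subspace_diff[OF distr_subspace[OF x]] by blast
  moreover have "?A (\<lambda>x. W x - W' x) (V x) - ?A (\<lambda>x. V x - V' x) (W x) =
      lie_bracket M V W x - lie_bracket M V' W' x"
  proof
    fix c
    have diff: "frechet_derivative (\<lambda>p. X (chart_inv c p) c - Y (chart_inv c p) c) (at (snd c x)) u =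
        frechet_derivative (\<lambda>p. X (chart_inv c p) c) (at (snd c x)) u -
        frechet_derivative (\<lambda>p. Y (chart_inv c p) c) (at (snd c x)) u"
      if "c \<in> charts_at M x" "smooth_section M D U X" "smooth_section M D U Y" for X Y u
    proof -
      have "smooth_vector_field M U X" "smooth_vector_field M U Y"
        using that by (auto simp: smooth_section_def)
      from has_derivative_diff[OF vector_field_has_derivative[OF this(1) U(2) that(1)]
          vector_field_has_derivative[OF this(2) U(2) that(1)]]
      have "((\<lambda>p. X (chart_inv c p) c - Y (chart_inv c p) c) has_derivative
        (\<lambda>u. frechet_derivative (\<lambda>p. X (chart_inv c p) c) (at (snd c x)) u -
        frechet_derivative (\<lambda>p. Y (chart_inv c p) c) (at (snd c x)) u)) (at (snd c x))" .
      from frechet_derivative_at[OF this, THEN fun_cong, of u, symmetric] show ?thesis by simp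
    qed
    show "(?A (\<lambda>x. W x - W' x) (V x) - ?A (\<lambda>x. V x - V' x) (W x)) c =
      (lie_bracket M V W x - lie_bracket M V' W' x) c"
      by (cases "c \<in> charts_at M x") (use V W in \<open>auto simp: lie_bracket_def diff\<close>)
  qed
  ultimately show ?thesis by simp
qed

text \<open>Any pair of extensions computes the definite description: two choices are compared on
  the intersection of their domains.\<close>

lemma levi_eq:
  assumes U: "openin (mtop M) U" "x \<in> U" and V: "smooth_section M D U V" and W: "smooth_section M D U W"
  shows "levi M D x (V x) (W x) = coset (D x) (lie_bracket M V W x)"
  unfolding levi_def
proof (rule the_equality)
  show "\<exists>U' V' W'. openin (mtop M) U' \<and> x \<in> U' \<and> smooth_section M D U' V' \<and> smooth_section M D U' W' \<and>
      V' x = V x \<and> W' x = W x \<and> coset (D x) (lie_bracket M V W x) = coset (D x) (lie_bracket M V' W' x)"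
    using assms by blast
  fix q
  assume "\<exists>U' V' W'. openin (mtop M) U' \<and> x \<in> U' \<and> smooth_section M D U' V' \<and> smooth_section M D U' W' \<and>
      V' x = V x \<and> W' x = W x \<and> q = coset (D x) (lie_bracket M V' W' x)"
  then obtain U' V' W' where *: "openin (mtop M) U'" "x \<in> U'" "smooth_section M D U' V'"
    "smooth_section M D U' W'" "V' x = V x" "W' x = W x" and q: "q = coset (D x) (lie_bracket M V' W' x)"
    by blast
  have x: "x \<in> points M" using U openin_subset by blast
  have "lie_bracket M V' W' x - lie_bracket M V W x \<in> D x"
    using * assms by (intro lie_bracket_mod_distr[of "U \<inter> U'"] openin_Int)
      (auto intro: smooth_section_subset)
  then show "q = coset (D x) (lie_bracket M V W x)"
    by (simp add: q coset_eq_iff[OF distr_subspace[OF x]])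
qed

section \<open>Adapted frames and the matrices of the Levi map and the metric\<close>

definition full_frame :: "(nat \<Rightarrow> 'm \<Rightarrow> ('m, 'e) tvec) \<Rightarrow> ('m \<Rightarrow> ('m, 'e) tvec) \<Rightarrow> 'm \<Rightarrow> nat \<Rightarrow> ('m, 'e) tvec" where
  "full_frame E Z x i = (if i < rk then E i x else Z x)"

definition frame_coords ::
  "(nat \<Rightarrow> 'm \<Rightarrow> ('m, 'e) tvec) \<Rightarrow> ('m \<Rightarrow> ('m, 'e) tvec) \<Rightarrow> 'm \<Rightarrow> ('m, 'e) tvec \<Rightarrow> nat \<Rightarrow> real" where
  "frame_coords E Z x = coords DIM('e) (full_frame E Z x)"

text \<open>The matrix of the Levi map once \<open>TM/D\<close> is trivialised by the class of
  \<open>Z\<close>; index \<open>rk\<close> is the position of \<open>Z\<close> in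
  \<open>full_frame\<close>.\<close>

definition levi_coeff ::
  "(nat \<Rightarrow> 'm \<Rightarrow> ('m, 'e) tvec) \<Rightarrow> ('m \<Rightarrow> ('m, 'e) tvec) \<Rightarrow> nat \<Rightarrow> nat \<Rightarrow> 'm \<Rightarrow> real" where
  "levi_coeff E Z i j x = frame_coords E Z x (lie_bracket M (E i) (E j) x) rk"

lemma adapted_frameD:
  assumes "adapted_frame M D U E Z"
  shows "local_frame M D rk U E" "smooth_vector_field M U Z" "x \<in> U \<Longrightarrow> Z x \<notin> D x"
    "x \<in> U \<Longrightarrow> Z x \<in> tangent_space M x"
  using assms by (auto simp: adapted_frame_def rk smooth_vector_field_def)

lemma sum_full_frame: "(\<Sum>i<DIM('e). a i *\<^sub>R full_frame E Z x i) = (\<Sum>i<rk. a i *\<^sub>R E i x) + a rk *\<^sub>R Z x"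
  by (simp add: full_frame_def flip: Suc_rk)

lemma full_frame_tangent:
  assumes "adapted_frame M D U E Z" "x \<in> U"
  shows "full_frame E Z x i \<in> tangent_space M x"
  using local_frameD(6)[OF adapted_frameD(1)[OF assms(1)] assms(2)] adapted_frameD(4)[OF assms]
  by (simp add: full_frame_def)

lemma full_frame_basis:
  assumes A: "adapted_frame M D U E Z" and x: "x \<in> U"
  shows "basis_of (tangent_space M x) DIM('e) (full_frame E Z x)"
proof (rule tangent_basis)
  note E = local_frameD[OF adapted_frameD(1)[OF A]]
  show "x \<in> points M" using E x by blast
  have "lin_indep rk (\<lambda>i. E i x)" "span ((\<lambda>i. E i x) ` {..<rk}) = D x"
    using E(4)[OF x] by (auto simp: basis_of_def lin_indep_iff)
  then show "lin_indep DIM('e) (full_frame E Z x)"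
    using lin_indep_snoc[of rk "\<lambda>i. E i x" "Z x"] adapted_frameD(3)[OF A x] Suc_rk
    by (simp add: full_frame_def[abs_def])
qed (rule full_frame_tangent[OF assms])

lemma frame_coords_sum:
  assumes "adapted_frame M D U E Z" "x \<in> U" "v \<in> tangent_space M x"
  shows "v = (\<Sum>i<rk. frame_coords E Z x v i *\<^sub>R E i x) + frame_coords E Z x v rk *\<^sub>R Z x"
  using coords_sum[OF full_frame_basis[OF assms(1,2)] assms(3)]
  by (simp add: frame_coords_def sum_full_frame)

lemma frame_coords_eq:
  assumes "adapted_frame M D U E Z" "x \<in> U" "i \<le> rk"
    and "v = (\<Sum>i<rk. a i *\<^sub>R E i x) + a rk *\<^sub>R Z x"
  shows "frame_coords E Z x v i = a i"
  unfolding frame_coords_def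
proof (rule coords_eq[OF full_frame_basis[OF assms(1,2)]])
  show "v = (\<Sum>i<DIM('e). a i *\<^sub>R full_frame E Z x i)" by (simp only: assms(4) sum_full_frame)
  show "i < DIM('e)" using assms(3) rk_less by simp
qed

lemma frame_coords_distr:
  assumes A: "adapted_frame M D U E Z" "x \<in> U" and v: "v \<in> D x"
  shows "v = (\<Sum>i<rk. frame_coords E Z x v i *\<^sub>R E i x)" "frame_coords E Z x v rk = 0"
proof -
  have "v = (\<Sum>i<rk. coords rk (\<lambda>i. E i x) v i *\<^sub>R E i x)"
    using coords_sum[OF local_frameD(4)[OF adapted_frameD(1)[OF A(1)] A(2)] v] by simp
  then have "v = (\<Sum>i<rk. (\<lambda>i. if i < rk then coords rk (\<lambda>i. E i x) v i else 0) i *\<^sub>R E i x) +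
      (\<lambda>i. if i < rk then coords rk (\<lambda>i. E i x) v i else 0) rk *\<^sub>R Z x"
    by simp
  from frame_coords_eq[OF A le_refl this] show 0: "frame_coords E Z x v rk = 0" by simp
  have "v \<in> tangent_space M x"
    using distr_tangent[of x] v local_frameD(5)[OF adapted_frameD(1)[OF A(1)] A(2)] by blast
  from frame_coords_sum[OF A this] 0 show "v = (\<Sum>i<rk. frame_coords E Z x v i *\<^sub>R E i x)" by simp
qed

lemma coset_scale_frame_inj:
  assumes A: "adapted_frame M D U E Z" "x \<in> U"
  shows "coset (D x) (s *\<^sub>R Z x) = coset (D x) (t *\<^sub>R Z x) \<longleftrightarrow> s = t"
proof
  have x: "x \<in> points M" using local_frameD(5)[OF adapted_frameD(1)[OF A(1)] A(2)] .
  assume "coset (D x) (s *\<^sub>R Z x) = coset (D x) (t *\<^sub>R Z x)"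
  then have *: "(s - t) *\<^sub>R Z x \<in> D x"
    by (simp add: coset_eq_iff[OF distr_subspace[OF x]] scaleR_left_diff_distrib)
  show "s = t"
  proof (rule ccontr)
    assume "s \<noteq> t"
    then show False
      using subspace_scale[OF distr_subspace[OF x] *, of "1 / (s - t)"] adapted_frameD(3)[OF A] by simp
  qed
qed simp

lemma coset_frame:
  assumes A: "adapted_frame M D U E Z" "x \<in> U" and v: "v \<in> tangent_space M x"
  shows "coset (D x) v = coset (D x) (frame_coords E Z x v rk *\<^sub>R Z x)"
proof -
  note E = local_frameD[OF adapted_frameD(1)[OF A(1)]]
  have "v - frame_coords E Z x v rk *\<^sub>R Z x = (\<Sum>i<rk. frame_coords E Z x v i *\<^sub>R E i x)"
    by (subst (1) frame_coords_sum[OF A v]) simp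
  also have "\<dots> \<in> D x" by (rule basis_of_comb[OF E(4)[OF A(2)]])
  finally show ?thesis using coset_eq_iff[OF distr_subspace[OF E(5)[OF A(2)]]] by blast
qed

text \<open>The two vectors are extended by combinations of the frame with constant coefficients,
  which is legitimate by \<open>levi_eq\<close>; the bracket is bilinear on these, and modulo
  \<open>D\<close> only the \<open>Z\<close>-component of each frame bracket survives.\<close>

lemma levi_frame:
  assumes A: "adapted_frame M D U E Z" and x: "x \<in> U"
  shows "levi M D x (\<Sum>i<rk. a i *\<^sub>R E i x) (\<Sum>j<rk. b j *\<^sub>R E j x) =
    coset (D x) ((\<Sum>i<rk. \<Sum>j<rk. a i * b j * levi_coeff E Z i j x) *\<^sub>R Z x)"
proof -
  note E = local_frameD[OF adapted_frameD(1)[OF A]]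
  let ?L = "\<lambda>i j. lie_bracket M (E i) (E j) x"
  have px: "x \<in> points M" using E(5)[OF x] .
  have L: "?L i j - levi_coeff E Z i j x *\<^sub>R Z x \<in> D x" if "i < rk" "j < rk" for i j
    using coset_frame[OF A x lie_bracket_in_tangent[OF E(1) x E(3) E(3)]] that
    by (simp add: coset_eq_iff[OF distr_subspace[OF px]] levi_coeff_def)
  have "levi M D x (\<Sum>i<rk. a i *\<^sub>R E i x) (\<Sum>j<rk. b j *\<^sub>R E j x) =
      coset (D x) (lie_bracket M (\<lambda>x. \<Sum>i<rk. a i *\<^sub>R E i x) (\<lambda>x. \<Sum>j<rk. b j *\<^sub>R E j x) x)"
    using E by (intro levi_eq[of U x "\<lambda>x. \<Sum>i<rk. a i *\<^sub>R E i x" "\<lambda>x. \<Sum>j<rk. b j *\<^sub>R E j x"]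
        smooth_section_lincomb x) auto
  also have "lie_bracket M (\<lambda>x. \<Sum>i<rk. a i *\<^sub>R E i x) (\<lambda>x. \<Sum>j<rk. b j *\<^sub>R E j x) x =
      (\<Sum>i<rk. \<Sum>j<rk. (a i * b j) *\<^sub>R ?L i j)"
    using E by (intro lie_bracket_lincomb[OF x]) auto
  also have "coset (D x) \<dots> = coset (D x) ((\<Sum>i<rk. \<Sum>j<rk. a i * b j * levi_coeff E Z i j x) *\<^sub>R Z x)"
  proof -
    have "(\<Sum>i<rk. \<Sum>j<rk. (a i * b j) *\<^sub>R ?L i j) - (\<Sum>i<rk. \<Sum>j<rk. a i * b j * levi_coeff E Z i j x) *\<^sub>R Z x
      = (\<Sum>i<rk. \<Sum>j<rk. (a i * b j) *\<^sub>R (?L i j - levi_coeff E Z i j x *\<^sub>R Z x))"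
      by (simp add: scaleR_diff_right sum_subtractf scaleR_left.sum)
    also have "\<dots> \<in> D x"
      using L by (intro subspace_sum subspace_scale distr_subspace px) auto
    finally show ?thesis using coset_eq_iff[OF distr_subspace[OF px]] by blast
  qed
  finally show ?thesis .
qed

lemma metric_frame:
  assumes E: "local_frame M D rk U E" and x: "x \<in> U"
  shows "g x (\<Sum>i<rk. a i *\<^sub>R E i x) (\<Sum>j<rk. b j *\<^sub>R E j x) =
    (\<Sum>i<rk. \<Sum>j<rk. a i * b j * g x (E i x) (E j x))"
proof -
  note E' = local_frameD[OF E]
  have px: "x \<in> points M" using E'(5)[OF x] .
  have mem: "E i x \<in> D x" if "i < rk" for i using E'(7) x that by blast
  have sum: "(\<Sum>i<rk. b i *\<^sub>R E i x) \<in> D x" for b by (rule basis_of_comb[OF E'(4)[OF x]])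
  have right: "g x v (\<Sum>j<rk. b j *\<^sub>R E j x) = (\<Sum>j<rk. b j * g x v (E j x))" if "v \<in> D x" for v b
    using linear_on_subspace_sum[OF metric_linear[OF px that] distr_subspace[OF px], of "{..<rk}" "\<lambda>i. E i x" b] mem
    by simp
  have "g x (\<Sum>i<rk. a i *\<^sub>R E i x) (\<Sum>j<rk. b j *\<^sub>R E j x) =
      (\<Sum>i<rk. a i * g x (\<Sum>j<rk. b j *\<^sub>R E j x) (E i x))"
    using metric_sym[OF px sum sum] right[OF sum] by simp
  also have "\<dots> = (\<Sum>i<rk. a i * (\<Sum>j<rk. b j * g x (E i x) (E j x)))"
    using metric_sym[OF px sum mem] right[OF mem] by (intro sum.cong) auto
  finally show ?thesis by (simp add: sum_distrib_left mult.assoc)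
qed

lemma levi_coeff_nonzero:
  assumes A: "adapted_frame M D U E Z" and x: "x \<in> U"
  obtains i j where "i < rk" "j < rk" "levi_coeff E Z i j x \<noteq> 0"
proof -
  note E = local_frameD[OF adapted_frameD(1)[OF A]]
  obtain v w where vw: "v \<in> D x" "w \<in> D x" "levi M D x v w \<noteq> coset (D x) 0"
    using levi_nonzero[OF E(5)[OF x]] by blast
  let ?v = "frame_coords E Z x v" and ?w = "frame_coords E Z x w"
  have "levi M D x v w = coset (D x) ((\<Sum>i<rk. \<Sum>j<rk. ?v i * ?w j * levi_coeff E Z i j x) *\<^sub>R Z x)"
    using levi_frame[OF A x, of ?v ?w]
    by (simp only: frame_coords_distr(1)[OF A x vw(1), symmetric] frame_coords_distr(1)[OF A x vw(2), symmetric])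
  then have "(\<Sum>i<rk. \<Sum>j<rk. ?v i * ?w j * levi_coeff E Z i j x) \<noteq> 0" using vw(3) by fastforce
  then have "\<exists>i<rk. \<exists>j<rk. levi_coeff E Z i j x \<noteq> 0"
    by (rule contrapos_np) (auto intro!: sum.neutral)
  then show thesis using that by blast
qed

text \<open>Stated for \<open>V\<close> with continuous coordinates, so that it applies to brackets
  of frame fields as well; the continuity comes from the moving-basis estimate in the chart
  \<open>c\<close>.\<close>

lemma frame_coords_continuous:
  assumes A: "adapted_frame M D U E Z" and c: "c \<in> atlas M" and B: "B \<subseteq> U" "B \<subseteq> fst c"
    and V: "\<And>x. x \<in> B \<Longrightarrow> V x \<in> tangent_space M x"
      "continuous_map (subtopology (mtop M) B) euclidean (\<lambda>x. V x c)"
    and i: "i \<le> rk"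
  shows "continuous_map (subtopology (mtop M) B) euclideanreal (\<lambda>x. frame_coords E Z x (V x) i)"
proof -
  note E = local_frameD[OF adapted_frameD(1)[OF A]]
  have B': "topspace (subtopology (mtop M) B) = B" using B E(5) by auto
  have ff: "smooth_vector_field M B (\<lambda>x. full_frame E Z x i)" for i
    using smooth_vector_field_subset[OF _ B(1)] E(3) adapted_frameD(2)[OF A]
    by (cases "i < rk") (simp_all add: full_frame_def)
  show ?thesis
  proof (rule continuous_map_coeff[of _ "DIM('e)" "\<lambda>i x. full_frame E Z x i c" "\<lambda>i x. frame_coords E Z x (V x) i"])
    show "lin_indep DIM('e) (\<lambda>i. full_frame E Z x i c)" if "x \<in> topspace (subtopology (mtop M) B)" for x
    proof -
      have x: "x \<in> U" "c \<in> charts_at M x" using that B' B c by auto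
      show ?thesis
        using lin_indep_chart[of c x "DIM('e)" "full_frame E Z x", OF x(2) full_frame_tangent[OF A x(1)]]
          full_frame_basis[OF A x(1)] by (simp add: basis_of_iff)
    qed
    show "continuous_map (subtopology (mtop M) B) euclidean (\<lambda>x. full_frame E Z x i c)" for i
      by (rule vector_field_continuous[OF c B(2) ff])
    show "continuous_map (subtopology (mtop M) B) euclidean
      (\<lambda>x. \<Sum>i<DIM('e). frame_coords E Z x (V x) i *\<^sub>R full_frame E Z x i c)"
    proof (rule continuous_map_eq[OF V(2)])
      fix x assume "x \<in> topspace (subtopology (mtop M) B)"
      then have x: "x \<in> B" "x \<in> U" using B' B by auto
      show "V x c = (\<Sum>i<DIM('e). frame_coords E Z x (V x) i *\<^sub>R full_frame E Z x i c)"
        using fun_cong[OF coords_sum[OF full_frame_basis[OF A x(2)] V(1)[OF x(1)]], of c]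
        by (simp add: frame_coords_def sum_fun_apply scaleR_fun_apply)
    qed
  qed (use i rk_less in auto)
qed

lemma levi_coeff_continuous:
  assumes A: "adapted_frame M D U E Z" and c: "c \<in> atlas M" "U \<subseteq> fst c" and ij: "i < rk" "j < rk"
  shows "continuous_map (subtopology (mtop M) U) euclideanreal (levi_coeff E Z i j)"
proof -
  note E = local_frameD[OF adapted_frameD(1)[OF A]]
  have "continuous_map (subtopology (mtop M) U) euclideanreal
      (\<lambda>x. frame_coords E Z x (lie_bracket M (E i) (E j) x) rk)"
  proof (rule frame_coords_continuous[OF A c(1) subset_refl c(2)])
    show "lie_bracket M (E i) (E j) x \<in> tangent_space M x" if "x \<in> U" for x
      using lie_bracket_in_tangent[OF E(1) that E(3) E(3)] ij by blast
    show "continuous_map (subtopology (mtop M) U) euclidean (\<lambda>x. lie_bracket M (E i) (E j) x c)"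
      using lie_bracket_continuous[OF E(1) c(1) E(3) E(3)] ij c(2)
      by (intro continuous_map_via_chart[OF c]) (simp add: Int_absorb2)
  qed simp
  then show ?thesis by (simp add: levi_coeff_def[abs_def])
qed

lemma metric_continuous:
  assumes E: "local_frame M D rk U E" and c: "c \<in> atlas M" "U \<subseteq> fst c" and ij: "i < rk" "j < rk"
  shows "continuous_map (subtopology (mtop M) U) euclideanreal (\<lambda>x. g x (E i x) (E j x))"
proof (rule continuous_map_via_chart[OF c])
  note E' = local_frameD[OF E]
  have "smooth_fun_on M U (\<lambda>x. g x (E i x) (E j x))"
    using metric_smooth[OF E'(1) E'(2) E'(2)] ij by blast
  then have "smooth_on (snd c ` (U \<inter> fst c)) ((\<lambda>x. g x (E i x) (E j x)) \<circ> chart_inv c)"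
    using c by (simp add: smooth_fun_on_def)
  then show "continuous_on (snd c ` U) (\<lambda>p. g (chart_inv c p) (E i (chart_inv c p)) (E j (chart_inv c p)))"
    using c by (auto dest!: smooth_on_continuous simp: Int_absorb2 o_def)
qed

text \<open>A vector \<open>e\<close> that completes the frame at \<open>x\<close> in one chart is
  extended with constant coordinates; openness of independence keeps the resulting field
  \<open>Z\<close> transverse near \<open>x\<close>. The domain stays inside one chart so that later
  continuity arguments can compare vectors in \<open>'e\<close>.\<close>

lemma ex_adapted_frame:
  assumes x: "x \<in> points M"
  obtains U E Z c where "x \<in> U" "c \<in> atlas M" "U \<subseteq> fst c" "adapted_frame M D U E Z"
proof -
  obtain U0 E where E: "x \<in> U0" "local_frame M D rk U0 E" using ex_local_frame[OF x] by blast
  note E' = local_frameD[OF E(2)]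
  obtain c where c: "c \<in> charts_at M x" using ex_chart[OF x] by blast
  then have ca: "c \<in> atlas M" by simp
  define U1 where "U1 = U0 \<inter> fst c"
  have U1: "openin (mtop M) U1" "x \<in> U1" "U1 \<subseteq> fst c" "U1 \<subseteq> U0"
    using E'(1) chart_openin[OF ca] E(1) c by (auto simp: U1_def)
  have top: "topspace (subtopology (mtop M) U1) = U1" using U1(1) openin_subset by fastforce
  have "lin_indep rk (\<lambda>i. E i x c)"
    using lin_indep_chart[of c x rk "\<lambda>i. E i x", OF c E'(6)[OF E(1)]] E'(4)[OF E(1)] by (simp add: basis_of_iff)
  then obtain e where e: "lin_indep (Suc rk) (\<lambda>i. if i < rk then E i x c else e)"
    using extend_lin_indep rk_less by blast
  define Z where "Z y = tvec_of M c y e" for y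
  have Zc: "Z y c = e" if "y \<in> U1" for y
    using that U1(3) ca tvec_of_eval[of c y e] by (auto simp: Z_def)
  have Z: "smooth_vector_field M U1 Z"
    using smooth_vector_field_tvec_of[OF ca U1(1,3)] by (simp add: Z_def[abs_def])
  have ff: "smooth_vector_field M U1 (\<lambda>y. full_frame E Z y i)" for i
    using smooth_vector_field_subset[OF E'(3) U1(4)] Z by (cases "i < rk") (simp_all add: full_frame_def)
  have "lin_indep DIM('e) (\<lambda>i. full_frame E Z x i c)"
  proof -
    have "(\<lambda>i. full_frame E Z x i c) = (\<lambda>i. if i < rk then E i x c else e)"
      using Zc[OF U1(2)] by (auto simp: full_frame_def)
    then show ?thesis using e unfolding Suc_rk by simp
  qed
  then obtain U where U: "openin (subtopology (mtop M) U1) U" "x \<in> U"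
    "\<And>y. y \<in> U \<Longrightarrow> lin_indep DIM('e) (\<lambda>i. full_frame E Z y i c)"
    using openin_lin_indep[of "DIM('e)" "subtopology (mtop M) U1" "\<lambda>i y. full_frame E Z y i c" x]
      vector_field_continuous[OF ca U1(3) ff] U1(2) top by metis
  have U': "openin (mtop M) U" "U \<subseteq> U1" using U(1) U1(1) by (auto simp: openin_open_subtopology)
  have "Z y \<notin> D y" if y: "y \<in> U" for y
  proof
    assume "Z y \<in> D y"
    moreover have y1: "y \<in> U1" "y \<in> U0" using y U'(2) U1(4) by auto
    ultimately have "Z y = (\<Sum>i<rk. coords rk (\<lambda>i. E i y) (Z y) i *\<^sub>R E i y)"
      using coords_sum[OF E'(4)] by simp
    \<comment> \<open>If \<open>Z y\<close> lay in \<open>D y\<close>, its expansion would be a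
      relation with coefficient -1 at position \<open>rk\<close>.\<close>
    then have *: "(\<Sum>i<Suc rk. (if i < rk then coords rk (\<lambda>i. E i y) (Z y) i else -1) *\<^sub>R full_frame E Z y i) = 0"
      by (simp add: full_frame_def)
    have yc: "c \<in> charts_at M y" using y1 U1(3) ca by auto
    have "lin_indep DIM('e) (full_frame E Z y)"
      using lin_indep_chart[of c y "DIM('e)" "full_frame E Z y", OF yc] U(3)[OF y] ff y1
      by (simp add: smooth_vector_field_def)
    from this[unfolded lin_indep_def Suc_rk[symmetric], rule_format, OF *, of rk] show False by simp
  qed
  moreover have "local_frame M D rk U E"
    using E(2) U' U1(4) smooth_section_subset unfolding local_frame_def by blast
  ultimately have "adapted_frame M D U E Z"
    using smooth_vector_field_subset[OF Z U'(2)] by (simp add: adapted_frame_def rk)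
  then show thesis using that U(2) ca U' U1(3) by blast
qed

section \<open>Arrows in frames\<close>

text \<open>Inverse of the trivialisation given by the two frames. A class in \<open>TM/D\<close> is
  \<open>t\<close> times the class of \<open>Z\<close> for exactly one \<open>t\<close>, which the
  definite description extracts; the restrictions match the extensionality demanded by
  \<open>GL_gr\<close>.\<close>

definition arrow_of ::
  "(nat \<Rightarrow> 'm \<Rightarrow> ('m, 'e) tvec) \<Rightarrow> ('m \<Rightarrow> ('m, 'e) tvec) \<Rightarrow>
   (nat \<Rightarrow> 'm \<Rightarrow> ('m, 'e) tvec) \<Rightarrow> ('m \<Rightarrow> ('m, 'e) tvec) \<Rightarrow>
   'm \<times> 'm \<times> (nat \<times> nat \<Rightarrow> real) \<times> real \<Rightarrow> ('m, 'e) gr_arrow" where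
  "arrow_of E Z E' Z' = (\<lambda>(x, y, a, b).
    \<lparr>src = x, tgt = y,
     deg1 = (\<lambda>v\<in>D x. \<Sum>i<rk. (\<Sum>j<rk. frame_coords E Z x v j * a (i, j)) *\<^sub>R E' i y),
     deg2 = (\<lambda>P\<in>normal_space M D x. coset (D y) ((b * (THE t. P = coset (D x) (t *\<^sub>R Z x))) *\<^sub>R Z' y))\<rparr>)"

text \<open>With \<open>G\<close>, \<open>G'\<close> the Gram and \<open>L\<close>,
  \<open>L'\<close> the Levi matrices at source and target, these are
  \<open>a\<^sup>T G' a = G\<close> and \<open>a\<^sup>T L' a = b L\<close>. Invertibility, an open
  condition, is left out so that the solutions form a closed set.\<close>

definition isometry_equations ::
  "(nat \<Rightarrow> 'm \<Rightarrow> ('m, 'e) tvec) \<Rightarrow> ('m \<Rightarrow> ('m, 'e) tvec) \<Rightarrow>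
   (nat \<Rightarrow> 'm \<Rightarrow> ('m, 'e) tvec) \<Rightarrow> ('m \<Rightarrow> ('m, 'e) tvec) \<Rightarrow>
   'm \<times> 'm \<times> (nat \<times> nat \<Rightarrow> real) \<times> real \<Rightarrow> bool" where
  "isometry_equations E Z E' Z' = (\<lambda>(x, y, a, b). \<forall>(k, l)\<in>{..<rk} \<times> {..<rk}.
    (\<Sum>i<rk. \<Sum>j<rk. a (i, k) * a (j, l) * g y (E' i y) (E' j y)) = g x (E k x) (E l x) \<and>
    (\<Sum>i<rk. \<Sum>j<rk. a (i, k) * a (j, l) * levi_coeff E' Z' i j y) = b * levi_coeff E Z k l x)"

lemma arrow_of_simps:
  "src (arrow_of E Z E' Z' (x, y, a, b)) = x" "tgt (arrow_of E Z E' Z' (x, y, a, b)) = y"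
  "v \<in> D x \<Longrightarrow> deg1 (arrow_of E Z E' Z' (x, y, a, b)) v =
    (\<Sum>i<rk. (\<Sum>j<rk. frame_coords E Z x v j * a (i, j)) *\<^sub>R E' i y)"
  by (simp_all add: arrow_of_def)

lemma normal_space_frame:
  assumes A: "adapted_frame M D U E Z" and x: "x \<in> U"
  shows "normal_space M D x = range (\<lambda>t. coset (D x) (t *\<^sub>R Z x))"
proof -
  have "\<exists>t. coset (D x) v = coset (D x) (t *\<^sub>R Z x)" if "v \<in> tangent_space M x" for v
    using coset_frame[OF A x that] by blast
  moreover have "t *\<^sub>R Z x \<in> tangent_space M x" for t
    using adapted_frameD(4)[OF A x] subspace_scale[OF tangent_subspace] by blast
  ultimately show ?thesis unfolding normal_space_def image_def by blast
qed

lemma deg2_arrow_of: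
  assumes A: "adapted_frame M D U E Z" and x: "x \<in> U"
  shows "deg2 (arrow_of E Z E' Z' (x, y, a, b)) (coset (D x) (t *\<^sub>R Z x)) = coset (D y) ((b * t) *\<^sub>R Z' y)"
proof -
  have "(THE s. coset (D x) (t *\<^sub>R Z x) = coset (D x) (s *\<^sub>R Z x)) = t"
    using coset_scale_frame_inj[OF A x] by auto
  moreover have "coset (D x) (t *\<^sub>R Z x) \<in> normal_space M D x"
    using normal_space_frame[OF A x] by blast
  ultimately show ?thesis by (simp add: arrow_of_def)
qed

lemma frame_coords_combine:
  assumes "adapted_frame M D U E Z" "x \<in> U" "v \<in> tangent_space M x" "w \<in> tangent_space M x" "i \<le> rk"
  shows "frame_coords E Z x (s *\<^sub>R v + t *\<^sub>R w) i = s * frame_coords E Z x v i + t * frame_coords E Z x w i"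
  unfolding frame_coords_def
  using coords_combine[OF full_frame_basis[OF assms(1,2)] assms(3,4)] assms(5) rk_less by simp

text \<open>The equations contain invertibility: a vector killed by the degree -1 part has zero norm
  at \<open>x\<close>, so that part is bijective by dimension; its surjectivity then turns
  \<open>b = 0\<close> into vanishing of the Levi map at \<open>y\<close>.\<close>

lemma arrow_of_in_groupoid:
  assumes A: "adapted_frame M D U E Z" and x: "x \<in> U"
    and A': "adapted_frame M D U' E' Z'" and y: "y \<in> U'"
    and eq: "isometry_equations E Z E' Z' (x, y, a, b)"
  shows "arrow_of E Z E' Z' (x, y, a, b) \<in> isometry_groupoid M D g"
proof -
  note E = local_frameD[OF adapted_frameD(1)[OF A]] and E' = local_frameD[OF adapted_frameD(1)[OF A']]
  have px: "x \<in> points M" and py: "y \<in> points M" using E(5)[OF x] E'(5)[OF y] .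
  let ?\<gamma> = "arrow_of E Z E' Z' (x, y, a, b)"
  let ?f = "deg1 ?\<gamma>" and ?h = "deg2 ?\<gamma>" and ?c = "frame_coords E Z x"
  let ?F = "\<lambda>v. \<Sum>i<rk. (\<Sum>j<rk. ?c v j * a (i, j)) *\<^sub>R E' i y"
  have f: "?f v = ?F v" if "v \<in> D x" for v using that by (rule arrow_of_simps)
  have gram: "(\<Sum>i<rk. \<Sum>j<rk. a (i, k) * a (j, l) * g y (E' i y) (E' j y)) = g x (E k x) (E l x)"
    and lev: "(\<Sum>i<rk. \<Sum>j<rk. a (i, k) * a (j, l) * levi_coeff E' Z' i j y) = b * levi_coeff E Z k l x"
    if "k < rk" "l < rk" for k l
    using eq that by (auto simp: isometry_equations_def)
  have linf: "linear_on_subspace (D x) ?f"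
    unfolding linear_on_subspace_def
  proof (intro ballI allI)
    fix v w s t assume vw: "v \<in> D x" "w \<in> D x"
    then have t: "v \<in> tangent_space M x" "w \<in> tangent_space M x" using distr_tangent[OF px] by auto
    have "s *\<^sub>R v + t *\<^sub>R w \<in> D x"
      using vw by (intro subspace_add subspace_scale distr_subspace px)
    moreover have "?F (s *\<^sub>R v + t *\<^sub>R w) = s *\<^sub>R ?F v + t *\<^sub>R ?F w"
    proof -
      have "(\<Sum>j<rk. ?c (s *\<^sub>R v + t *\<^sub>R w) j * a (i, j)) =
          s * (\<Sum>j<rk. ?c v j * a (i, j)) + t * (\<Sum>j<rk. ?c w j * a (i, j))" for i
        by (simp add: frame_coords_combine[OF A x t] sum.distrib sum_distrib_left distrib_right mult.assoc)
      then show ?thesis by (simp add: scaleR_left_distrib sum.distrib scaleR_sum_right)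
    qed
    ultimately show "?f (s *\<^sub>R v + t *\<^sub>R w) = s *\<^sub>R ?f v + t *\<^sub>R ?f w" using vw by (simp add: f)
  qed
  have fD: "?f ` D x \<subseteq> D y"
    using basis_of_comb[OF E'(4)[OF y]] by (auto simp: f)
  have iso: "g y (?f v) (?f w) = g x v w" if vw: "v \<in> D x" "w \<in> D x" for v w
  proof -
    have "g y (?f v) (?f w) = (\<Sum>k<rk. \<Sum>l<rk. ?c v k * ?c w l *
        (\<Sum>i<rk. \<Sum>j<rk. a (i, k) * a (j, l) * g y (E' i y) (E' j y)))"
      unfolding f[OF vw(1)] f[OF vw(2)] metric_frame[OF adapted_frameD(1)[OF A'] y]
      by (rule bilinear_sum_pullback)
    also have "\<dots> = (\<Sum>k<rk. \<Sum>l<rk. ?c v k * ?c w l * g x (E k x) (E l x))"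
      by (simp add: gram)
    also have "\<dots> = g x (\<Sum>k<rk. ?c v k *\<^sub>R E k x) (\<Sum>l<rk. ?c w l *\<^sub>R E l x)"
      by (rule metric_frame[OF adapted_frameD(1)[OF A] x, symmetric])
    also have "\<dots> = g x v w"
      by (simp only: frame_coords_distr(1)[OF A x vw(1), symmetric] frame_coords_distr(1)[OF A x vw(2), symmetric])
    finally show ?thesis .
  qed
  have bijf: "bij_betw ?f (D x) (D y)"
  proof (rule linear_on_subspace_bij[OF E(4)[OF x] E'(4)[OF y] linf fD])
    fix v assume v: "v \<in> D x" "?f v = 0"
    have "g y 0 0 = 0"
      using linear_on_subspaceD[OF metric_linear[OF py subspace_0[OF distr_subspace[OF py]]], of 0 0 0 0]
        subspace_0[OF distr_subspace[OF py]] by simp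
    then have "g x v v = 0" using iso[OF v(1) v(1)] v(2) by simp
    then show "v = 0" using metric_pos[OF px v(1)] by fastforce
  qed
  \<comment> \<open>The Levi map at \<open>x\<close> read in the frame; the bracket of the images at
    \<open>y\<close> turns out to be \<open>b\<close> times this scalar.\<close>
  define q where "q v w = (\<Sum>k<rk. \<Sum>l<rk. ?c v k * ?c w l * levi_coeff E Z k l x)" for v w
  have levix: "levi M D x v w = coset (D x) (q v w *\<^sub>R Z x)" if vw: "v \<in> D x" "w \<in> D x" for v w
    using levi_frame[OF A x, of "?c v" "?c w"]
    by (simp only: q_def frame_coords_distr(1)[OF A x vw(1), symmetric] frame_coords_distr(1)[OF A x vw(2), symmetric])
  have leviy: "levi M D y (?f v) (?f w) = coset (D y) ((b * q v w) *\<^sub>R Z' y)" if vw: "v \<in> D x" "w \<in> D x" for v w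
  proof -
    have "levi M D y (?f v) (?f w) = coset (D y) ((\<Sum>k<rk. \<Sum>l<rk. ?c v k * ?c w l *
        (\<Sum>i<rk. \<Sum>j<rk. a (i, k) * a (j, l) * levi_coeff E' Z' i j y)) *\<^sub>R Z' y)"
      unfolding f[OF vw(1)] f[OF vw(2)] levi_frame[OF A' y]
      by (rule arg_cong[of _ _ "\<lambda>t. coset (D y) (t *\<^sub>R Z' y)"], rule bilinear_sum_pullback)
    also have "(\<Sum>k<rk. \<Sum>l<rk. ?c v k * ?c w l *
        (\<Sum>i<rk. \<Sum>j<rk. a (i, k) * a (j, l) * levi_coeff E' Z' i j y)) = b * q v w"
    proof -
      have "(\<Sum>k<rk. \<Sum>l<rk. ?c v k * ?c w l *
          (\<Sum>i<rk. \<Sum>j<rk. a (i, k) * a (j, l) * levi_coeff E' Z' i j y)) =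
          (\<Sum>k<rk. \<Sum>l<rk. ?c v k * ?c w l * (b * levi_coeff E Z k l x))"
        by (intro sum.cong refl) (simp add: lev)
      then show ?thesis by (simp add: q_def sum_distrib_left mult_ac)
    qed
    finally show ?thesis .
  qed
  have h: "?h (coset (D x) (t *\<^sub>R Z x)) = coset (D y) ((b * t) *\<^sub>R Z' y)" for t
    by (rule deg2_arrow_of[OF A x])
  have "b \<noteq> 0"
  proof
    assume b: "b = 0"
    obtain v w where "v \<in> ?f ` D x" "w \<in> ?f ` D x" "levi M D y v w \<noteq> coset (D y) 0"
      using levi_nonzero[OF py] unfolding bij_betw_imp_surj_on[OF bijf] by blast
    then show False using leviy b by auto
  qed
  have N: "normal_space M D x = range (\<lambda>t. coset (D x) (t *\<^sub>R Z x))"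
    "normal_space M D y = range (\<lambda>t. coset (D y) (t *\<^sub>R Z' y))"
    using normal_space_frame[OF A x] normal_space_frame[OF A' y] .
  have bijh: "bij_betw ?h (normal_space M D x) (normal_space M D y)"
    unfolding bij_betw_def
  proof
    show "inj_on ?h (normal_space M D x)"
      using \<open>b \<noteq> 0\<close> by (auto simp: inj_on_def N h coset_scale_frame_inj[OF A' y])
    have "coset (D y) (t *\<^sub>R Z' y) \<in> ?h ` normal_space M D x" for t
    proof (rule image_eqI)
      show "coset (D y) (t *\<^sub>R Z' y) = ?h (coset (D x) ((t / b) *\<^sub>R Z x))"
        using \<open>b \<noteq> 0\<close> by (simp add: h)
      show "coset (D x) ((t / b) *\<^sub>R Z x) \<in> normal_space M D x" unfolding N(1) by blast
    qed
    then show "?h ` normal_space M D x = normal_space M D y"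
      unfolding N(2) by (auto simp: h N(1))
  qed
  have "?\<gamma> \<in> GL_gr M D"
  proof -
    have "?f \<in> extensional (D x)" "?h \<in> extensional (normal_space M D x)"
      by (auto simp: arrow_of_def)
    moreover have "?h (coset_add P Q) = coset_add (?h P) (?h Q)"
      if "P \<in> normal_space M D x" "Q \<in> normal_space M D x" for P Q
    proof -
      obtain s t where P: "P = coset (D x) (s *\<^sub>R Z x)" and Q: "Q = coset (D x) (t *\<^sub>R Z x)"
        using \<open>P \<in> _\<close> \<open>Q \<in> _\<close> unfolding N by blast
      show ?thesis
        unfolding P Q h coset_add_coset[OF distr_subspace[OF px]] coset_add_coset[OF distr_subspace[OF py]]
          scaleR_left_distrib[symmetric] distrib_left[symmetric] ..
    qed
    moreover have "?h (coset_scale (D x) r P) = coset_scale (D y) r (?h P)" if "P \<in> normal_space M D x" for P r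
    proof -
      obtain s where P: "P = coset (D x) (s *\<^sub>R Z x)" using \<open>P \<in> _\<close> unfolding N by blast
      have eq: "r *\<^sub>R (b * s) *\<^sub>R Z' y = (b * (r * s)) *\<^sub>R Z' y" by (simp add: mult_ac)
      show ?thesis
        unfolding P h coset_scale_coset[OF distr_subspace[OF px]] coset_scale_coset[OF distr_subspace[OF py]]
          eq by (simp only: scaleR_scaleR h)
    qed
    ultimately show ?thesis
      using bijf bijh linf px py unfolding GL_gr_def by (simp add: arrow_of_simps)
  qed
  moreover have "map_prod ?h ?f (gr_bracket M D x p q) = gr_bracket M D y (map_prod ?h ?f p) (map_prod ?h ?f q)"
    if "p \<in> gr_space M D x" "q \<in> gr_space M D x" for p q
  proof -
    have D: "snd p \<in> D x" "snd q \<in> D x" using that by (auto simp: gr_space_def)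
    have "?f 0 = 0"
      using linear_on_subspaceD[OF linf, of 0 0 0 0] subspace_0[OF distr_subspace[OF px]] by simp
    then show ?thesis
      using levix[OF D] leviy[OF D] by (simp add: gr_bracket_def h)
  qed
  ultimately show ?thesis
    using iso unfolding isometry_groupoid_def by (simp add: arrow_of_simps)
qed

lemma deg2_frame:
  assumes A: "adapted_frame M D U E Z" "adapted_frame M D U' E' Z'"
    and \<gamma>: "\<gamma> \<in> GL_gr M D" "src \<gamma> \<in> U" "tgt \<gamma> \<in> U'"
  shows "\<exists>b. deg2 \<gamma> (coset (D (src \<gamma>)) (Z (src \<gamma>))) = coset (D (tgt \<gamma>)) (b *\<^sub>R Z' (tgt \<gamma>))"
proof -
  have "coset (D (src \<gamma>)) (1 *\<^sub>R Z (src \<gamma>)) \<in> normal_space M D (src \<gamma>)"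
    using normal_space_frame[OF A(1) \<gamma>(2)] by blast
  then have "deg2 \<gamma> (coset (D (src \<gamma>)) (Z (src \<gamma>))) \<in> normal_space M D (tgt \<gamma>)"
    using \<gamma>(1) unfolding GL_gr_def by (auto dest: bij_betwE)
  then show ?thesis using normal_space_frame[OF A(2) \<gamma>(3)] by blast
qed

lemma deg1_frame:
  assumes A: "adapted_frame M D U E Z" "adapted_frame M D U' E' Z'"
    and \<gamma>: "\<gamma> \<in> GL_gr M D" "src \<gamma> \<in> U" "tgt \<gamma> \<in> U'" and j: "j < rk"
  shows "deg1 \<gamma> (E j (src \<gamma>)) =
    (\<Sum>i<rk. frame_coords E' Z' (tgt \<gamma>) (deg1 \<gamma> (E j (src \<gamma>))) i *\<^sub>R E' i (tgt \<gamma>))"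
proof (rule frame_coords_distr(1)[OF A(2) \<gamma>(3)])
  have "E j (src \<gamma>) \<in> D (src \<gamma>)" using local_frameD(7)[OF adapted_frameD(1)[OF A(1)] \<gamma>(2) j] .
  then show "deg1 \<gamma> (E j (src \<gamma>)) \<in> D (tgt \<gamma>)" using \<gamma>(1) unfolding GL_gr_def by (auto dest: bij_betwE)
qed

text \<open>An arrow is determined by its values on the frame and on the class of \<open>Z\<close>;
  testing the two defining conditions on frame vectors gives the equations.\<close>

lemma groupoid_arrow_of:
  assumes A: "adapted_frame M D U E Z" "adapted_frame M D U' E' Z'"
    and \<gamma>: "\<gamma> \<in> isometry_groupoid M D g" "src \<gamma> \<in> U" "tgt \<gamma> \<in> U'"
  obtains a b where "a \<in> extensional ({..<rk} \<times> {..<rk})"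
    "isometry_equations E Z E' Z' (src \<gamma>, tgt \<gamma>, a, b)" "\<gamma> = arrow_of E Z E' Z' (src \<gamma>, tgt \<gamma>, a, b)"
proof -
  let ?x = "src \<gamma>" and ?y = "tgt \<gamma>"
  note E = local_frameD[OF adapted_frameD(1)[OF A(1)]] and E' = local_frameD[OF adapted_frameD(1)[OF A(2)]]
  have px: "?x \<in> points M" and py: "?y \<in> points M" using E(5)[OF \<gamma>(2)] E'(5)[OF \<gamma>(3)] .
  have GL: "\<gamma> \<in> GL_gr M D" using \<gamma>(1) by (simp add: isometry_groupoid_def)
  define a where "a = (\<lambda>(i, j)\<in>{..<rk} \<times> {..<rk}. frame_coords E' Z' ?y (deg1 \<gamma> (E j ?x)) i)"
  obtain b where b: "deg2 \<gamma> (coset (D ?x) (Z ?x)) = coset (D ?y) (b *\<^sub>R Z' ?y)"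
    using deg2_frame[OF A GL \<gamma>(2,3)] by blast
  have lin: "linear_on_subspace (D ?x) (deg1 \<gamma>)" and ext: "deg1 \<gamma> \<in> extensional (D ?x)"
    "deg2 \<gamma> \<in> extensional (normal_space M D ?x)"
    using GL by (auto simp: GL_gr_def)
  have a: "deg1 \<gamma> (E j ?x) = (\<Sum>i<rk. a (i, j) *\<^sub>R E' i ?y)" if "j < rk" for j
    by (subst deg1_frame[OF A GL \<gamma>(2,3) that]) (simp add: a_def that)
  have deg2: "deg2 \<gamma> (coset (D ?x) (t *\<^sub>R Z ?x)) = coset (D ?y) ((b * t) *\<^sub>R Z' ?y)" for t
  proof -
    have "coset (D ?x) (1 *\<^sub>R Z ?x) \<in> normal_space M D ?x" using normal_space_frame[OF A(1) \<gamma>(2)] by blast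
    then have "deg2 \<gamma> (coset_scale (D ?x) t (coset (D ?x) (Z ?x))) =
        coset_scale (D ?y) t (deg2 \<gamma> (coset (D ?x) (Z ?x)))"
      using GL unfolding GL_gr_def by simp
    then show ?thesis
      by (simp add: b coset_scale_coset[OF distr_subspace[OF px]] coset_scale_coset[OF distr_subspace[OF py]] mult.commute)
  qed
  have
    "(\<Sum>i<rk. \<Sum>j<rk. a (i, k) * a (j, l) * g ?y (E' i ?y) (E' j ?y)) = g ?x (E k ?x) (E l ?x)"
    "(\<Sum>i<rk. \<Sum>j<rk. a (i, k) * a (j, l) * levi_coeff E' Z' i j ?y) = b * levi_coeff E Z k l ?x"
    if kl: "k < rk" "l < rk" for k l
  proof -
    have DE: "E k ?x \<in> D ?x" "E l ?x \<in> D ?x" using E(7)[OF \<gamma>(2)] kl by auto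
    have "g ?y (deg1 \<gamma> (E k ?x)) (deg1 \<gamma> (E l ?x)) = g ?x (E k ?x) (E l ?x)"
      using \<gamma>(1) DE by (simp add: isometry_groupoid_def)
    then show "(\<Sum>i<rk. \<Sum>j<rk. a (i, k) * a (j, l) * g ?y (E' i ?y) (E' j ?y)) = g ?x (E k ?x) (E l ?x)"
      by (simp add: a kl metric_frame[OF adapted_frameD(1)[OF A(2)] \<gamma>(3)])
    \<comment> \<open>Unit coefficient vectors, with which \<open>levi_frame\<close> yields single
      entries of the Levi matrix.\<close>
    let ?\<delta> = "\<lambda>k i. if i = k then 1 else (0::real)"
    have \<delta>: "(\<Sum>i<rk. ?\<delta> k i *\<^sub>R E i ?x) = E k ?x" if "k < rk" for k
    proof -
      have "(\<Sum>i<rk. ?\<delta> k i *\<^sub>R E i ?x) = (\<Sum>i<rk. if i = k then E i ?x else 0)"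
        by (rule sum.cong) auto
      then show ?thesis using that by simp
    qed
    have "(\<Sum>i<rk. \<Sum>j<rk. ?\<delta> k i * ?\<delta> l j * levi_coeff E Z i j ?x) = levi_coeff E Z k l ?x"
    proof -
      have "(\<Sum>i<rk. \<Sum>j<rk. ?\<delta> k i * ?\<delta> l j * levi_coeff E Z i j ?x) =
          (\<Sum>i<rk. ?\<delta> k i * (\<Sum>j<rk. ?\<delta> l j * levi_coeff E Z i j ?x))"
        unfolding sum_distrib_left mult.assoc ..
      also have "\<dots> = levi_coeff E Z k l ?x" by (simp only: sum_indicator_mult kl)
      finally show ?thesis .
    qed
    then have lx: "levi M D ?x (E k ?x) (E l ?x) = coset (D ?x) (levi_coeff E Z k l ?x *\<^sub>R Z ?x)"
      using levi_frame[OF A(1) \<gamma>(2), of "?\<delta> k" "?\<delta> l"] unfolding \<delta>[OF kl(1)] \<delta>[OF kl(2)] by simp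
    have ly: "levi M D ?y (deg1 \<gamma> (E k ?x)) (deg1 \<gamma> (E l ?x)) =
        coset (D ?y) ((\<Sum>i<rk. \<Sum>j<rk. a (i, k) * a (j, l) * levi_coeff E' Z' i j ?y) *\<^sub>R Z' ?y)"
      unfolding a[OF kl(1)] a[OF kl(2)] by (rule levi_frame[OF A(2) \<gamma>(3)])
    \<comment> \<open>The zero class, a filler for the degree -2 component, which the bracket
      ignores.\<close>
    let ?P = "coset (D ?x) (0 *\<^sub>R Z ?x)"
    have "?P \<in> normal_space M D ?x" using normal_space_frame[OF A(1) \<gamma>(2)] by blast
    then have "(?P, E k ?x) \<in> gr_space M D ?x" "(?P, E l ?x) \<in> gr_space M D ?x"
      using DE by (auto simp: gr_space_def)
    then have "map_prod (deg2 \<gamma>) (deg1 \<gamma>) (gr_bracket M D ?x (?P, E k ?x) (?P, E l ?x)) =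
      gr_bracket M D ?y (map_prod (deg2 \<gamma>) (deg1 \<gamma>) (?P, E k ?x)) (map_prod (deg2 \<gamma>) (deg1 \<gamma>) (?P, E l ?x))"
      using \<gamma>(1) unfolding isometry_groupoid_def by blast
    then have "deg2 \<gamma> (levi M D ?x (E k ?x) (E l ?x)) = levi M D ?y (deg1 \<gamma> (E k ?x)) (deg1 \<gamma> (E l ?x))"
      by (simp add: gr_bracket_def)
    then show "(\<Sum>i<rk. \<Sum>j<rk. a (i, k) * a (j, l) * levi_coeff E' Z' i j ?y) = b * levi_coeff E Z k l ?x"
      unfolding lx ly deg2 by (simp add: coset_scale_frame_inj[OF A(2) \<gamma>(3)])
  qed
  then have "isometry_equations E Z E' Z' (?x, ?y, a, b)" by (auto simp: isometry_equations_def)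
  moreover have "\<gamma> = arrow_of E Z E' Z' (?x, ?y, a, b)"
  proof -
    let ?\<gamma>' = "arrow_of E Z E' Z' (?x, ?y, a, b)"
    have "deg1 \<gamma> = deg1 ?\<gamma>'"
    proof (rule extensionalityI[OF ext(1)])
      show "deg1 ?\<gamma>' \<in> extensional (D ?x)" by (simp add: arrow_of_def)
      fix v assume v: "v \<in> D ?x"
      let ?c = "frame_coords E Z ?x v"
      have "deg1 \<gamma> v = deg1 \<gamma> (\<Sum>j<rk. ?c j *\<^sub>R E j ?x)"
        by (simp only: frame_coords_distr(1)[OF A(1) \<gamma>(2) v, symmetric])
      also have "\<dots> = (\<Sum>j<rk. ?c j *\<^sub>R deg1 \<gamma> (E j ?x))"
        using E(7)[OF \<gamma>(2)] by (intro linear_on_subspace_sum[OF lin distr_subspace[OF px]]) auto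
      also have "\<dots> = (\<Sum>j<rk. \<Sum>i<rk. (?c j * a (i, j)) *\<^sub>R E' i ?y)"
        by (simp add: a scaleR_sum_right)
      also have "\<dots> = (\<Sum>i<rk. (\<Sum>j<rk. ?c j * a (i, j)) *\<^sub>R E' i ?y)"
        by (subst sum.swap) (simp add: scaleR_left.sum)
      finally show "deg1 \<gamma> v = deg1 ?\<gamma>' v" using v by (simp add: arrow_of_simps)
    qed
    moreover have "deg2 \<gamma> = deg2 ?\<gamma>'"
    proof (rule extensionalityI[OF ext(2)])
      show "deg2 ?\<gamma>' \<in> extensional (normal_space M D ?x)" by (simp add: arrow_of_def)
      fix P assume "P \<in> normal_space M D ?x"
      then obtain t where "P = coset (D ?x) (t *\<^sub>R Z ?x)" using normal_space_frame[OF A(1) \<gamma>(2)] by blast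
      then show "deg2 \<gamma> P = deg2 ?\<gamma>' P" by (simp add: deg2 deg2_arrow_of[OF A(1) \<gamma>(2)])
    qed
    ultimately show ?thesis by (intro gr_arrow.equality) (simp_all add: arrow_of_simps)
  qed
  moreover have "a \<in> extensional ({..<rk} \<times> {..<rk})" by (simp add: a_def)
  ultimately show thesis using that by blast
qed

section \<open>Topology of the groupoid\<close>

abbreviation coord_space :: "('m \<times> 'm \<times> (nat \<times> nat \<Rightarrow> real) \<times> real) topology" where
  "coord_space \<equiv> prod_topology (mtop M) (prod_topology (mtop M)
     (prod_topology (product_topology (\<lambda>_. euclideanreal) ({..<rk} \<times> {..<rk})) euclideanreal))"

text \<open>Gram and Levi entries are continuous on the domain of a frame, so their pullbacks to the
  coordinate space are continuous over the coordinates \<open>R\<close> whose source lies in that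
  domain.\<close>

lemma coord_space_source:
  assumes "continuous_map (subtopology (mtop M) B) euclideanreal h" "R \<subseteq> {q. fst q \<in> B}"
  shows "continuous_map (subtopology coord_space R) euclideanreal (\<lambda>q. h (fst q))"
proof -
  have "continuous_map (subtopology coord_space R) (subtopology (mtop M) B) fst"
  proof (rule continuous_map_into_subtopology)
    show "continuous_map (subtopology coord_space R) (mtop M) fst"
      by (rule continuous_map_from_subtopology[OF continuous_map_fst])
    show "fst \<in> topspace (subtopology coord_space R) \<rightarrow> B" by (rule Pi_I) (use assms(2) in auto)
  qed
  from continuous_map_compose[OF this assms(1)] show ?thesis by (simp add: o_def)
qed

lemma coord_space_target:
  assumes "continuous_map (subtopology (mtop M) B) euclideanreal h" "R \<subseteq> {q. fst (snd q) \<in> B}"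
  shows "continuous_map (subtopology coord_space R) euclideanreal (\<lambda>q. h (fst (snd q)))"
proof -
  have "continuous_map coord_space (mtop M) (fst \<circ> snd)"
    by (intro continuous_map_compose[OF continuous_map_snd continuous_map_fst])
  then have "continuous_map (subtopology coord_space R) (subtopology (mtop M) B) (fst \<circ> snd)"
  proof (intro continuous_map_into_subtopology[OF continuous_map_from_subtopology])
    show "fst \<circ> snd \<in> topspace (subtopology coord_space R) \<rightarrow> B" by (rule Pi_I) (use assms(2) in auto)
  qed
  from continuous_map_compose[OF this assms(1)] show ?thesis by (simp add: o_def)
qed

lemma coord_space_snd_snd:
  "continuous_map coord_space
    (prod_topology (product_topology (\<lambda>_. euclideanreal) ({..<rk} \<times> {..<rk})) euclideanreal) (snd \<circ> snd)"
  by (rule continuous_map_compose[OF continuous_map_snd continuous_map_snd])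

lemma coord_space_entry:
  assumes "i < rk" "j < rk"
  shows "continuous_map (subtopology coord_space R) euclideanreal (\<lambda>q. fst (snd (snd q)) (i, j))"
proof -
  let ?P = "product_topology (\<lambda>_. euclideanreal) ({..<rk} \<times> {..<rk})"
  have 1: "continuous_map coord_space ?P (fst \<circ> (snd \<circ> snd))"
    by (rule continuous_map_compose[OF coord_space_snd_snd continuous_map_fst])
  have 2: "continuous_map ?P euclideanreal (\<lambda>a. a (i, j))"
    using assms by (intro continuous_map_product_projection) simp
  have "continuous_map (subtopology coord_space R) euclideanreal ((\<lambda>a. a (i, j)) \<circ> (fst \<circ> (snd \<circ> snd)))"
    by (rule continuous_map_from_subtopology[OF continuous_map_compose[OF 1 2]])
  then show ?thesis by (simp add: o_def)
qed

lemma coord_space_scalar: "continuous_map (subtopology coord_space R) euclideanreal (\<lambda>q. snd (snd (snd q)))"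
proof -
  have "continuous_map coord_space euclideanreal (snd \<circ> (snd \<circ> snd))"
    by (rule continuous_map_compose[OF coord_space_snd_snd continuous_map_snd])
  then have "continuous_map (subtopology coord_space R) euclideanreal (snd \<circ> (snd \<circ> snd))"
    by (rule continuous_map_from_subtopology)
  then show ?thesis by (simp add: o_def)
qed

text \<open>Positive definiteness at the target and a non-vanishing Levi entry at the source confine
  the solutions to a compact box, in which they form a closed set.\<close>

lemma compactin_isometry_equations:
  assumes A: "adapted_frame M D U E Z" and c: "c \<in> atlas M" "U \<subseteq> fst c"
    and A': "adapted_frame M D U' E' Z'" and c': "c' \<in> atlas M" "U' \<subseteq> fst c'"
    and K: "compactin (mtop M) K" "K \<subseteq> U" and K': "compactin (mtop M) K'" "K' \<subseteq> U'"
    and kl: "k < rk" "l < rk" "\<And>x. x \<in> K \<Longrightarrow> levi_coeff E Z k l x \<noteq> 0"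
  shows "compactin coord_space {q \<in> topspace coord_space. fst q \<in> K \<and> fst (snd q) \<in> K' \<and>
    isometry_equations E Z E' Z' q}" (is "compactin _ ?Q")
proof -
  note E = local_frameD[OF adapted_frameD(1)[OF A]] and E' = local_frameD[OF adapted_frameD(1)[OF A']]
  let ?g = "\<lambda>i j x. g x (E i x) (E j x)" and ?g' = "\<lambda>i j y. g y (E' i y) (E' j y)"
  let ?l = "levi_coeff E Z" and ?l' = "levi_coeff E' Z'"
  have cg: "continuous_map (subtopology (mtop M) K) euclideanreal (?g i j)" if "i < rk" "j < rk" for i j
    using metric_continuous[OF adapted_frameD(1)[OF A] c that] K(2) by (rule continuous_map_from_subtopology_mono)
  have cl: "continuous_map (subtopology (mtop M) K) euclideanreal (?l i j)" if "i < rk" "j < rk" for i j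
    using levi_coeff_continuous[OF A c that] K(2) by (rule continuous_map_from_subtopology_mono)
  have cg': "continuous_map (subtopology (mtop M) K') euclideanreal (?g' i j)" if "i < rk" "j < rk" for i j
    using metric_continuous[OF adapted_frameD(1)[OF A'] c' that] K'(2) by (rule continuous_map_from_subtopology_mono)
  have cl': "continuous_map (subtopology (mtop M) K') euclideanreal (?l' i j)" if "i < rk" "j < rk" for i j
    using levi_coeff_continuous[OF A' c' that] K'(2) by (rule continuous_map_from_subtopology_mono)
  have pos: "0 < (\<Sum>i<rk. \<Sum>j<rk. e i * e j * ?g' i j y)" if y: "y \<in> K'" and e: "\<exists>i<rk. e i \<noteq> 0" for y and e :: "nat \<Rightarrow> real"
  proof -
    have y': "y \<in> U'" using y K'(2) by auto
    let ?v = "\<Sum>i<rk. e i *\<^sub>R E' i y"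
    have "?v \<noteq> 0" using E'(4)[OF y'] e unfolding basis_of_iff lin_indep_def by blast
    then have "0 < g y ?v ?v" using metric_pos[OF E'(5)[OF y'] basis_of_comb[OF E'(4)[OF y']]] by blast
    then show ?thesis unfolding metric_frame[OF adapted_frameD(1)[OF A'] y'] .
  qed
  obtain \<delta> where \<delta>: "\<delta> > 0"
    "\<And>y e i. y \<in> K' \<Longrightarrow> i < rk \<Longrightarrow> \<delta> * (e i)\<^sup>2 \<le> (\<Sum>i<rk. \<Sum>j<rk. e i * e j * ?g' i j y)"
    using quadratic_form_lower_bound[OF K'(1), of rk ?g'] cg' pos by blast
  have "\<exists>B. \<forall>x\<in>K. \<bar>?g i i x\<bar> \<le> B" if "i < rk" for i
    using compactin_real_bounded[OF K(1) cg[OF that that]] by metis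
  then obtain G where G: "\<And>i x. i < rk \<Longrightarrow> x \<in> K \<Longrightarrow> \<bar>?g i i x\<bar> \<le> G i" by metis
  have "\<exists>B. \<forall>y\<in>K'. \<bar>?l' i j y\<bar> \<le> B" if "i < rk" "j < rk" for i j
    using compactin_real_bounded[OF K'(1) cl'[OF that]] by metis
  then obtain L where L: "\<And>i j y. i < rk \<Longrightarrow> j < rk \<Longrightarrow> y \<in> K' \<Longrightarrow> \<bar>?l' i j y\<bar> \<le> L i j" by metis
  have "continuous_map (subtopology (mtop M) K) euclideanreal (\<lambda>x. inverse (?l k l x))"
    using kl by (intro continuous_map_real_inverse cl) auto
  then obtain H where H: "\<And>x. x \<in> K \<Longrightarrow> \<bar>inverse (?l k l x)\<bar> \<le> H"
    using compactin_real_bounded[OF K(1)] by blast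
  \<comment> \<open>From \<open>\<delta> * (a (i, j))\<^sup>2 \<le> G j\<close> together with
    \<open>\<bar>t\<bar> \<le> 1 + t\<^sup>2\<close>, which avoids square roots.\<close>
  define C where "C i = 1 + G i / \<delta>" for i
  \<comment> \<open>\<open>b\<close> is the product of \<open>b * ?l k l x\<close>, estimated
    through the Levi equation, and the inverse of \<open>?l k l x\<close>, bounded by
    \<open>H\<close>.\<close>
  define B where "B = (\<Sum>i<rk. \<Sum>j<rk. C k * C l * L i j) * H"
  let ?Box = "K \<times> K' \<times> (PiE ({..<rk} \<times> {..<rk}) (\<lambda>(i, j). {- C j..C j})) \<times> {-B..B}"
  have "?Q \<subseteq> ?Box"
  proof
    fix q assume q: "q \<in> ?Q"
    obtain x y a b where q_eq: "q = (x, y, a, b)" by (cases q) auto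
    have x: "x \<in> K" and y: "y \<in> K'" and ext: "a \<in> extensional ({..<rk} \<times> {..<rk})"
      using q by (auto simp: q_eq PiE_iff)
    have gram: "(\<Sum>i<rk. \<Sum>j<rk. a (i, k) * a (j, l) * ?g' i j y) = ?g k l x"
      and lev: "(\<Sum>i<rk. \<Sum>j<rk. a (i, k) * a (j, l) * ?l' i j y) = b * ?l k l x"
      if "k < rk" "l < rk" for k l
      using q that by (auto simp: q_eq isometry_equations_def)
    have aC: "\<bar>a (i, j)\<bar> \<le> C j" if ij: "i < rk" "j < rk" for i j
    proof -
      have "\<delta> * (a (i, j))\<^sup>2 \<le> G j"
        using \<delta>(2)[OF y ij(1), of "\<lambda>i. a (i, j)"] gram[OF ij(2) ij(2)] G[OF ij(2) x] by linarith
      then have "(a (i, j))\<^sup>2 \<le> G j / \<delta>" using \<delta>(1) by (simp add: field_simps)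
      moreover have "\<bar>a (i, j)\<bar> \<le> 1 + (a (i, j))\<^sup>2"
        using sum_squares_bound[of "\<bar>a (i, j)\<bar>" 1] zero_le_power2[of "a (i, j)"] by (simp add: power2_abs)
      ultimately show ?thesis by (simp add: C_def)
    qed
    have "\<bar>b\<bar> = \<bar>b * ?l k l x\<bar> * \<bar>inverse (?l k l x)\<bar>"
      using kl(3)[OF x] by (simp add: abs_mult field_simps)
    also have "\<dots> \<le> (\<Sum>i<rk. \<Sum>j<rk. C k * C l * L i j) * H"
    proof (rule mult_mono[OF _ H[OF x]])
      show "\<bar>b * ?l k l x\<bar> \<le> (\<Sum>i<rk. \<Sum>j<rk. C k * C l * L i j)"
        unfolding lev[OF kl(1,2), symmetric]
      proof (intro order_trans[OF sum_abs] sum_mono order_trans[OF sum_abs])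
        fix i j assume "i \<in> {..<rk}" "j \<in> {..<rk}"
        then have "\<bar>a (i, k)\<bar> * \<bar>a (j, l)\<bar> * \<bar>?l' i j y\<bar> \<le> C k * C l * L i j"
          using aC kl L y by (intro mult_mono mult_nonneg_nonneg) (auto intro: order_trans[OF abs_ge_zero])
        then show "\<bar>a (i, k) * a (j, l) * ?l' i j y\<bar> \<le> C k * C l * L i j" by (simp add: abs_mult)
      qed
      then show "0 \<le> (\<Sum>i<rk. \<Sum>j<rk. C k * C l * L i j)" by linarith
    qed simp
    finally have "\<bar>b\<bar> \<le> B" by (simp add: B_def)
    moreover have "a (i, j) \<in> {- C j..C j}" if "i < rk" "j < rk" for i j
      using aC[OF that] by (simp add: abs_le_iff)
    ultimately show "q \<in> ?Box"
      using x y ext by (auto simp: q_eq PiE_iff abs_le_iff)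
  qed
  moreover have "compactin coord_space ?Box"
    using K(1) K'(1) by (auto simp: compactin_Times compactin_PiE)
  \<comment> \<open>Closedness is asserted inside the box, because the Gram and Levi entries are
    known to be continuous over \<open>K\<close> and \<open>K'\<close> and not on the whole
    coordinate space.\<close>
  moreover have "closedin (subtopology coord_space ?Box) (?Box \<inter> ?Q)"
  proof -
    let ?X = "subtopology coord_space ?Box"
    have src: "continuous_map ?X euclideanreal (\<lambda>q. h (fst q))"
      if "continuous_map (subtopology (mtop M) K) euclideanreal h" for h
      using that by (rule coord_space_source) auto
    have tgt: "continuous_map ?X euclideanreal (\<lambda>q. h (fst (snd q)))"
      if "continuous_map (subtopology (mtop M) K') euclideanreal h" for h
      using that by (rule coord_space_target) auto
    let ?P = "\<lambda>p q.
      (\<Sum>i<rk. \<Sum>j<rk. fst (snd (snd q)) (i, fst p) * fst (snd (snd q)) (j, snd p) * ?g' i j (fst (snd q)))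
        = ?g (fst p) (snd p) (fst q) \<and>
      (\<Sum>i<rk. \<Sum>j<rk. fst (snd (snd q)) (i, fst p) * fst (snd (snd q)) (j, snd p) * ?l' i j (fst (snd q)))
        = snd (snd (snd q)) * ?l (fst p) (snd p) (fst q)"
    have "closedin ?X {q \<in> topspace ?X. \<forall>p\<in>{..<rk} \<times> {..<rk}. ?P p q}"
    proof (rule closedin_Collect_ball_finite)
      fix p assume "p \<in> {..<rk} \<times> {..<rk}"
      then have p: "fst p < rk" "snd p < rk" by auto
      have "closedin ?X {q \<in> topspace ?X.
          (\<Sum>i<rk. \<Sum>j<rk. fst (snd (snd q)) (i, fst p) * fst (snd (snd q)) (j, snd p) * ?g' i j (fst (snd q)))
            = ?g (fst p) (snd p) (fst q)}"
        by (intro closedin_continuous_maps_eq[OF Hausdorff_space_euclidean] continuous_map_sum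
            continuous_map_real_mult coord_space_entry tgt src cg cg' p) auto
      moreover have "closedin ?X {q \<in> topspace ?X.
          (\<Sum>i<rk. \<Sum>j<rk. fst (snd (snd q)) (i, fst p) * fst (snd (snd q)) (j, snd p) * ?l' i j (fst (snd q)))
            = snd (snd (snd q)) * ?l (fst p) (snd p) (fst q)}"
        by (intro closedin_continuous_maps_eq[OF Hausdorff_space_euclidean] continuous_map_sum
            continuous_map_real_mult coord_space_entry coord_space_scalar tgt src cl cl' p) auto
      ultimately have "closedin ?X ({q \<in> topspace ?X.
          (\<Sum>i<rk. \<Sum>j<rk. fst (snd (snd q)) (i, fst p) * fst (snd (snd q)) (j, snd p) * ?g' i j (fst (snd q)))
            = ?g (fst p) (snd p) (fst q)} \<inter> {q \<in> topspace ?X.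
          (\<Sum>i<rk. \<Sum>j<rk. fst (snd (snd q)) (i, fst p) * fst (snd (snd q)) (j, snd p) * ?l' i j (fst (snd q)))
            = snd (snd (snd q)) * ?l (fst p) (snd p) (fst q)})" by (rule closedin_Int)
      then show "closedin ?X {q \<in> topspace ?X. ?P p q}"
        by (rule back_subst[of "closedin ?X"]) blast
    qed simp
    moreover have "{q \<in> topspace ?X. \<forall>p\<in>{..<rk} \<times> {..<rk}. ?P p q} = ?Box \<inter> ?Q"
    proof -
      have iff: "isometry_equations E Z E' Z' q \<longleftrightarrow> (\<forall>p\<in>{..<rk} \<times> {..<rk}. ?P p q)" for q
        unfolding isometry_equations_def by (cases q) (simp add: case_prod_beta')
      have box: "fst q \<in> K \<and> fst (snd q) \<in> K'" if "q \<in> ?Box" for q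
        using that by (simp only: mem_Times_iff)
      show ?thesis
      proof (rule Set.set_eqI)
        fix q
        show "q \<in> {q \<in> topspace ?X. \<forall>p\<in>{..<rk} \<times> {..<rk}. ?P p q} \<longleftrightarrow> q \<in> ?Box \<inter> ?Q"
          unfolding mem_Collect_eq Int_iff topspace_subtopology iff[symmetric] using box[of q] by argo
      qed
    qed
    ultimately show ?thesis by simp
  qed
  ultimately have "compactin (subtopology coord_space ?Box) (?Box \<inter> ?Q)" "?Box \<inter> ?Q = ?Q"
    using closedin_compact_space[OF compact_space_subtopology] by blast+
  then show ?thesis by (simp only: compactin_subtopology)
qed

section \<open>Trivialisations, changes of frames and the topology of \<open>GL_gr\<close>\<close>

lemma trivialisation_preimage_eq:
  "trivialisation_preimage M D U E Z U' E' Z' W =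
     {\<gamma> \<in> GL_gr M D. src \<gamma> \<in> U \<and> tgt \<gamma> \<in> U' \<and>
        (\<exists>a b. (src \<gamma>, tgt \<gamma>, a, b) \<in> W \<and>
           (\<forall>j<rk. deg1 \<gamma> (E j (src \<gamma>)) = (\<Sum>i<rk. a (i, j) *\<^sub>R E' i (tgt \<gamma>))) \<and>
           deg2 \<gamma> (coset (D (src \<gamma>)) (Z (src \<gamma>))) = coset (D (tgt \<gamma>)) (b *\<^sub>R Z' (tgt \<gamma>)))}"
  unfolding trivialisation_preimage_def rk ..

lemma mem_trivialisation_preimage:
  assumes A: "adapted_frame M D U E Z" "adapted_frame M D U' E' Z'"
    and \<gamma>: "\<gamma> \<in> GL_gr M D" "src \<gamma> \<in> U" "tgt \<gamma> \<in> U'"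
    and W: "\<And>a b. a \<in> extensional ({..<rk} \<times> {..<rk}) \<Longrightarrow> (src \<gamma>, tgt \<gamma>, a, b) \<in> W"
  shows "\<gamma> \<in> trivialisation_preimage M D U E Z U' E' Z' W"
proof -
  obtain b where b: "deg2 \<gamma> (coset (D (src \<gamma>)) (Z (src \<gamma>))) = coset (D (tgt \<gamma>)) (b *\<^sub>R Z' (tgt \<gamma>))"
    using deg2_frame[OF A \<gamma>] by blast
  let ?a = "\<lambda>(i, j)\<in>{..<rk} \<times> {..<rk}. frame_coords E' Z' (tgt \<gamma>) (deg1 \<gamma> (E j (src \<gamma>))) i"
  have "deg1 \<gamma> (E j (src \<gamma>)) = (\<Sum>i<rk. ?a (i, j) *\<^sub>R E' i (tgt \<gamma>))" if "j < rk" for j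
    by (subst deg1_frame[OF A \<gamma> that]) (simp add: that)
  moreover have "(src \<gamma>, tgt \<gamma>, ?a, b) \<in> W" by (rule W) simp
  ultimately show ?thesis using \<gamma> b unfolding trivialisation_preimage_eq by blast
qed

lemma trivialisation_open:
  assumes "adapted_frame M D U E Z" "adapted_frame M D U' E' Z'" "openin coord_space W"
  shows "openin (GL_gr_topology M D) (trivialisation_preimage M D U E Z U' E' Z' W)"
  unfolding GL_gr_topology_def
  by (rule topology_generated_by_Basis) (use assms[unfolded rk] in blast)

lemma topspace_GL_gr_topology: "topspace (GL_gr_topology M D) = GL_gr M D"
proof
  show "topspace (GL_gr_topology M D) \<subseteq> GL_gr M D"
    unfolding GL_gr_topology_def topology_generated_by_topspace by (auto simp: trivialisation_preimage_def)
  show "GL_gr M D \<subseteq> topspace (GL_gr_topology M D)"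
  proof
    fix \<gamma> assume \<gamma>: "\<gamma> \<in> GL_gr M D"
    then have p: "src \<gamma> \<in> points M" "tgt \<gamma> \<in> points M" by (auto simp: GL_gr_def)
    obtain U E Z where A: "src \<gamma> \<in> U" "adapted_frame M D U E Z" using ex_adapted_frame[OF p(1)] by metis
    obtain U' E' Z' where A': "tgt \<gamma> \<in> U'" "adapted_frame M D U' E' Z'" using ex_adapted_frame[OF p(2)] by metis
    have "\<gamma> \<in> trivialisation_preimage M D U E Z U' E' Z' (topspace coord_space)"
      using p by (intro mem_trivialisation_preimage[OF A(2) A'(2) \<gamma> A(1) A'(1)]) (simp add: PiE_iff)
    then show "\<gamma> \<in> topspace (GL_gr_topology M D)"
      using openin_subset[OF trivialisation_open[OF A(2) A'(2) openin_topspace]] by blast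
  qed
qed

text \<open>Around each of its arrows, a set given by open conditions on source and target contains
  a trivialisation preimage, in frames chosen near the endpoints of that arrow.\<close>

lemma continuous_map_src_tgt:
  "continuous_map (GL_gr_topology M D) (prod_topology (mtop M) (mtop M)) (\<lambda>\<gamma>. (src \<gamma>, tgt \<gamma>))"
proof -
  have open_st: "openin (GL_gr_topology M D) {\<gamma> \<in> GL_gr M D. src \<gamma> \<in> S \<and> tgt \<gamma> \<in> S'}"
    if S: "openin (mtop M) S" "openin (mtop M) S'" for S S'
  proof (subst openin_subopen, clarify)
    fix \<gamma> assume \<gamma>: "\<gamma> \<in> GL_gr M D" "src \<gamma> \<in> S" "tgt \<gamma> \<in> S'"
    then have p: "src \<gamma> \<in> points M" "tgt \<gamma> \<in> points M" by (auto simp: GL_gr_def)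
    obtain U E Z where A: "src \<gamma> \<in> U" "adapted_frame M D U E Z" using ex_adapted_frame[OF p(1)] by metis
    obtain U' E' Z' where A': "tgt \<gamma> \<in> U'" "adapted_frame M D U' E' Z'" using ex_adapted_frame[OF p(2)] by metis
    let ?W = "S \<times> S' \<times> topspace (prod_topology (product_topology (\<lambda>_. euclideanreal) ({..<rk} \<times> {..<rk})) euclideanreal)"
    have W: "openin coord_space ?W"
      unfolding openin_prod_Times_iff using S openin_topspace by blast
    have "\<gamma> \<in> trivialisation_preimage M D U E Z U' E' Z' ?W"
      using \<gamma> by (intro mem_trivialisation_preimage[OF A(2) A'(2) \<gamma>(1) A(1) A'(1)]) (simp add: PiE_iff)
    moreover have "trivialisation_preimage M D U E Z U' E' Z' ?W \<subseteq> {\<gamma> \<in> GL_gr M D. src \<gamma> \<in> S \<and> tgt \<gamma> \<in> S'}"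
      by (auto simp: trivialisation_preimage_def)
    ultimately show "\<exists>T. openin (GL_gr_topology M D) T \<and> \<gamma> \<in> T \<and>
        T \<subseteq> {\<gamma> \<in> GL_gr M D. src \<gamma> \<in> S \<and> tgt \<gamma> \<in> S'}"
      using trivialisation_open[OF A(2) A'(2) W] by blast
  qed
  have "continuous_map (GL_gr_topology M D) (mtop M) src"
    unfolding continuous_map_def topspace_GL_gr_topology
  proof (intro conjI allI impI)
    fix S assume "openin (mtop M) S"
    from open_st[OF this openin_topspace] show "openin (GL_gr_topology M D) {\<gamma> \<in> GL_gr M D. src \<gamma> \<in> S}"
      by (rule back_subst[of "openin (GL_gr_topology M D)"]) (auto simp: GL_gr_def)
  qed (auto simp: GL_gr_def)
  moreover have "continuous_map (GL_gr_topology M D) (mtop M) tgt"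
    unfolding continuous_map_def topspace_GL_gr_topology
  proof (intro conjI allI impI)
    fix S assume "openin (mtop M) S"
    from open_st[OF openin_topspace this] show "openin (GL_gr_topology M D) {\<gamma> \<in> GL_gr M D. tgt \<gamma> \<in> S}"
      by (rule back_subst[of "openin (GL_gr_topology M D)"]) (auto simp: GL_gr_def)
  qed (auto simp: GL_gr_def)
  ultimately show ?thesis by (rule continuous_map_pairedI)
qed

text \<open>Transition map between two trivialisations. With \<open>P\<close> the coordinates of
  \<open>F\<close> in \<open>E\<close> at the source and \<open>P'\<close> those of
  \<open>E'\<close> in \<open>F'\<close> at the target, the matrix becomes \<open>P' a P\<close>;
  the scalar is multiplied by the transverse components of \<open>Y\<close> and
  \<open>Z'\<close>.\<close>

definition change_frames ::
  "(nat \<Rightarrow> 'm \<Rightarrow> ('m, 'e) tvec) \<Rightarrow> ('m \<Rightarrow> ('m, 'e) tvec) \<Rightarrow>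
   (nat \<Rightarrow> 'm \<Rightarrow> ('m, 'e) tvec) \<Rightarrow> ('m \<Rightarrow> ('m, 'e) tvec) \<Rightarrow>
   (nat \<Rightarrow> 'm \<Rightarrow> ('m, 'e) tvec) \<Rightarrow> ('m \<Rightarrow> ('m, 'e) tvec) \<Rightarrow>
   (nat \<Rightarrow> 'm \<Rightarrow> ('m, 'e) tvec) \<Rightarrow> ('m \<Rightarrow> ('m, 'e) tvec) \<Rightarrow>
   'm \<times> 'm \<times> (nat \<times> nat \<Rightarrow> real) \<times> real \<Rightarrow> 'm \<times> 'm \<times> (nat \<times> nat \<Rightarrow> real) \<times> real" where
  "change_frames E Z E' Z' F Y F' Y' q =
    (fst q, fst (snd q),
     (\<lambda>p\<in>{..<rk} \<times> {..<rk}. \<Sum>l<rk. (\<Sum>k<rk. frame_coords E Z (fst q) (F (snd p) (fst q)) k *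
        fst (snd (snd q)) (l, k)) * frame_coords F' Y' (fst (snd q)) (E' l (fst (snd q))) (fst p)),
     snd (snd (snd q)) * frame_coords E Z (fst q) (Y (fst q)) rk *
       frame_coords F' Y' (fst (snd q)) (Z' (fst (snd q))) rk)"

text \<open>Membership asserts the existence of coordinates in the new frames. The formula of
  \<open>change_frames\<close> provides them, and they are unique since points of \<open>W\<close>
  carry extensional matrices.\<close>

lemma arrow_of_trivialisation:
  assumes A: "adapted_frame M D U E Z" "x \<in> U" and A': "adapted_frame M D U' E' Z'" "y \<in> U'"
    and B: "adapted_frame M D V F Y" and B': "adapted_frame M D V' F' Y'"
    and W: "W \<subseteq> topspace coord_space"
    and GL: "arrow_of E Z E' Z' (x, y, a, b) \<in> GL_gr M D"
  shows "arrow_of E Z E' Z' (x, y, a, b) \<in> trivialisation_preimage M D V F Y V' F' Y' W \<longleftrightarrow>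
    x \<in> V \<and> y \<in> V' \<and> change_frames E Z E' Z' F Y F' Y' (x, y, a, b) \<in> W" (is "?\<gamma> \<in> _ \<longleftrightarrow> _")
proof (cases "x \<in> V \<and> y \<in> V'")
  case True
  then have xy: "x \<in> V" "y \<in> V'" by auto
  note E' = local_frameD[OF adapted_frameD(1)[OF A'(1)]] and F = local_frameD[OF adapted_frameD(1)[OF B]]
    and F' = local_frameD[OF adapted_frameD(1)[OF B']]
  have px: "x \<in> points M" and py: "y \<in> points M" using F(5)[OF xy(1)] F'(5)[OF xy(2)] .
  obtain a' b' where cf: "change_frames E Z E' Z' F Y F' Y' (x, y, a, b) = (x, y, a', b')"
    by (simp add: change_frames_def)
  then have a': "a' = (\<lambda>p\<in>{..<rk} \<times> {..<rk}. \<Sum>l<rk. (\<Sum>k<rk. frame_coords E Z x (F (snd p) x) k * a (l, k)) *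
        frame_coords F' Y' y (E' l y) (fst p))"
    and b': "b' = b * frame_coords E Z x (Y x) rk * frame_coords F' Y' y (Z' y) rk"
    by (simp_all add: change_frames_def)
  have deg1: "deg1 ?\<gamma> (F j x) = (\<Sum>i<rk. a' (i, j) *\<^sub>R F' i y)" if j: "j < rk" for j
  proof -
    have E'F': "E' l y = (\<Sum>i<rk. frame_coords F' Y' y (E' l y) i *\<^sub>R F' i y)" if "l < rk" for l
      using frame_coords_distr(1)[OF B' xy(2)] E'(7)[OF A'(2) that] .
    have "deg1 ?\<gamma> (F j x) = (\<Sum>l<rk. (\<Sum>k<rk. frame_coords E Z x (F j x) k * a (l, k)) *\<^sub>R E' l y)"
      using F(7)[OF xy(1) j] by (rule arrow_of_simps)
    also have "\<dots> = (\<Sum>l<rk. (\<Sum>k<rk. frame_coords E Z x (F j x) k * a (l, k)) *\<^sub>R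
        (\<Sum>i<rk. frame_coords F' Y' y (E' l y) i *\<^sub>R F' i y))"
      by (intro sum.cong refl arg_cong2[of _ _ _ _ scaleR] E'F') simp
    also have "\<dots> = (\<Sum>l<rk. \<Sum>i<rk. ((\<Sum>k<rk. frame_coords E Z x (F j x) k * a (l, k)) *
        frame_coords F' Y' y (E' l y) i) *\<^sub>R F' i y)"
      by (simp only: scaleR_sum_right scaleR_scaleR)
    also have "\<dots> = (\<Sum>i<rk. \<Sum>l<rk. ((\<Sum>k<rk. frame_coords E Z x (F j x) k * a (l, k)) *
        frame_coords F' Y' y (E' l y) i) *\<^sub>R F' i y)"
      by (rule sum.swap)
    also have "\<dots> = (\<Sum>i<rk. a' (i, j) *\<^sub>R F' i y)"
      using j by (intro sum.cong refl) (simp add: a' scaleR_left.sum)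
    finally show ?thesis .
  qed
  have deg2: "deg2 ?\<gamma> (coset (D x) (Y x)) = coset (D y) (b' *\<^sub>R Y' y)"
  proof -
    let ?z = "frame_coords E Z x (Y x) rk" and ?z' = "frame_coords F' Y' y (Z' y) rk"
    have "deg2 ?\<gamma> (coset (D x) (Y x)) = coset (D y) ((b * ?z) *\<^sub>R Z' y)"
      unfolding coset_frame[OF A adapted_frameD(4)[OF B xy(1)]] by (rule deg2_arrow_of[OF A])
    also have "\<dots> = coset_scale (D y) (b * ?z) (coset (D y) (Z' y))"
      by (simp add: coset_scale_coset[OF distr_subspace[OF py]])
    also have "coset (D y) (Z' y) = coset (D y) (?z' *\<^sub>R Y' y)"
      by (rule coset_frame[OF B' xy(2) adapted_frameD(4)[OF A']])
    also have "coset_scale (D y) (b * ?z) (coset (D y) (?z' *\<^sub>R Y' y)) = coset (D y) (b' *\<^sub>R Y' y)"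
      by (simp add: coset_scale_coset[OF distr_subspace[OF py]] b')
    finally show ?thesis .
  qed
  have unique: "(x, y, a'', b'') = (x, y, a', b')"
    if "(x, y, a'', b'') \<in> W" "\<And>j. j < rk \<Longrightarrow> deg1 ?\<gamma> (F j x) = (\<Sum>i<rk. a'' (i, j) *\<^sub>R F' i y)"
      "deg2 ?\<gamma> (coset (D x) (Y x)) = coset (D y) (b'' *\<^sub>R Y' y)" for a'' b''
  proof -
    have "a'' = a'"
    proof (rule extensionalityI)
      show "a'' \<in> extensional ({..<rk} \<times> {..<rk})" using that(1) W by (auto simp: PiE_iff)
      show "a' \<in> extensional ({..<rk} \<times> {..<rk})" by (simp add: a')
      fix p assume "p \<in> {..<rk} \<times> {..<rk}"
      then obtain i j where p: "p = (i, j)" "i < rk" "j < rk" by auto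
      have "lin_indep rk (\<lambda>i. F' i y)" using F'(4)[OF xy(2)] by (simp add: basis_of_iff)
      from lin_indepD[OF this _ p(2), of "\<lambda>i. a'' (i, j)" "\<lambda>i. a' (i, j)"]
      show "a'' p = a' p" using that(2)[OF p(3)] deg1[OF p(3)] p(1) by simp
    qed
    moreover have "b'' = b'"
      using that(3) deg2 by (simp add: coset_scale_frame_inj[OF B' xy(2)])
    ultimately show ?thesis by simp
  qed
  show ?thesis
  proof
    assume "?\<gamma> \<in> trivialisation_preimage M D V F Y V' F' Y' W"
    then obtain a'' b'' where "(x, y, a'', b'') \<in> W"
      "\<And>j. j < rk \<Longrightarrow> deg1 ?\<gamma> (F j x) = (\<Sum>i<rk. a'' (i, j) *\<^sub>R F' i y)"
      "deg2 ?\<gamma> (coset (D x) (Y x)) = coset (D y) (b'' *\<^sub>R Y' y)"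
      unfolding trivialisation_preimage_eq mem_Collect_eq arrow_of_simps(1,2) by blast
    with unique[of a'' b''] show "x \<in> V \<and> y \<in> V' \<and> change_frames E Z E' Z' F Y F' Y' (x, y, a, b) \<in> W"
      unfolding cf using xy by simp
  next
    assume "x \<in> V \<and> y \<in> V' \<and> change_frames E Z E' Z' F Y F' Y' (x, y, a, b) \<in> W"
    then have "(x, y, a', b') \<in> W" by (simp only: cf)
    then show "?\<gamma> \<in> trivialisation_preimage M D V F Y V' F' Y' W"
      unfolding trivialisation_preimage_eq mem_Collect_eq arrow_of_simps(1,2)
      using GL xy deg1 deg2 by blast
  qed
next
  case False
  then show ?thesis by (auto simp: trivialisation_preimage_eq arrow_of_simps)
qed

lemma change_frames_continuous:
  assumes A: "adapted_frame M D U E Z" and c: "c \<in> atlas M" "U \<subseteq> fst c"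
    and A': "adapted_frame M D U' E' Z'" and c': "c' \<in> atlas M" "U' \<subseteq> fst c'"
    and B: "adapted_frame M D V F Y" and B': "adapted_frame M D V' F' Y'"
    and R: "R = {q \<in> topspace coord_space. fst q \<in> U \<inter> V \<and> fst (snd q) \<in> U' \<inter> V'}"
  shows "continuous_map (subtopology coord_space R) coord_space (change_frames E Z E' Z' F Y F' Y')"
proof -
  note F = local_frameD[OF adapted_frameD(1)[OF B]] and E' = local_frameD[OF adapted_frameD(1)[OF A']]
  have src: "continuous_map (subtopology coord_space R) euclideanreal (\<lambda>q. frame_coords E Z (fst q) (X (fst q)) k)"
    if X: "smooth_vector_field M V X" and k: "k \<le> rk" for X k
  proof (rule coord_space_source)
    have "smooth_vector_field M (U \<inter> V) X" using smooth_vector_field_subset[OF X] by blast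
    then show "continuous_map (subtopology (mtop M) (U \<inter> V)) euclideanreal (\<lambda>x. frame_coords E Z x (X x) k)"
      using c(2) by (intro frame_coords_continuous[OF A c(1) _ _ _ _ k] vector_field_continuous c(1))
        (auto simp: smooth_vector_field_def)
  qed (auto simp: R)
  have tgt: "continuous_map (subtopology coord_space R) euclideanreal
      (\<lambda>q. frame_coords F' Y' (fst (snd q)) (X (fst (snd q))) k)"
    if X: "smooth_vector_field M U' X" and k: "k \<le> rk" for X k
  proof (rule coord_space_target)
    have "smooth_vector_field M (U' \<inter> V') X" using smooth_vector_field_subset[OF X] by blast
    then show "continuous_map (subtopology (mtop M) (U' \<inter> V')) euclideanreal (\<lambda>x. frame_coords F' Y' x (X x) k)"
      using c'(2) by (intro frame_coords_continuous[OF B' c'(1) _ _ _ _ k] vector_field_continuous c'(1))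
        (auto simp: smooth_vector_field_def)
  qed (auto simp: R)
  let ?X = "subtopology coord_space R" and ?I = "{..<rk} \<times> {..<rk}"
  have 1: "continuous_map ?X (mtop M) fst"
    by (rule continuous_map_from_subtopology[OF continuous_map_fst])
  have 2: "continuous_map ?X (mtop M) (\<lambda>q. fst (snd q))"
    using continuous_map_from_subtopology[OF continuous_map_compose[OF continuous_map_snd continuous_map_fst]]
    by (simp only: o_def)
  have 3: "continuous_map ?X (product_topology (\<lambda>_. euclideanreal) ?I)
     (\<lambda>q. \<lambda>p\<in>?I. \<Sum>l<rk. (\<Sum>k<rk. frame_coords E Z (fst q) (F (snd p) (fst q)) k *
        fst (snd (snd q)) (l, k)) * frame_coords F' Y' (fst (snd q)) (E' l (fst (snd q))) (fst p))"
    unfolding continuous_map_componentwise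
  proof (intro conjI ballI)
    fix p assume p: "p \<in> ?I"
    have "continuous_map ?X euclideanreal
      (\<lambda>q. \<Sum>l<rk. (\<Sum>k<rk. frame_coords E Z (fst q) (F (snd p) (fst q)) k *
        fst (snd (snd q)) (l, k)) * frame_coords F' Y' (fst (snd q)) (E' l (fst (snd q))) (fst p))"
      by (intro continuous_map_sum continuous_map_real_mult src tgt coord_space_entry F(3) E'(3)) (use p in auto)
    then show "continuous_map ?X euclideanreal
      (\<lambda>q. (\<lambda>p\<in>?I. \<Sum>l<rk. (\<Sum>k<rk. frame_coords E Z (fst q) (F (snd p) (fst q)) k *
        fst (snd (snd q)) (l, k)) * frame_coords F' Y' (fst (snd q)) (E' l (fst (snd q))) (fst p)) p)"
      using p by simp
  qed auto
  have 4: "continuous_map ?X euclideanreal (\<lambda>q. snd (snd (snd q)) * frame_coords E Z (fst q) (Y (fst q)) rk *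
       frame_coords F' Y' (fst (snd q)) (Z' (fst (snd q))) rk)"
    by (intro continuous_map_real_mult coord_space_scalar src tgt adapted_frameD(2)[OF B] adapted_frameD(2)[OF A']) auto
  show ?thesis
    unfolding change_frames_def[abs_def] by (intro continuous_map_pairedI 1 2 3 4)
qed

text \<open>The topology is generated by trivialisations in all adapted frames. A generating set
  pulls back to the preimage of its \<open>W\<close> under a change of frames, which is open over
  the overlap \<open>R\<close> of the domains.\<close>

lemma arrow_of_continuous:
  assumes A: "adapted_frame M D U E Z" and c: "c \<in> atlas M" "U \<subseteq> fst c"
    and A': "adapted_frame M D U' E' Z'" and c': "c' \<in> atlas M" "U' \<subseteq> fst c'"
    and Q: "Q \<subseteq> topspace coord_space"
      "\<And>q. q \<in> Q \<Longrightarrow> fst q \<in> U \<and> fst (snd q) \<in> U' \<and> isometry_equations E Z E' Z' q"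
  shows "continuous_map (subtopology coord_space Q) (GL_gr_topology M D) (arrow_of E Z E' Z')"
proof -
  have GL: "arrow_of E Z E' Z' q \<in> GL_gr M D" if "q \<in> Q" for q
  proof -
    obtain x y a b where q: "q = (x, y, a, b)" by (cases q) auto
    show ?thesis
      using arrow_of_in_groupoid[OF A _ A', of x y a b] Q(2)[OF that] by (simp add: q isometry_groupoid_def)
  qed
  have top: "topspace (subtopology coord_space Q) = Q" using Q(1) by (simp only: topspace_subtopology Int_absorb1)
  show ?thesis
    unfolding GL_gr_topology_def
  proof (rule continuous_on_generated_topo)
    fix T assume "T \<in> {trivialisation_preimage M D U E Z U' E' Z' W | U E Z U' E' Z' W.
      adapted_frame M D U E Z \<and> adapted_frame M D U' E' Z' \<and> openin (trivialisation_space M) W}"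
    then obtain V F Y V' F' Y' W where T: "T = trivialisation_preimage M D V F Y V' F' Y' W"
      and B: "adapted_frame M D V F Y" "adapted_frame M D V' F' Y'" and W: "openin coord_space W"
      unfolding rk by blast
    define R where "R = {q \<in> topspace coord_space. fst q \<in> U \<inter> V \<and> fst (snd q) \<in> U' \<inter> V'}"
    have UV: "openin (mtop M) (U \<inter> V)" "openin (mtop M) (U' \<inter> V')"
      using A A' B adapted_frameD(1) local_frameD(1) by (meson openin_Int)+
    have "openin coord_space {q \<in> topspace coord_space. fst q \<in> U \<inter> V}"
      by (rule openin_continuous_map_preimage[OF continuous_map_fst UV(1)])
    moreover have "openin coord_space {q \<in> topspace coord_space. (fst \<circ> snd) q \<in> U' \<inter> V'}"
      by (rule openin_continuous_map_preimage[OF continuous_map_compose[OF continuous_map_snd continuous_map_fst] UV(2)])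
    ultimately have "openin coord_space ({q \<in> topspace coord_space. fst q \<in> U \<inter> V} \<inter>
        {q \<in> topspace coord_space. (fst \<circ> snd) q \<in> U' \<inter> V'})" by (rule openin_Int)
    then have R: "openin coord_space R"
      by (rule back_subst[of "openin coord_space"]) (auto simp only: R_def o_apply)
    let ?\<tau> = "change_frames E Z E' Z' F Y F' Y'"
    have "openin (subtopology coord_space R) {q \<in> topspace (subtopology coord_space R). ?\<tau> q \<in> W}"
      by (rule openin_continuous_map_preimage[OF change_frames_continuous[OF A c A' c' B R_def] W])
    then have O: "openin coord_space {q \<in> topspace (subtopology coord_space R). ?\<tau> q \<in> W}"
      using R by (rule openin_trans_full)
    have eq: "arrow_of E Z E' Z' -` T \<inter> Q = {q \<in> topspace (subtopology coord_space R). ?\<tau> q \<in> W} \<inter> Q"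
    proof (rule Set.set_eqI)
      fix q :: "'m \<times> 'm \<times> (nat \<times> nat \<Rightarrow> real) \<times> real"
      obtain x y a b where q: "q = (x, y, a, b)" by (cases q) auto
      show "q \<in> arrow_of E Z E' Z' -` T \<inter> Q \<longleftrightarrow>
        q \<in> {q \<in> topspace (subtopology coord_space R). ?\<tau> q \<in> W} \<inter> Q"
      proof (cases "q \<in> Q")
        case True
        then have qU: "x \<in> U" "y \<in> U'" "q \<in> topspace coord_space" using Q by (auto simp: q)
        have "arrow_of E Z E' Z' q \<in> T \<longleftrightarrow> x \<in> V \<and> y \<in> V' \<and> ?\<tau> q \<in> W"
          using arrow_of_trivialisation[OF A qU(1) A' qU(2) B openin_subset[OF W]] GL[OF True]
          unfolding T q by blast
        moreover have "q \<in> R \<longleftrightarrow> x \<in> V \<and> y \<in> V'" using qU by (simp only: R_def q) simp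
        ultimately show ?thesis using True qU(3)
          by (simp only: vimage_eq Int_iff mem_Collect_eq topspace_subtopology) blast
      qed blast
    qed
    show "openin (subtopology coord_space Q) (arrow_of E Z E' Z' -` T \<inter> topspace (subtopology coord_space Q))"
      unfolding top openin_subtopology by (rule exI, rule conjI[OF O eq])
  next
    have "arrow_of E Z E' Z' ` Q \<subseteq> topspace (GL_gr_topology M D)"
      unfolding topspace_GL_gr_topology using GL by blast
    then show "arrow_of E Z E' Z' ` topspace (subtopology coord_space Q) \<subseteq>
      \<Union> {trivialisation_preimage M D U E Z U' E' Z' W | U E Z U' E' Z' W.
        adapted_frame M D U E Z \<and> adapted_frame M D U' E' Z' \<and> openin (trivialisation_space M) W}"
      unfolding top GL_gr_topology_def topology_generated_by_topspace .
  qed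
qed

section \<open>Compact preimages and properness\<close>

lemma compactin_groupoid_local:
  assumes A: "adapted_frame M D U E Z" and c: "c \<in> atlas M" "U \<subseteq> fst c"
    and A': "adapted_frame M D U' E' Z'" and c': "c' \<in> atlas M" "U' \<subseteq> fst c'"
    and K: "compactin (mtop M) K" "K \<subseteq> U" and K': "compactin (mtop M) K'" "K' \<subseteq> U'"
    and kl: "k < rk" "l < rk" "\<And>x. x \<in> K \<Longrightarrow> levi_coeff E Z k l x \<noteq> 0"
  shows "compactin (GL_gr_topology M D) {\<gamma> \<in> isometry_groupoid M D g. src \<gamma> \<in> K \<and> tgt \<gamma> \<in> K'}"
proof -
  let ?Q = "{q \<in> topspace coord_space. fst q \<in> K \<and> fst (snd q) \<in> K' \<and> isometry_equations E Z E' Z' q}"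
  have Q: "compactin coord_space ?Q" by (rule compactin_isometry_equations[OF assms])
  have "continuous_map (subtopology coord_space ?Q) (GL_gr_topology M D) (arrow_of E Z E' Z')"
    by (rule arrow_of_continuous[OF A c A' c']) (use K(2) K'(2) in blast)+
  with Q have "compactin (GL_gr_topology M D) (arrow_of E Z E' Z' ` ?Q)"
    by (intro image_compactin[of "subtopology coord_space ?Q"]) (simp only: compactin_absolute)
  moreover have "arrow_of E Z E' Z' ` ?Q = {\<gamma> \<in> isometry_groupoid M D g. src \<gamma> \<in> K \<and> tgt \<gamma> \<in> K'}"
  proof (intro subset_antisym subsetI)
    fix \<gamma> assume "\<gamma> \<in> arrow_of E Z E' Z' ` ?Q"
    then obtain x y a b where \<gamma>: "\<gamma> = arrow_of E Z E' Z' (x, y, a, b)"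
      "x \<in> K" "y \<in> K'" "isometry_equations E Z E' Z' (x, y, a, b)" by auto
    then have "\<gamma> \<in> isometry_groupoid M D g"
      using arrow_of_in_groupoid[OF A _ A'] K(2) K'(2) by blast
    then show "\<gamma> \<in> {\<gamma> \<in> isometry_groupoid M D g. src \<gamma> \<in> K \<and> tgt \<gamma> \<in> K'}"
      using \<gamma> by (simp add: arrow_of_simps)
  next
    fix \<gamma> assume "\<gamma> \<in> {\<gamma> \<in> isometry_groupoid M D g. src \<gamma> \<in> K \<and> tgt \<gamma> \<in> K'}"
    then have \<gamma>: "\<gamma> \<in> isometry_groupoid M D g" "src \<gamma> \<in> K" "tgt \<gamma> \<in> K'" by auto
    obtain a b where ab: "a \<in> extensional ({..<rk} \<times> {..<rk})"
      "isometry_equations E Z E' Z' (src \<gamma>, tgt \<gamma>, a, b)" "\<gamma> = arrow_of E Z E' Z' (src \<gamma>, tgt \<gamma>, a, b)"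
      using groupoid_arrow_of[OF A A' \<gamma>(1)] \<gamma>(2,3) K(2) K'(2) by blast
    have "src \<gamma> \<in> points M" "tgt \<gamma> \<in> points M"
      using \<gamma> K(1) K'(1) compactin_subset_topspace by blast+
    then have "(src \<gamma>, tgt \<gamma>, a, b) \<in> ?Q" using ab(1,2) \<gamma>(2,3) by (simp add: PiE_iff)
    then show "\<gamma> \<in> arrow_of E Z E' Z' ` ?Q" using ab(3) by (rule rev_image_eqI)
  qed
  ultimately show ?thesis by simp
qed

text \<open>The open sets \<open>G\<close> and \<open>G'\<close> serve to cover compact subsets of
  \<open>M \<times> M\<close>; the compact set of arrows over \<open>K\<close> and \<open>K'\<close>
  contains all arrows of the groupoid over \<open>G\<close> and \<open>G'\<close>.\<close>

lemma compactin_groupoid_neighbourhood: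
  assumes x: "x \<in> points M" and y: "y \<in> points M"
  obtains G G' K K' where "openin (mtop M) G" "x \<in> G" "G \<subseteq> K" "openin (mtop M) G'" "y \<in> G'" "G' \<subseteq> K'"
    "compactin (GL_gr_topology M D) {\<gamma> \<in> isometry_groupoid M D g. src \<gamma> \<in> K \<and> tgt \<gamma> \<in> K'}"
proof -
  obtain U E Z c where A: "x \<in> U" "c \<in> atlas M" "U \<subseteq> fst c" "adapted_frame M D U E Z"
    using ex_adapted_frame[OF x] .
  obtain U' E' Z' c' where A': "y \<in> U'" "c' \<in> atlas M" "U' \<subseteq> fst c'" "adapted_frame M D U' E' Z'"
    using ex_adapted_frame[OF y] .
  have U: "openin (mtop M) U" "openin (mtop M) U'"
    using local_frameD(1)[OF adapted_frameD(1)] A(4) A'(4) by blast+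
  obtain k l where kl: "k < rk" "l < rk" "levi_coeff E Z k l x \<noteq> 0" using levi_coeff_nonzero[OF A(4,1)] .
  let ?X = "subtopology (mtop M) U"
  have top: "topspace ?X = U" using openin_subset[OF U(1)] by (simp add: Int_absorb1)
  have "openin ?X {z \<in> topspace ?X. levi_coeff E Z k l z \<in> - {0}}"
    by (rule openin_continuous_map_preimage[OF levi_coeff_continuous[OF A(4,2,3) kl(1,2)]])
      (simp add: open_Compl)
  then have "openin (mtop M) {z \<in> U. levi_coeff E Z k l z \<in> - {0}}"
    unfolding top using U(1) by (rule openin_trans_full)
  moreover have "x \<in> {z \<in> U. levi_coeff E Z k l z \<in> - {0}}" using A(1) kl(3) by simp
  ultimately obtain G K where G: "openin (mtop M) G" "compactin (mtop M) K" "x \<in> G" "G \<subseteq> K"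
    "K \<subseteq> {z \<in> U. levi_coeff E Z k l z \<in> - {0}}"
    by (rule compact_neighbourhood)
  obtain G' K' where G': "openin (mtop M) G'" "compactin (mtop M) K'" "y \<in> G'" "G' \<subseteq> K'" "K' \<subseteq> U'"
    using compact_neighbourhood[OF U(2) A'(1)] .
  have "compactin (GL_gr_topology M D) {\<gamma> \<in> isometry_groupoid M D g. src \<gamma> \<in> K \<and> tgt \<gamma> \<in> K'}"
    by (rule compactin_groupoid_local[OF A(4,2,3) A'(4,2,3) G(2) _ G'(2,5) kl(1,2)]) (use G(5) in auto)
  then show thesis using that G G' by blast
qed

lemma topspace_isometry_groupoid: "topspace (isometry_groupoid_topology M D g) = isometry_groupoid M D g"
  unfolding isometry_groupoid_topology_def topspace_subtopology topspace_GL_gr_topology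
  by (auto simp: isometry_groupoid_def)

lemma continuous_map_isometry_groupoid:
  "continuous_map (isometry_groupoid_topology M D g) (prod_topology (mtop M) (mtop M)) (\<lambda>\<gamma>. (src \<gamma>, tgt \<gamma>))"
  unfolding isometry_groupoid_topology_def
  by (rule continuous_map_from_subtopology[OF continuous_map_src_tgt])

lemma compactin_groupoid:
  assumes C: "compactin (prod_topology (mtop M) (mtop M)) C"
  shows "compactin (isometry_groupoid_topology M D g)
    {\<gamma> \<in> topspace (isometry_groupoid_topology M D g). (src \<gamma>, tgt \<gamma>) \<in> C}"
proof -
  let ?MM = "prod_topology (mtop M) (mtop M)" and ?X = "isometry_groupoid_topology M D g"
  let ?pre = "\<lambda>K K'. {\<gamma> \<in> isometry_groupoid M D g. src \<gamma> \<in> K \<and> tgt \<gamma> \<in> K'}"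
  \<comment> \<open>Open sets whose arrows lie in some compact set: a finite subcover encloses the
    preimage of \<open>C\<close> in a finite union of compact sets.\<close>
  let ?V = "{W. openin ?MM W \<and> (\<exists>S. compactin ?X S \<and> {\<gamma> \<in> isometry_groupoid M D g. (src \<gamma>, tgt \<gamma>) \<in> W} \<subseteq> S)}"
  have "C \<subseteq> \<Union>?V"
  proof clarify
    fix x y assume "(x, y) \<in> C"
    then have xy: "x \<in> points M" "y \<in> points M" using compactin_subset_topspace[OF C] by auto
    obtain G G' K K' where G: "openin (mtop M) G" "x \<in> G" "G \<subseteq> K" "openin (mtop M) G'" "y \<in> G'" "G' \<subseteq> K'"
      "compactin (GL_gr_topology M D) (?pre K K')"
      using compactin_groupoid_neighbourhood[OF xy] .
    have "compactin ?X (?pre K K')"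
      unfolding isometry_groupoid_topology_def compactin_subtopology using G(7) by blast
    moreover have "{\<gamma> \<in> isometry_groupoid M D g. (src \<gamma>, tgt \<gamma>) \<in> G \<times> G'} \<subseteq> ?pre K K'" using G(3,6) by blast
    moreover have "openin ?MM (G \<times> G')" using G(1,4) by (simp add: openin_prod_Times_iff)
    ultimately have "G \<times> G' \<in> ?V" by blast
    then show "(x, y) \<in> \<Union>?V" using G(2,5) by blast
  qed
  then obtain F where F: "finite F" "F \<subseteq> ?V" "C \<subseteq> \<Union>F"
    using compactinD[OF C, of ?V] by blast
  then have "\<forall>W\<in>F. \<exists>S. compactin ?X S \<and> {\<gamma> \<in> isometry_groupoid M D g. (src \<gamma>, tgt \<gamma>) \<in> W} \<subseteq> S" by blast
  from bchoice[OF this] obtain S where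
    "\<forall>W\<in>F. compactin ?X (S W) \<and> {\<gamma> \<in> isometry_groupoid M D g. (src \<gamma>, tgt \<gamma>) \<in> W} \<subseteq> S W"
    by (rule exE)
  then have S: "compactin ?X (S W)" "{\<gamma> \<in> isometry_groupoid M D g. (src \<gamma>, tgt \<gamma>) \<in> W} \<subseteq> S W"
    if "W \<in> F" for W
    using that by simp_all
  have "closedin ?MM C"
    using compactin_imp_closedin[OF _ C] Hausdorff by (simp add: Hausdorff_space_prod_topology)
  then have "closedin ?X {\<gamma> \<in> topspace ?X. (src \<gamma>, tgt \<gamma>) \<in> C}"
    by (rule closedin_continuous_map_preimage[OF continuous_map_isometry_groupoid])
  moreover have "compactin ?X (\<Union>(S ` F))" using F(1) S(1) by (intro compactin_Union) auto
  moreover have "{\<gamma> \<in> topspace ?X. (src \<gamma>, tgt \<gamma>) \<in> C} \<subseteq> \<Union>(S ` F)"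
    unfolding topspace_isometry_groupoid using F(3) S(2) by blast
  ultimately show ?thesis using closed_compactin by blast
qed

text \<open>\<open>proper_map\<close> asks for a closed map with compact fibres. Continuity and
  compact preimages of compact sets imply this because \<open>M \<times> M\<close> is locally
  compact and Hausdorff, hence compactly generated with closed compact subsets.\<close>

lemma proper_map_isometry_groupoid:
  "proper_map (isometry_groupoid_topology M D g) (prod_topology (mtop M) (mtop M)) (\<lambda>\<gamma>. (src \<gamma>, tgt \<gamma>))"
proof (rule compact_imp_proper_map)
  show "k_space (prod_topology (mtop M) (mtop M))"
    by (intro locally_compact_imp_k_space) (simp add: locally_compact_space_prod_topology locally_compact)
  show "kc_space (prod_topology (mtop M) (mtop M))"
    by (intro Hausdorff_imp_kc_space) (simp add: Hausdorff_space_prod_topology Hausdorff)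
  show "(\<lambda>\<gamma>. (src \<gamma>, tgt \<gamma>)) \<in> topspace (isometry_groupoid_topology M D g) \<rightarrow> topspace (prod_topology (mtop M) (mtop M))"
    by (rule continuous_map_funspace[OF continuous_map_isometry_groupoid])
qed (use continuous_map_isometry_groupoid compactin_groupoid in blast)+

end

theorem proposition3p12:
  fixes M :: "('m, 'e::euclidean_space) manifold"
    and D :: "('m, 'e) distr"
    and g :: "('m, 'e) metric"
    and N S :: "(real ^ 'n::{finite,linorder}) set"
    and k :: nat
  assumes "corank_one_sub_riemannian M D g"
    and "DIM('e) = 2 * CARD('n) + 1"
    and "S \<in> simplex_strata" and "N \<subseteq> S" and "embedded_submanifold k N"
    and "type_map M D g ` points M = proj_point ` N"
    and "submersion_onto M (simplex_type_map M D g) N"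
  shows "continuous_map (isometry_groupoid_topology M D g) (prod_topology (mtop M) (mtop M))
           (\<lambda>\<gamma>. (src \<gamma>, tgt \<gamma>)) \<and>
         proper_map (isometry_groupoid_topology M D g) (prod_topology (mtop M) (mtop M))
           (\<lambda>\<gamma>. (src \<gamma>, tgt \<gamma>))"
proof -
  interpret sub_riemannian M D g "DIM('e) - 1"
    by unfold_locales (use assms(1) in simp_all)
  show ?thesis
    using continuous_map_isometry_groupoid proper_map_isometry_groupoid by blast
qed

end
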